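(* Let $\Sigma_1,\Sigma_2$ be $0$-asymptotically stable systems and let $\gamma,\delta>0$. Then $\Sigma_2$ is $(\gamma,\delta)$-similar to $\Sigma_1$ if and only if there exist a (symmetric) positive definite matrix $X$ and a matrix $\Pi$ such that $$\begin{bmatrix}XA^T+AX+\Pi^TB^T+B\Pi&\bar E&X\bar C^T \\ \bar E^T&-\bar Q(\gamma,\delta)&0 \\ \bar CX&0&-I\end{bmatrix}\prec0,$$ where $$A=\begin{bmatrix}A_1&0 \\ 0&A_2\end{bmatrix},\quad B=\begin{bmatrix}0 \\ E_2\end{bmatrix},\quad\bar E=\begin{bmatrix}B_1&0 \\ 0&B_2\end{bmatrix},\quad\bar C=\begin{bmatrix}C_1&-C_2\end{bmatrix},\quad\bar Q(\gamma,\delta)=\begin{bmatrix}(\gamma+\delta)I&-\gamma I \\ -\gamma I&(\gamma+\delta)I\end{bmatrix}.$$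
   Context: For $i=1,2$, $\Sigma_i$ is the continuous-time linear system $\dot x_i=A_ix_i+B_iu_i+E_id_i$, $y_i=C_ix_i$ with real constant matrices, state $x_i\in\mathbb{R}^{n_i}$, input $u_i\in\mathbb{R}^{m}$, disturbance $d_i\in\mathbb{R}^{q_i}$ and output $y_i\in\mathbb{R}^{p}$ (same $m$ and $p$ for both systems). It is $0$-asymptotically stable if $A_i$ is Hurwitz. $\mathcal{L}_2$ is the space of measurable (vector-valued) functions $u$ on $[0,\infty)$ with $\|u\|^2=\int_0^\infty|u(t)|^2\,dt<\infty$. $y_i(t;t_0,x_{i,0},u_i,d_i)$ denotes the output at time $t$ for $x_i(t_0)=x_{i,0}$, input $u_i$, disturbance $d_i$. Definition. For $\gamma,\delta>0$, $\Sigma_2$ is $(\gamma,\delta)$-similar to $\Sigma_1$ ($\Sigma_1\preccurlyeq_{\gamma,\delta}\Sigma_2$) if there exist constants $\varepsilon,\eta,\mu>0$ such that for all $u_1,u_2\in\mathcal{L}_2$ and all $d_1\in\mathcal{L}_2$ there exists $d_2\in\mathcal{L}_2$ with $$\|y_1-y_2\|^2\le\gamma\|u_1-u_2\|^2+(\delta-\varepsilon)\left\|\begin{bmatrix}u_1 \\ u_2\end{bmatrix}\right\|^2+(\mu-\varepsilon)\|d_1\|^2-\eta\|d_2\|^2,$$ where $y_i(t)=y_i(t;0,0,u_i,d_i)$. The blocks of $\bar Q$ are $m\times m$; $X$ is $(n_1+n_2)\times(n_1+n_2)$ and $\Pi$ is $q_2\times(n_1+n_2)$. $M\prec0$ means $M$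 is negative definite. *)

theory Defs
  imports "HOL-Analysis.Analysis"
begin

definition vec_append :: "'a^'m \<Rightarrow> 'a^'n \<Rightarrow> 'a^('m + 'n)" where
  "vec_append x y = (\<chi> i. case i of Inl a \<Rightarrow> x $ a | Inr b \<Rightarrow> y $ b)"

text \<open>A matrix of type \<open>'a^'c^'r\<close> has rows indexed by \<open>'r\<close> and columns by \<open>'c\<close>; it is the
  vector of its rows, so appending vectors of rows stacks matrices vertically.\<close>

abbreviation vcat :: "'a^'c^'r \<Rightarrow> 'a^'c^'s \<Rightarrow> 'a^'c^('r + 's)" where
  "vcat \<equiv> vec_append"

definition hcat :: "'a^'c^'r \<Rightarrow> 'a^'d^'r \<Rightarrow> 'a^('c + 'd)^'r" where
  "hcat M N = (\<chi> i. vec_append (M $ i) (N $ i))"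

definition block2 ::
  "'a^'c^'r \<Rightarrow> 'a^'d^'r \<Rightarrow>
   'a^'c^'s \<Rightarrow> 'a^'d^'s \<Rightarrow> 'a^('c + 'd)^('r + 's)" where
  "block2 M11 M12
          M21 M22 = vcat (hcat M11 M12) (hcat M21 M22)"

definition block3 ::
  "'a^'c^'r \<Rightarrow> 'a^'d^'r \<Rightarrow> 'a^'e^'r \<Rightarrow>
   'a^'c^'s \<Rightarrow> 'a^'d^'s \<Rightarrow> 'a^'e^'s \<Rightarrow>
   'a^'c^'t \<Rightarrow> 'a^'d^'t \<Rightarrow> 'a^'e^'t \<Rightarrow> 'a^('c + 'd + 'e)^('r + 's + 't)" where
  "block3 M11 M12 M13
          M21 M22 M23
          M31 M32 M33 =
     vcat (hcat M11 (hcat M12 M13))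
          (vcat (hcat M21 (hcat M22 M23))
                (hcat M31 (hcat M32 M33)))"

definition pos_definite :: "real^'n^'n \<Rightarrow> bool" where
  "pos_definite M \<longleftrightarrow> transpose M = M \<and> (\<forall>v. v \<noteq> 0 \<longrightarrow> 0 < v \<bullet> (M *v v))"

definition neg_definite :: "real^'n^'n \<Rightarrow> bool" where
  "neg_definite M \<longleftrightarrow> transpose M = M \<and> (\<forall>v. v \<noteq> 0 \<longrightarrow> v \<bullet> (M *v v) < 0)"

definition hurwitz :: "real^'n^'n \<Rightarrow> bool" where
  "hurwitz M \<longleftrightarrow>
     (\<forall>(z::complex) (v::complex^'n).
        v \<noteq> 0 \<and> map_matrix complex_of_real M *v v = z *s v \<longrightarrow> Re z < 0)"

definition L2 :: "(real \<Rightarrow> real^'k) set" where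
  "L2 = {u. u \<in> borel_measurable (lebesgue_on {0..}) \<and>
            integrable (lebesgue_on {0..}) (\<lambda>t. (norm (u t))\<^sup>2)}"

definition L2_norm :: "(real \<Rightarrow> real^'k) \<Rightarrow> real" where
  "L2_norm u = sqrt (integral\<^sup>L (lebesgue_on {0..}) (\<lambda>t. (norm (u t))\<^sup>2))"

text \<open>\<open>x' = A x + B u + E d\<close>, \<open>y = C x\<close>, with state, input, disturbance and output
  spaces indexed by \<open>'n\<close>, \<open>'m\<close>, \<open>'q\<close> and \<open>'p\<close>.\<close>

record ('n::finite, 'm::finite, 'q::finite, 'p::finite) lti =
  matA :: "real^'n^'n"
  matB :: "real^'m^'n"
  matE :: "real^'q^'n"
  matC :: "real^'n^'p"

definition zero_asymptotically_stable ::
  "('n::finite, 'm::finite, 'q::finite, 'p::finite) lti \<Rightarrow> bool" where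
  "zero_asymptotically_stable S \<longleftrightarrow> hurwitz (matA S)"

text \<open>As \<open>u\<close> and \<open>d\<close> are merely locally integrable, the differential equation is understood in
  the sense of Caratheodory: \<open>x\<close> is locally absolutely continuous and satisfies it almost
  everywhere, which is the integral equation below.\<close>

definition state_trajectory ::
  "('n::finite, 'm::finite, 'q::finite, 'p::finite) lti \<Rightarrow> real \<Rightarrow> real^'n \<Rightarrow>
   (real \<Rightarrow> real^'m) \<Rightarrow> (real \<Rightarrow> real^'q) \<Rightarrow> (real \<Rightarrow> real^'n) \<Rightarrow> bool" where
  "state_trajectory S t0 x0 u d x \<longleftrightarrow>
     (let f = (\<lambda>s. matA S *v x s + matB S *v u s + matE S *v d s)
      in \<forall>t\<ge>t0. f absolutely_integrable_on {t0..t} \<and> x t = x0 + integral {t0..t} f)"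

text \<open>For locally integrable \<open>u\<close> and \<open>d\<close> a trajectory exists and is unique on \<open>{t0..}\<close>, so the
  description below is proper for \<open>t \<ge> t0\<close>.\<close>

definition state_at ::
  "('n::finite, 'm::finite, 'q::finite, 'p::finite) lti \<Rightarrow> real \<Rightarrow> real^'n \<Rightarrow>
   (real \<Rightarrow> real^'m) \<Rightarrow> (real \<Rightarrow> real^'q) \<Rightarrow> real \<Rightarrow> real^'n" where
  "state_at S t0 x0 u d t = (THE z. \<exists>x. state_trajectory S t0 x0 u d x \<and> x t = z)"

definition output_at ::
  "('n::finite, 'm::finite, 'q::finite, 'p::finite) lti \<Rightarrow> real \<Rightarrow> real^'n \<Rightarrow>
   (real \<Rightarrow> real^'m) \<Rightarrow> (real \<Rightarrow> real^'q) \<Rightarrow> real \<Rightarrow> real^'p" where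
  "output_at S t0 x0 u d t = matC S *v state_at S t0 x0 u d t"

text \<open>\<open>similar_to \<gamma> \<delta> S2 S1\<close>: the second system is \<open>(\<gamma>, \<delta>)\<close>-similar to the first. An integral
  that diverges has value 0 in the library, so membership of \<open>y1 - y2\<close> in \<open>L2\<close>, implicit in
  the finiteness of its norm, is required explicitly. It is automatic for stable systems.\<close>

definition similar_to ::
  "real \<Rightarrow> real \<Rightarrow> ('n2::finite, 'm::finite, 'q2::finite, 'p::finite) lti \<Rightarrow>
   ('n1::finite, 'm, 'q1::finite, 'p) lti \<Rightarrow> bool" where
  "similar_to \<gamma> \<delta> S2 S1 \<longleftrightarrow>
     (\<exists>\<epsilon>>0. \<exists>\<eta>>0. \<exists>\<mu>>0.
       \<forall>u1\<in>L2. \<forall>u2\<in>L2. \<forall>d1\<in>L2. \<exists>d2\<in>L2.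
         let e = (\<lambda>t. output_at S1 0 0 u1 d1 t - output_at S2 0 0 u2 d2 t)
         in e \<in> L2 \<and>
            (L2_norm e)\<^sup>2 \<le> \<gamma> * (L2_norm (\<lambda>t. u1 t - u2 t))\<^sup>2
              + (\<delta> - \<epsilon>) * (L2_norm (\<lambda>t. vec_append (u1 t) (u2 t)))\<^sup>2
              + (\<mu> - \<epsilon>) * (L2_norm d1)\<^sup>2 - \<eta> * (L2_norm d2)\<^sup>2)"

definition A_joint ::
  "('n1::finite, 'm::finite, 'q1::finite, 'p::finite) lti \<Rightarrow>
   ('n2::finite, 'm, 'q2::finite, 'p) lti \<Rightarrow> real^('n1 + 'n2)^('n1 + 'n2)" where
  "A_joint S1 S2 = block2 (matA S1) 0
                          0         (matA S2)"

definition B_joint ::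
  "('n1::finite, 'm::finite, 'q1::finite, 'p::finite) lti \<Rightarrow>
   ('n2::finite, 'm, 'q2::finite, 'p) lti \<Rightarrow> real^'q2^('n1 + 'n2)" where
  "B_joint S1 S2 = vcat 0 (matE S2)"

definition E_bar ::
  "('n1::finite, 'm::finite, 'q1::finite, 'p::finite) lti \<Rightarrow>
   ('n2::finite, 'm, 'q2::finite, 'p) lti \<Rightarrow> real^('m + 'm)^('n1 + 'n2)" where
  "E_bar S1 S2 = block2 (matB S1) 0
                        0         (matB S2)"

definition C_bar ::
  "('n1::finite, 'm::finite, 'q1::finite, 'p::finite) lti \<Rightarrow>
   ('n2::finite, 'm, 'q2::finite, 'p) lti \<Rightarrow> real^('n1 + 'n2)^'p" where
  "C_bar S1 S2 = hcat (matC S1) (- matC S2)"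

text \<open>\<open>mat c\<close> is the scalar matrix \<open>c I\<close>.\<close>

definition Q_bar :: "real \<Rightarrow> real \<Rightarrow> real^('m::finite + 'm)^('m + 'm)" where
  "Q_bar \<gamma> \<delta> = block2 (mat (\<gamma> + \<delta>)) (mat (- \<gamma>))
                      (mat (- \<gamma>))    (mat (\<gamma> + \<delta>))"

end

theory Submission
  imports Defs "HOL-Computational_Algebra.Fundamental_Theorem_Algebra"
begin

text \<open>Let \<open>x\<close> be the joint state, \<open>w = (u1, u2)\<close> the joint input and \<open>d = d2\<close>, so that the difference of the outputs is
  \<open>C x\<close> with \<open>x' = A x + B d + E w + D d1\<close>. By definition of \<open>Q_bar\<close>, similarity asks that every input \<open>w\<close> (and \<open>d1\<close>)
  can be answered by some \<open>d\<close> such that the integral of \<open>(norm (C x))\<^sup>2\<close> stays strictly below that of \<open>w \<bullet> Q w\<close>, up to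
  a large multiple of \<open>(norm d1)\<^sup>2\<close>.

  Given a solution \<open>(X, \<Pi>)\<close> of the matrix inequality, the feedback \<open>d = \<Pi> X\<^sup>-\<^sup>1 x\<close> is such an answer, by the
  dissipation inequality for the storage function \<open>x \<bullet> X\<^sup>-\<^sup>1 x\<close> (\<open>lmi_sufficient\<close>).

  Conversely the answer \<open>d\<close> may depend on the whole of \<open>w\<close>, including its future, and it has to be shown that this
  is no better than a state feedback. The argument is by duality (\<open>lmi_necessary\<close>). If the matrix inequality
  has no solution, a separation argument (\<open>quadratic_alternative\<close>) produces finitely many vectors that
  describe a stationary process \<open>l\<close> of the adjoint equation \<open>l' = - A\<^sup>T l - C\<^sup>T v\<close> which satisfies \<open>B\<^sup>T l = 0\<close> and in
  which \<open>l \<bullet> E Q\<^sup>-\<^sup>1 E\<^sup>T l\<close> is on average at least as large as \<open>(norm v)\<^sup>2\<close>. With \<open>w = Q\<^sup>-\<^sup>1 E\<^sup>T l\<close> as an input, the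
  identity \<open>(x \<bullet> l)' = w \<bullet> Q w - C x \<bullet> v\<close> does not contain \<open>d\<close>, and the Cauchy-Schwarz inequality shows that, up to
  boundary terms, \<open>(norm (C x))\<^sup>2\<close> is on average at least \<open>w \<bullet> Q w\<close> whatever \<open>d\<close> is (\<open>adjoint_estimate\<close>). The boundary
  terms are controlled by the stability of \<open>A\<close> and are negligible on long time intervals, which contradicts the
  strict inequality in the definition of similarity. No process is constructed: finitely many solutions of the
  adjoint equation, which start in the given vectors, stand for it, and sums over them for its mean values (\<open>gramian_balance\<close>).\<close>

section \<open>A theorem of the alternative for quadratic inequalities\<close>

text \<open>A theorem of the alternative for one strict quadratic inequality whose form depends affinely on a
  parameter \<open>x\<close>: if no \<open>x\<close> makes \<open>q v + x \<bullet> l v\<close> negative for all nonzero \<open>v\<close>, then finitely many vectors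
  certify it. Linear matrix inequalities have this shape. The certificate is a convex combination of values
  \<open>(q v, l v)\<close> at unit vectors; spreading the weights as square roots over the vectors, which is possible by
  homogeneity, expresses it as plain sums, so no factorisation of semidefinite matrices is needed.\<close>

lemma quadratic_alternative:
  fixes q :: "'v::euclidean_space \<Rightarrow> real" and l :: "'v \<Rightarrow> 'w::euclidean_space"
  assumes cq: "continuous_on UNIV q" and cl: "continuous_on UNIV l"
    and hq: "\<And>c v. q (c *\<^sub>R v) = c\<^sup>2 * q v" and hl: "\<And>c v. l (c *\<^sub>R v) = c\<^sup>2 *\<^sub>R l v"
    and infeasible: "\<And>x. \<exists>v. v \<noteq> 0 \<and> q v + x \<bullet> l v \<ge> 0"
  shows "\<exists>(k::nat) z. (\<Sum>j<k. (norm (z j))\<^sup>2) = 1 \<and> (\<Sum>j<k. l (z j)) = 0 \<and> (\<Sum>j<k. q (z j)) \<ge> 0"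
proof -
  define D where "D = (\<lambda>v. (q v, l v)) ` sphere 0 1"
  define R where "R = {0::real..} \<times> {0::'w}"
  have cD: "compact D"
    unfolding D_def
    by (intro compact_continuous_image continuous_on_Pair continuous_on_subset[OF cq]
        continuous_on_subset[OF cl] compact_sphere) auto
  have neD: "D \<noteq> {}" by (simp add: D_def)
  have "convex hull D \<inter> R \<noteq> {}"
  proof
    assume "convex hull D \<inter> R = {}"
    moreover have "convex R" "closed R"
      by (auto simp: R_def intro!: convex_Times closed_Times convex_real_interval)
    ultimately obtain h c where h: "\<forall>y\<in>convex hull D. h \<bullet> y < c" "\<forall>y\<in>R. h \<bullet> y > c"
      using separating_hyperplane_compact_closed[of "convex hull D" R] cD neD
      by (metis compact_convex_hull convex_convex_hull convex_hull_eq_empty)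
    obtain a x where hx: "h = (a, x)" by (cases h)
    \<comment> \<open>The point \<open>(0, 0)\<close> of \<open>R\<close> forces \<open>c < 0\<close>; the
      points \<open>(r, 0)\<close> with large \<open>r\<close> force \<open>a \<ge> 0\<close>.\<close>
    have c0: "c < 0" using h(2)[rule_format, of "(0,0)"] unfolding hx R_def by simp
    have a0: "a \<ge> 0"
    proof (rule ccontr)
      assume "\<not> a \<ge> 0"
      then have "h \<bullet> (c / a, 0) > c" using h(2) c0
        by (auto simp: R_def divide_nonpos_neg)
      then show False using \<open>\<not> a \<ge> 0\<close> by (auto simp: hx)
    qed
    have sep: "a * q v + x \<bullet> l v < c" if "norm v = 1" for v
    proof -
      have "(q v, l v) \<in> convex hull D" using that by (intro hull_inc) (auto simp: D_def)
      then show ?thesis using h(1) by (auto simp: hx)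
    qed
    have "bounded (q ` sphere 0 1)"
      by (intro compact_imp_bounded compact_continuous_image continuous_on_subset[OF cq]) auto
    then obtain b where "\<forall>y\<in>q ` sphere 0 1. norm y \<le> b" unfolding bounded_iff by blast
    then have b: "\<bar>q v\<bar> \<le> b" if "norm v = 1" for v using that by auto
    \<comment> \<open>A functional with \<open>a > 0\<close> is scaled to \<open>a = 1\<close>; one with
      \<open>a = 0\<close> is scaled so much that it outweighs \<open>q\<close>, which is bounded on the
      sphere.\<close>
    define y where "y = (if a = 0 then ((\<bar>b\<bar> + 1) / (- c)) *\<^sub>R x else (1 / a) *\<^sub>R x)"
    have neg: "q v + y \<bullet> l v < 0" if v: "norm v = 1" for v
    proof (cases "a = 0")
      case True
      have "((\<bar>b\<bar> + 1) / (- c)) * (x \<bullet> l v) \<le> ((\<bar>b\<bar> + 1) / (- c)) * c"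
        using sep[OF v] True c0 by (intro mult_left_mono) (auto simp: field_simps)
      also have "\<dots> = - (\<bar>b\<bar> + 1)" using c0 by (simp add: field_simps)
      finally show ?thesis using b[OF v] True unfolding y_def by simp
    next
      case False
      then show ?thesis using sep[OF v] a0 c0 unfolding y_def
        by (simp add: field_simps)
    qed
    obtain v where v: "v \<noteq> 0" "q v + y \<bullet> l v \<ge> 0" using infeasible by blast
    have "q (inverse (norm v) *\<^sub>R v) + y \<bullet> l (inverse (norm v) *\<^sub>R v)
        = (inverse (norm v))\<^sup>2 * (q v + y \<bullet> l v)"
      unfolding hq hl by (simp add: algebra_simps)
    also have "\<dots> \<ge> 0" using v by simp
    finally show False using neg[of "inverse (norm v) *\<^sub>R v"] v by simp
  qed
  then obtain s where "s \<in> convex hull D" "s \<in> R" by blast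
  then have s: "s \<in> convex hull D" "fst s \<ge> 0" "snd s = 0"
    by (auto simp: R_def)
  from s(1) obtain k u y where u: "\<forall>i\<in>{1::nat..k}. 0 \<le> u i \<and> y i \<in> D" "sum u {1..k} = 1"
      "(\<Sum>i = 1..k. u i *\<^sub>R y i) = s"
    unfolding convex_hull_indexed by blast
  have "\<forall>i\<in>{1..k}. \<exists>v. norm v = 1 \<and> y i = (q v, l v)"
  proof
    fix i assume "i \<in> {1..k}"
    then have "y i \<in> (\<lambda>v. (q v, l v)) ` sphere 0 1" using u(1) by (simp add: D_def)
    then show "\<exists>v. norm v = 1 \<and> y i = (q v, l v)" by (elim imageE) auto
  qed
  then obtain v where v: "\<And>i. i \<in> {1..k} \<Longrightarrow> norm (v i) = 1 \<and> y i = (q (v i), l (v i))"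
    by metis
  define z where "z j = sqrt (u (Suc j)) *\<^sub>R v (Suc j)" for j
  have zn: "(norm (z j))\<^sup>2 = u (Suc j)" "l (z j) = snd (u (Suc j) *\<^sub>R y (Suc j))"
      "q (z j) = fst (u (Suc j) *\<^sub>R y (Suc j))" if "j < k" for j
    using that u(1)[rule_format, of "Suc j"] v[of "Suc j"]
    by (auto simp: z_def hq hl power_mult_distrib)
  have sh: "(\<Sum>j<k. f (Suc j)) = (\<Sum>i = 1..k. f i)" for f :: "nat \<Rightarrow> 'b::comm_monoid_add"
    by (simp add: sum.atLeast1_atMost_eq)
  have s': "(\<Sum>i = 1..k. fst (u i *\<^sub>R y i)) = fst s" "(\<Sum>i = 1..k. snd (u i *\<^sub>R y i)) = snd s"
    by (simp_all only: u(3)[symmetric] fst_sum snd_sum)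
  show ?thesis
  proof (intro exI conjI)
    show "(\<Sum>j<k. (norm (z j))\<^sup>2) = 1" using zn u(2) sh[of u] by simp
    show "(\<Sum>j<k. l (z j)) = 0"
      using zn(2) sh[of "\<lambda>i. snd (u i *\<^sub>R y i)"] s(3) s' by simp
    show "(\<Sum>j<k. q (z j)) \<ge> 0"
      using zn(3) sh[of "\<lambda>i. fst (u i *\<^sub>R y i)"] s(2) s' by simp
  qed
qed

section \<open>Rank-one matrices and eigenvectors modulo a subspace\<close>

text \<open>The rank-one matrix \<open>a b\<^sup>T\<close>.\<close>

definition outer :: "real^'n \<Rightarrow> real^'m \<Rightarrow> real^'m^'n" where
  "outer a b = (\<chi> i j. a $ i * b $ j)"

lemma inner_outer: "X \<bullet> outer a b = a \<bullet> (X *v b)"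
  by (simp add: inner_vec_def outer_def matrix_vector_mult_def sum_distrib_left mult_ac)

lemma outer_mult_vec: "outer a b *v x = (b \<bullet> x) *\<^sub>R a"
  by (simp add: vec_eq_iff inner_vec_def outer_def matrix_vector_mult_def sum_distrib_left
      sum_distrib_right mult_ac)

lemma outer_scaleR: "outer (c *\<^sub>R a) (d *\<^sub>R b) = (c * d) *\<^sub>R outer a b"
  by (simp add: vec_eq_iff outer_def mult_ac)

lemma outer_zero [simp]: "outer 0 b = 0" "outer a 0 = 0"
  by (simp_all add: vec_eq_iff outer_def)

lemma continuous_on_outer [continuous_intros]:
  "continuous_on S f \<Longrightarrow> continuous_on S g \<Longrightarrow> continuous_on S (\<lambda>x. outer (f x) (g x))"
  unfolding outer_def by (intro continuous_intros)

lemma inner_transpose_mult: "a \<bullet> (transpose X *v b) = b \<bullet> (X *v a)" for X :: "real^'n^'m"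
  by (metis dot_lmul_matrix inner_commute transpose_matrix_vector)

lemma sum_matrix_vector_mult: "(\<Sum>j\<in>J. M j) *v x = (\<Sum>j\<in>J. M j *v (x::real^'n))"
  by (induction J rule: infinite_finite_induct) (auto simp: matrix_vector_mult_add_rdistrib)

lemma vec_map_sum:
  fixes T :: "complex^'n \<Rightarrow> complex^'n"
  assumes "\<And>x y. T (x + y) = T x + T y" and "\<And>c x. T (c *s x) = c *s T x"
  shows "T (\<Sum>i\<in>I. f i) = (\<Sum>i\<in>I. T (f i))"
proof -
  have "T 0 = 0" using assms(2)[of 0 0] by simp
  then show ?thesis by (induction I rule: infinite_finite_induct) (auto simp: assms)
qed

text \<open>An eigenvector of \<open>T\<close> in the quotient by \<open>K\<close>. For an invariant subspace \<open>K\<close> this is the usual existence of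
  eigenvectors in the quotient space, but the proof only uses that \<open>K\<close> contains 0 and is closed under scaling:
  a nonzero polynomial \<open>p\<close> of least degree with \<open>p(T) y0 \<in> K\<close> is split as \<open>(X - z) r\<close>, and \<open>y = r(T) y0\<close>.\<close>

lemma eigenvector_modulo:
  fixes T :: "complex^'n \<Rightarrow> complex^'n"
  assumes add: "\<And>x y. T (x + y) = T x + T y" and scale: "\<And>c x. T (c *s x) = c *s T x"
    and K: "0 \<in> K" and K_scale: "\<And>c y. y \<in> K \<Longrightarrow> c *s y \<in> K" and y0: "y0 \<notin> K"
  obtains z y where "y \<notin> K" and "T y - z *s y \<in> K"
proof -
  define app where "app p = (\<Sum>i\<le>degree p. coeff p i *s (T ^^ i) y0)" for p
  have app_eq: "app p = (\<Sum>i\<le>m. coeff p i *s (T ^^ i) y0)" if "degree p \<le> m" for p m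
    unfolding app_def using that
    by (intro sum.mono_neutral_left) (auto simp: coeff_eq_0)
  have app_add: "app (p + r) = app p + app r" for p r
  proof -
    define m where "m = max (degree p) (degree r)"
    have "degree (p + r) \<le> m" "degree p \<le> m" "degree r \<le> m"
      by (auto simp: m_def degree_add_le_max)
    then show ?thesis by (simp add: app_eq vector_sadd_rdistrib sum.distrib)
  qed
  have app_smult: "app (smult c p) = c *s app p" for c p
  proof -
    have "app (smult c p) = (\<Sum>i\<le>degree p. coeff (smult c p) i *s (T ^^ i) y0)"
      by (rule app_eq) simp
    then show ?thesis by (simp add: app_def vec.scale_sum_right)
  qed
  have app_shift: "app (pCons 0 p) = T (app p)" for p
  proof -
    have "app (pCons 0 p) = (\<Sum>i\<le>Suc (degree p). coeff (pCons 0 p) i *s (T ^^ i) y0)"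
      by (intro app_eq) (simp add: degree_pCons_le)
    also have "\<dots> = (\<Sum>i\<le>degree p. coeff p i *s T ((T ^^ i) y0))"
      by (subst sum.atMost_Suc_shift) simp
    also have "\<dots> = T (app p)" unfolding app_def by (simp add: vec_map_sum[of T, OF add scale] scale)
    finally show ?thesis .
  qed
  \<comment> \<open>More vectors \<open>T\<^sup>i y0\<close> than the real dimension are dependent, already with
    real coefficients.\<close>
  have ex: "\<exists>p. p \<noteq> 0 \<and> app p \<in> K"
  proof -
    define n where "n = DIM(complex^'n)"
    define f where "f i = (T ^^ i) y0" for i
    show ?thesis
    proof (cases "inj_on f {..n}")
      case False
      then obtain i j where ij: "i \<noteq> j" "f i = f j" by (auto simp: inj_on_def)
      define p where "p = monom (1::complex) i + smult (- 1) (monom 1 j)"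
      have "app (monom 1 i) = f i" for i
        by (subst app_eq[of _ i]) (auto simp: degree_monom_le f_def if_distrib[of "\<lambda>c. c *s _"] cong: if_cong)
      then have "app p = 0" unfolding p_def app_add app_smult using ij by simp
      moreover have "coeff p i = 1" using ij by (simp add: p_def)
      then have "p \<noteq> 0" by auto
      ultimately show ?thesis using K by auto
    next
      case True
      then have "card (f ` {..n}) = Suc n" by (simp add: card_image)
      then have "dependent (f ` {..n})"
        by (intro dependent_biggerset) (auto simp: n_def)
      then obtain u where u: "(\<Sum>v\<in>f ` {..n}. u v *\<^sub>R v) = 0" "\<exists>v\<in>f ` {..n}. u v \<noteq> 0"
        by (subst (asm) dependent_finite) auto
      define p where "p = (\<Sum>i\<le>n. monom (complex_of_real (u (f i))) i)"
      have co: "coeff p i = (if i \<le> n then complex_of_real (u (f i)) else 0)" for i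
        by (auto simp: p_def coeff_sum)
      then have "degree p \<le> n" by (intro degree_le) auto
      then have "app p = (\<Sum>i\<le>n. complex_of_real (u (f i)) *s f i)"
        by (subst app_eq[of _ n]) (auto simp: co f_def)
      also have "\<dots> = (\<Sum>i\<le>n. u (f i) *\<^sub>R f i)"
        by (intro sum.cong) (auto simp: vec_eq_iff scaleR_conv_of_real[where 'a = complex])
      also have "\<dots> = 0" using u(1) True by (simp add: sum.reindex)
      finally have "app p = 0" .
      moreover have "p \<noteq> 0" using u(2) co by (metis atMost_iff coeff_0 imageE of_real_eq_0_iff)
      ultimately show ?thesis using K by auto
    qed
  qed
  obtain p where p: "p \<noteq> 0 \<and> app p \<in> K"
      "\<And>r. r \<noteq> 0 \<and> app r \<in> K \<Longrightarrow> degree p \<le> degree r"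
    using ex_has_least_nat[of "\<lambda>p. p \<noteq> 0 \<and> app p \<in> K" _ degree] ex by blast
  have "degree p \<noteq> 0"
  proof
    assume d: "degree p = 0"
    then obtain c where c: "p = [:c:]" "c \<noteq> 0" using p(1) by (metis degree_eq_zeroE pCons_0_0)
    then have "app p = c *s y0" by (simp add: app_def)
    then have "(1 / c) *s (c *s y0) \<in> K" using p(1) K_scale by metis
    then show False using c y0 by simp
  qed
  then obtain z where z: "poly p z = 0"
    using fundamental_theorem_of_algebra[of p] by (auto simp: constant_degree)
  then obtain r where r: "p = [:- z, 1:] * r" using poly_eq_0_iff_dvd[of p z] by (metis dvdE)
  then have "r \<noteq> 0" using p(1) by auto
  moreover have "degree p = Suc (degree r)" unfolding r using \<open>r \<noteq> 0\<close>
    by (subst degree_mult_eq) auto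
  ultimately have "app r \<notin> K" using p(2) by fastforce
  moreover have "app p = T (app r) - z *s app r"
  proof -
    have "app p = app (pCons 0 r + smult (- z) r)" unfolding r by simp
    also have "\<dots> = T (app r) + (- z) *s app r" by (simp only: app_add app_shift app_smult)
    finally show ?thesis by simp
  qed
  ultimately show thesis using that p(1) by metis
qed

section \<open>Hurwitz matrices and the Lyapunov inequality\<close>

lemma hurwitz_transpose:
  assumes "hurwitz (A :: real^'n^'n)" shows "hurwitz (transpose A)"
  unfolding hurwitz_def
proof safe
  fix z :: complex and v :: "complex^'n"
  assume v: "v \<noteq> 0" "map_matrix complex_of_real (transpose A) *v v = z *s v"
  define N where "N = map_matrix complex_of_real A - mat z"
  have matz: "mat z *v x = z *s x" for x :: "complex^'n"
    by (simp add: vec_eq_iff matrix_vector_mult_def mat_def if_distrib if_distribR cong: if_cong)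
  have "transpose N *v v = map_matrix complex_of_real (transpose A) *v v - mat z *v v"
    unfolding N_def
    by (subst matrix_vector_mult_diff_rdistrib[symmetric])
       (rule arg_cong[where f = "\<lambda>M. M *v v"], auto simp: vec_eq_iff transpose_def mat_def map_matrix_def)
  then have "transpose N *v v = 0" using v(2) matz by simp
  then have "\<not> invertible (transpose N)"
    using v(1) by (metis inj_matrix_vector_mult injD matrix_vector_mult_0_right)
  then have "\<not> invertible N"
    by (simp add: invertible_det_nz det_transpose)
  then obtain y where y: "y \<noteq> 0" "N *v y = 0"
    by (metis invertible_left_inverse matrix_left_invertible_ker)
  then have "map_matrix complex_of_real A *v y = z *s y"
    by (simp add: N_def matrix_vector_mult_diff_rdistrib matz)
  then show "Re z < 0" using assms y(1) by (auto simp: hurwitz_def)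
qed

text \<open>With \<open>Z = \<Sum> x\<^sub>j x\<^sub>j\<^sup>T\<close> the hypothesis says that \<open>A Z + Z A\<^sup>T\<close> is the positive semidefinite matrix
  \<open>\<Sum> g\<^sub>j g\<^sub>j\<^sup>T\<close>; for Hurwitz \<open>A\<close> this forces \<open>Z = 0\<close>. The kernel of \<open>Z\<close> is invariant under \<open>A\<^sup>T\<close>; if it is not
  everything, \<open>A\<^sup>T\<close> has an eigenvector \<open>y\<close> modulo the kernel, and evaluating the identity at \<open>y\<close> shows
  that its eigenvalue has nonnegative real part. It is also an eigenvalue of \<open>A\<^sup>T\<close> itself.\<close>

lemma hurwitz_no_growing_gramian:
  fixes A :: "real^'n^'n" and k :: nat
  assumes A: "hurwitz A"
    and gram: "(\<Sum>j<k. outer (x j) (A *v x j) + outer (A *v x j) (x j)) = (\<Sum>j<k. outer (g j) (g j))"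
    and j: "j < k"
  shows "x j = 0"
proof (rule ccontr)
  assume xj: "x j \<noteq> 0"
  \<comment> \<open>The bilinear (not sesquilinear) pairing of a real with a complex vector; \<open>T\<close> is
    the complexified \<open>A\<^sup>T\<close> and \<open>K\<close> the kernel of \<open>Z\<close>.\<close>
  define p where "p v y = (\<Sum>i\<in>UNIV. complex_of_real (v $ i) * y $ i)" for v :: "real^'n" and y :: "complex^'n"
  define T where "T y = map_matrix complex_of_real (transpose A) *v y" for y :: "complex^'n"
  define K where "K = {y. \<forall>j<k. p (x j) y = 0}"
  have p_lin: "p v (a + b) = p v a + p v b" "p v (c *s a) = c * p v a" for v a b c
    by (simp_all add: p_def algebra_simps sum.distrib sum_distrib_left)
  have p_diff: "p v (a - b) = p v a - p v b" for v a b
    by (simp add: p_def algebra_simps sum_subtractf)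
  have pT: "p v (T y) = p (A *v v) y" for v y
  proof -
    have "p v (T y) = (\<Sum>i\<in>UNIV. \<Sum>l\<in>UNIV. complex_of_real (v $ i) * (complex_of_real (A $ l $ i) * y $ l))"
      by (simp add: p_def T_def matrix_vector_mult_def map_matrix_def transpose_def sum_distrib_left)
    also have "\<dots> = (\<Sum>l\<in>UNIV. \<Sum>i\<in>UNIV. complex_of_real (v $ i) * (complex_of_real (A $ l $ i) * y $ l))"
      by (rule sum.swap)
    also have "\<dots> = p (A *v v) y"
      by (simp add: p_def matrix_vector_mult_def sum_distrib_right sum_distrib_left mult_ac)
    finally show ?thesis .
  qed
  have p_outer: "(\<Sum>a\<in>UNIV. \<Sum>b\<in>UNIV. cnj (w $ a) * of_real (outer u v $ a $ b) * y $ b) = cnj (p u w) * p v y"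
    for u v w y
    by (simp add: p_def outer_def sum_product mult_ac) (rule sum.swap)
  \<comment> \<open>The hypothesis as an identity of Hermitian forms.\<close>
  have E: "(\<Sum>j<k. cnj (p (x j) w) * p (x j) (T y) + cnj (p (x j) (T w)) * p (x j) y)
      = (\<Sum>j<k. cnj (p (g j) w) * p (g j) y)" for w y
  proof -
    have *: "(\<Sum>a\<in>UNIV. \<Sum>b\<in>UNIV. cnj (w $ a) * of_real ((\<Sum>j<k. M j) $ a $ b) * y $ b)
        = (\<Sum>j<k. \<Sum>a\<in>UNIV. \<Sum>b\<in>UNIV. cnj (w $ a) * of_real (M j $ a $ b) * y $ b)"
      for M :: "nat \<Rightarrow> real^'n^'n"
      by (induction k) (simp_all add: algebra_simps sum.distrib)
    have "(\<Sum>j<k. cnj (p (x j) w) * p (A *v x j) y + cnj (p (A *v x j) w) * p (x j) y)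
      = (\<Sum>j<k. \<Sum>a\<in>UNIV. \<Sum>b\<in>UNIV. cnj (w $ a) * of_real ((outer (x j) (A *v x j) + outer (A *v x j) (x j)) $ a $ b) * y $ b)"
      unfolding p_outer[symmetric] by (simp add: algebra_simps sum.distrib)
    also have "\<dots> = (\<Sum>j<k. \<Sum>a\<in>UNIV. \<Sum>b\<in>UNIV. cnj (w $ a) * of_real (outer (g j) (g j) $ a $ b) * y $ b)"
      by (simp only: *[symmetric] gram)
    finally show ?thesis unfolding p_outer pT .
  qed
  have sq: "cnj u * u = of_real ((norm u)\<^sup>2)" for u by (simp only: mult.commute complex_norm_square)
  have inv: "T y \<in> K" if y: "y \<in> K" for y
  proof -
    have "(\<Sum>j<k. cnj (p (g j) y) * p (g j) y) = 0"
      using E[of y y] y by (simp add: K_def)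
    then have "(\<Sum>j<k. (norm (p (g j) y))\<^sup>2) = 0"
      unfolding sq of_real_sum[symmetric] of_real_eq_0_iff .
    then have g0: "p (g j) y = 0" if "j < k" for j
      using that by (subst (asm) sum_nonneg_eq_0_iff) auto
    have "(\<Sum>j<k. cnj (p (x j) (T y)) * p (x j) (T y)) = 0"
      using E[of "T y" y] y g0 by (simp add: K_def)
    then have "(\<Sum>j<k. (norm (p (x j) (T y)))\<^sup>2) = 0"
      unfolding sq of_real_sum[symmetric] of_real_eq_0_iff .
    then show ?thesis
      by (subst (asm) sum_nonneg_eq_0_iff) (auto simp: K_def)
  qed
  have K_add: "a + b \<in> K" if "a \<in> K" "b \<in> K" for a b using that by (simp add: K_def p_lin)
  have K_scale: "c *s a \<in> K" if "a \<in> K" for a c using that by (simp add: K_def p_lin)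
  have K0: "0 \<in> K" by (simp add: K_def p_def)
  obtain i where i: "x j $ i \<noteq> 0" using xj by (auto simp: vec_eq_iff)
  have "p (x j) (axis i 1) = of_real (x j $ i)"
    by (simp add: p_def axis_def if_distrib cong: if_cong)
  then have "axis i 1 \<notin> K" using i j by (auto simp: K_def)
  moreover have T_lin: "T (a + b) = T a + T b" "T (c *s a) = c *s T a" for a b c
    by (simp_all add: T_def matrix_vector_right_distrib vec.scale)
  ultimately obtain z y where y: "y \<notin> K" "T y - z *s y \<in> K"
    using eigenvector_modulo[of T K "axis i 1"] K0 K_scale by metis
  have pz: "p (x j) (T y) = z * p (x j) y" if "j < k" for j
    using y(2) that by (auto simp: K_def p_diff p_lin)
  have "(\<Sum>j<k. cnj (p (x j) y) * (z * p (x j) y) + cnj (z * p (x j) y) * p (x j) y)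
      = (\<Sum>j<k. cnj (p (g j) y) * p (g j) y)"
    using E[of y y] pz by simp
  also have "(\<Sum>j<k. cnj (p (x j) y) * (z * p (x j) y) + cnj (z * p (x j) y) * p (x j) y)
      = (\<Sum>j<k. (z + cnj z) * (cnj (p (x j) y) * p (x j) y))"
    by (intro sum.cong refl) (simp add: algebra_simps)
  also have "\<dots> = of_real (2 * Re z * (\<Sum>j<k. (norm (p (x j) y))\<^sup>2))"
    unfolding sq by (simp add: complex_add_cnj sum_distrib_left)
  finally have "2 * Re z * (\<Sum>j<k. (norm (p (x j) y))\<^sup>2) = (\<Sum>j<k. (norm (p (g j) y))\<^sup>2)"
    unfolding sq of_real_sum[symmetric] of_real_eq_iff .
  then have "2 * Re z * (\<Sum>j<k. (norm (p (x j) y))\<^sup>2) \<ge> 0" by (simp add: sum_nonneg)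
  moreover have "(\<Sum>j<k. (norm (p (x j) y))\<^sup>2) > 0"
  proof -
    obtain j where "j < k" "p (x j) y \<noteq> 0" using y(1) by (auto simp: K_def)
    then show ?thesis by (intro sum_pos2[of _ j]) auto
  qed
  ultimately have Re: "Re z \<ge> 0" by (simp add: zero_le_mult_iff)
  \<comment> \<open>If \<open>N = T - z\<close> were injective, it would map \<open>K\<close> onto
    \<open>K\<close>, and \<open>N y \<in> K\<close> would give \<open>y \<in> K\<close>.\<close>
  have "\<exists>v. v \<noteq> 0 \<and> T v = z *s v"
  proof (rule ccontr)
    assume no: "\<nexists>v. v \<noteq> 0 \<and> T v = z *s v"
    define N where "N v = T v - z *s v" for v
    have linN: "linear N"
    proof
      show "N (a + b) = N a + N b" for a b by (simp add: N_def T_lin vector_add_ldistrib)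
      have sc: "r *\<^sub>R a = of_real r *s a" for r and a :: "complex^'n"
        by (simp add: vec_eq_iff scaleR_conv_of_real[where 'a = complex])
      show "N (r *\<^sub>R a) = r *\<^sub>R N a" for r a
        by (simp add: N_def sc T_lin vec.scale_right_diff_distrib mult.commute)
    qed
    have injN: "inj N"
      using no by (subst linear_injective_0[OF linN]) (auto simp: N_def)
    have subK: "subspace K"
    proof -
      have "r *\<^sub>R a \<in> K" if "a \<in> K" for r a
      proof -
        have "r *\<^sub>R a = of_real r *s a"
          by (simp add: vec_eq_iff scaleR_conv_of_real[where 'a = complex])
        then show ?thesis using K_scale[OF that] by simp
      qed
      then show ?thesis using K0 K_add by (auto simp: subspace_def)
    qed
    have NK: "N ` K \<subseteq> K"
    proof safe
      fix a assume a: "a \<in> K"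
      have "N a = T a + (- z) *s a" by (simp add: N_def)
      then show "N a \<in> K" using K_add[OF inv[OF a] K_scale[OF a]] by metis
    qed
    have "N ` K = K"
      using NK linear_subspace_image[OF linN subK] subK dim_image_eq[OF linN, of K] injN
      by (intro subspace_dim_equal) (auto simp: inj_on_subset)
    moreover have "N y \<in> K" using y(2) by (simp add: N_def)
    ultimately obtain b where "b \<in> K" "N y = N b" by auto
    then show False using injN y(1) by (auto dest: injD)
  qed
  then obtain v where "v \<noteq> 0" "T v = z *s v" by blast
  then have "Re z < 0" using hurwitz_transpose[OF A] by (auto simp: hurwitz_def T_def)
  then show False using Re by simp
qed

text \<open>Lyapunov's theorem: the alternative to a solution of the Lyapunov inequality is a certificate that
  the previous lemma excludes.\<close>

lemma hurwitz_lyapunov: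
  fixes A :: "real^'n^'n"
  assumes A: "hurwitz A"
  obtains P where "pos_definite P" and "\<And>x. x \<noteq> 0 \<Longrightarrow> x \<bullet> (P *v (A *v x)) < 0"
proof -
  define l where "l v = (case v of (x, g) \<Rightarrow> outer x (A *v x) + outer (A *v x) x - outer g g)" for v
  have "\<exists>X. \<forall>v. v \<noteq> 0 \<longrightarrow> X \<bullet> l v < 0"
  proof (rule ccontr)
    assume "\<nexists>X. \<forall>v. v \<noteq> 0 \<longrightarrow> X \<bullet> l v < 0"
    then have inf: "\<exists>v. v \<noteq> 0 \<and> 0 + X \<bullet> l v \<ge> 0" for X by (auto simp: not_less)
    have cl: "continuous_on UNIV l" unfolding l_def case_prod_beta
      by (intro continuous_intros linear_continuous_on_compose[OF _ matrix_vector_mul_linear])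
    have hl: "l (c *\<^sub>R v) = c\<^sup>2 *\<^sub>R l v" for c v
      by (cases v) (simp add: l_def matrix_vector_mult_scaleR outer_scaleR power2_eq_square algebra_simps)
    obtain k :: nat and z where z: "(\<Sum>j<k. (norm (z j))\<^sup>2) = 1" "(\<Sum>j<k. l (z j)) = 0"
      using quadratic_alternative[of "\<lambda>_. 0" l, OF continuous_on_const cl _ hl inf] by auto
    define x where "x j = fst (z j)" for j
    define g where "g j = snd (z j)" for j
    have "(\<Sum>j<k. outer (x j) (A *v x j) + outer (A *v x j) (x j)) = (\<Sum>j<k. outer (g j) (g j))"
      using z(2) by (simp add: l_def x_def g_def case_prod_beta sum_subtractf)
    from hurwitz_no_growing_gramian[OF A this] have x0: "x j = 0" if "j < k" for j using that .
    then have "(\<Sum>j<k. outer (g j) (g j)) = 0"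
      using z(2) by (simp add: l_def x_def g_def case_prod_beta sum_subtractf outer_def vec_eq_iff)
    then have "(\<Sum>j<k. mat 1 \<bullet> outer (g j) (g j)) = 0" by (simp flip: inner_sum_right)
    then have "(\<Sum>j<k. (norm (g j))\<^sup>2) = 0" by (simp add: inner_outer power2_norm_eq_inner)
    then have "(norm (g j))\<^sup>2 = 0" if "j < k" for j
      using that by (subst (asm) sum_nonneg_eq_0_iff) auto
    then have "(norm (z j))\<^sup>2 = 0" if "j < k" for j
      using that x0[OF that] by (auto simp: x_def g_def norm_prod_def)
    then show False using z(1) by simp
  qed
  then obtain X where X: "\<And>v. v \<noteq> 0 \<Longrightarrow> X \<bullet> l v < 0" by blast
  define P where "P = X + transpose X"
  have P: "a \<bullet> (P *v b) = a \<bullet> (X *v b) + b \<bullet> (X *v a)" for a b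
    by (simp add: P_def matrix_vector_mult_add_rdistrib inner_add_right inner_transpose_mult del: transpose_matrix_vector)
  show thesis
  proof (rule that)
    show "pos_definite P" unfolding pos_definite_def
    proof safe
      show "transpose P = P" by (simp add: P_def transpose_def vec_eq_iff)
      show "0 < v \<bullet> (P *v v)" if "v \<noteq> 0" for v
        using X[of "(0, v)"] that by (simp add: P l_def inner_outer inner_diff_right zero_prod_def inner_add_right)
    qed
    show "x \<bullet> (P *v (A *v x)) < 0" if "x \<noteq> 0" for x
      using X[of "(x, 0)"] that by (simp add: P l_def inner_outer inner_diff_right zero_prod_def inner_add_right)
  qed
qed

section \<open>The matrix exponential\<close>

lemma bounded_bilinear_matrix_matrix: "bounded_bilinear ((**) :: real^'n^'m \<Rightarrow> real^'p^'n \<Rightarrow> real^'p^'m)"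
  unfolding bilinear_conv_bounded_bilinear[symmetric] bilinear_def
  by (auto intro!: linearI simp: vec_eq_iff matrix_matrix_mult_def algebra_simps sum.distrib sum_distrib_left)

lemma bounded_bilinear_matrix_vector: "bounded_bilinear ((*v) :: real^'n^'m \<Rightarrow> real^'n \<Rightarrow> real^'m)"
  unfolding bilinear_conv_bounded_bilinear[symmetric] bilinear_def
  by (auto intro!: linearI simp: matrix_vector_right_distrib matrix_vector_mult_add_rdistrib
      scaleR_matrix_vector_assoc matrix_vector_mult_scaleR)

text \<open>Powers of a square matrix, and the matrix exponential \<open>expm M t = e\<^bsup>tM\<^esup>\<close> as a power series in \<open>t\<close>.\<close>

primrec mpow :: "real^'n^'n \<Rightarrow> nat \<Rightarrow> real^'n^'n" where
  "mpow M 0 = mat 1"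
| "mpow M (Suc k) = M ** mpow M k"

definition expm :: "real^'n^'n \<Rightarrow> real \<Rightarrow> real^'n^'n" where
  "expm M t = (\<Sum>k. (t ^ k / fact k) *\<^sub>R mpow M k)"

lemma expm_summable: "summable (\<lambda>k. (t ^ k / fact k) *\<^sub>R mpow (M :: real^'n^'n) k)"
proof -
  obtain K where K: "K > 0" "\<And>(a::real^'n^'n) (b::real^'n^'n). norm (a ** b) \<le> norm a * norm b * K"
    using bounded_bilinear.pos_bounded[OF bounded_bilinear_matrix_matrix] by metis
  define c where "c = norm M * K"
  have c: "c \<ge> 0" using K by (simp add: c_def)
  have P: "norm (mpow M k) \<le> c ^ k * norm (mat 1 :: real^'n^'n)" for k
  proof (induction k)
    case (Suc k)
    have "norm (M ** mpow M k) \<le> c * norm (mpow M k)"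
      using K(2)[of M "mpow M k"] by (simp add: c_def mult_ac)
    also have "\<dots> \<le> c * (c ^ k * norm (mat 1 :: real^'n^'n))"
      using Suc c by (intro mult_left_mono)
    finally show ?case by simp
  qed simp
  have "summable (\<lambda>k. inverse (fact k) * (\<bar>t\<bar> * c) ^ k * norm (mat 1 :: real^'n^'n))"
    by (intro summable_mult2 summable_exp)
  then show ?thesis
  proof (rule summable_comparison_test'[where N = 0])
    fix k
    have "norm ((t ^ k / fact k) *\<^sub>R mpow M k)
        \<le> (\<bar>t\<bar> ^ k / fact k) * (c ^ k * norm (mat 1 :: real^'n^'n))"
      using mult_left_mono[OF P[of k], of "\<bar>t\<bar> ^ k / fact k"] by (simp add: power_abs)
    then show "norm ((t ^ k / fact k) *\<^sub>R mpow M k)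
        \<le> inverse (fact k) * (\<bar>t\<bar> * c) ^ k * norm (mat 1 :: real^'n^'n)"
      by (simp add: power_mult_distrib divide_inverse mult_ac)
  qed
qed

lemma expm_0 [simp]: "expm M 0 = mat 1"
proof -
  have "(\<lambda>k. (0 ^ k / fact k) *\<^sub>R mpow M k) sums ((0 ^ 0 / fact 0) *\<^sub>R mpow M 0)"
    by (rule sums_single[where f = "\<lambda>k. (0 ^ k / fact k) *\<^sub>R mpow M k" and i = 0, THEN sums_cong[THEN iffD1, rotated]])
       (auto simp: power_0_left)
  then show ?thesis unfolding expm_def by (simp add: sums_iff)
qed

lemma expm_commute: "expm M t ** M = M ** expm M t"
proof -
  have pc: "mpow M k ** M = M ** mpow M k" for k
    by (induction k) (simp_all add: matrix_mul_assoc[symmetric])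
  have "expm M t ** M = (\<Sum>k. ((t ^ k / fact k) *\<^sub>R mpow M k) ** M)"
    unfolding expm_def
    by (rule bounded_linear.suminf[OF bounded_bilinear.bounded_linear_left[OF bounded_bilinear_matrix_matrix] expm_summable])
  also have "\<dots> = (\<Sum>k. M ** ((t ^ k / fact k) *\<^sub>R mpow M k))"
    using pc by (simp add: bounded_bilinear.scaleR_left[OF bounded_bilinear_matrix_matrix]
        bounded_bilinear.scaleR_right[OF bounded_bilinear_matrix_matrix])
  also have "\<dots> = M ** expm M t"
    unfolding expm_def
    by (rule bounded_linear.suminf[OF bounded_bilinear.bounded_linear_right[OF bounded_bilinear_matrix_matrix] expm_summable, symmetric])
  finally show ?thesis .
qed

lemma expm_has_vector_derivative:
  fixes M :: "real^'n^'n"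
  shows "(expm M has_vector_derivative M ** expm M t) (at t within S)"
  unfolding has_vector_derivative_def
proof (subst has_derivative_componentwise_within, rule ballI)
  fix b :: "real^'n^'n"
  define c where "c k = (mpow M k \<bullet> b) / fact k" for k
  have ser: "X t \<bullet> b = (\<Sum>k. (Y k t) \<bullet> b)" if "summable (\<lambda>k. Y k t)" "X t = (\<Sum>k. Y k t)"
    for X :: "real \<Rightarrow> real^'n^'n" and Y t
    using that bounded_linear.suminf[OF bounded_linear_inner_left] by metis
  have e: "expm M t \<bullet> b = (\<Sum>k. c k * t ^ k)" for t
    unfolding expm_def
    by (subst bounded_linear.suminf[OF bounded_linear_inner_left expm_summable])
       (simp add: c_def mult_ac)
  have sm: "summable (\<lambda>k. c k * t ^ k)" for t
    using bounded_linear.summable[OF bounded_linear_inner_left expm_summable[of t M], of b]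
    by (simp add: c_def mult_ac)
  have d: "diffs c k * t ^ k = (M ** ((t ^ k / fact k) *\<^sub>R mpow M k)) \<bullet> b" for k t
  proof -
    have "diffs c k = (M ** mpow M k) \<bullet> b / fact k"
      by (simp add: diffs_def c_def del: of_nat_Suc)
    then show ?thesis
      by (simp add: bounded_bilinear.scaleR_right[OF bounded_bilinear_matrix_matrix])
  qed
  have "(M ** expm M t) \<bullet> b = (\<Sum>k. (M ** ((t ^ k / fact k) *\<^sub>R mpow M k)) \<bullet> b)"
    unfolding expm_def
    by (subst bounded_linear.suminf[OF bounded_bilinear.bounded_linear_right[OF bounded_bilinear_matrix_matrix] expm_summable])
       (rule bounded_linear.suminf[OF bounded_linear_inner_left
          bounded_linear.summable[OF bounded_bilinear.bounded_linear_right[OF bounded_bilinear_matrix_matrix] expm_summable]])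
  then have "((\<lambda>t. \<Sum>k. c k * t ^ k) has_real_derivative (M ** expm M t) \<bullet> b) (at t)"
    using termdiffs_strong_converges_everywhere[OF sm, of t] by (simp add: d)
  then have "((\<lambda>t. expm M t \<bullet> b) has_real_derivative (M ** expm M t) \<bullet> b) (at t within S)"
    unfolding e by (rule has_field_derivative_at_within)
  then show "((\<lambda>x. expm M x \<bullet> b) has_derivative (\<lambda>x. (x *\<^sub>R (M ** expm M t)) \<bullet> b)) (at t within S)"
    by (simp add: has_field_derivative_def mult.commute[of _ "(M ** expm M t) \<bullet> b"])
qed

lemma expm_minus_has_vector_derivative:
  "((\<lambda>t. expm M (- t)) has_vector_derivative - (M ** expm M (- t))) (at t within S)"
proof -
  have "((\<lambda>t. expm M (- t)) has_vector_derivative (- 1) *\<^sub>R (M ** expm M (- t))) (at t within S)"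
    by (rule vector_diff_chain_within[unfolded o_def, where f = uminus])
       (auto intro!: derivative_eq_intros expm_has_vector_derivative)
  then show ?thesis by simp
qed

lemma expm_inverse: "expm M t ** expm M (- t) = mat 1"
proof -
  have "((\<lambda>t. expm M t ** expm M (- t)) has_derivative (\<lambda>h. 0)) (at t within UNIV)" for t
  proof -
    have "expm M t ** - (M ** expm M (- t)) + M ** expm M t ** expm M (- t) = 0"
      by (simp add: matrix_mul_assoc expm_commute bounded_bilinear.minus_right[OF bounded_bilinear_matrix_matrix])
    then show ?thesis
      using bounded_bilinear.has_vector_derivative[OF bounded_bilinear_matrix_matrix
         expm_has_vector_derivative[of M t UNIV] expm_minus_has_vector_derivative[of M t UNIV]]
      by (simp add: has_vector_derivative_def)
  qed
  then obtain c where "\<And>t. expm M t ** expm M (- t) = c"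
    using has_derivative_zero_constant[of UNIV "\<lambda>t. expm M t ** expm M (- t)"] by auto
  from this[of 0] this[of t] show ?thesis by simp
qed

lemma continuous_on_expm [continuous_intros]:
  "continuous_on S f \<Longrightarrow> continuous_on S (\<lambda>t. expm M (f t))"
proof -
  have "continuous_on UNIV (expm M)"
    by (rule continuous_on_vector_derivative) (rule expm_has_vector_derivative)
  then show "continuous_on S f \<Longrightarrow> continuous_on S (\<lambda>t. expm M (f t))"
    by (rule continuous_on_compose2) auto
qed

section \<open>The product rule for indefinite integrals\<close>

lemma absolutely_integrable_continuous_product:
  fixes h :: "'a::euclidean_space \<Rightarrow> 'b::euclidean_space \<Rightarrow> 'c::euclidean_space"
  assumes "bounded_bilinear h" and "continuous_on {a..b::real} f" and "g absolutely_integrable_on {a..b}"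
  shows "(\<lambda>x. h (f x) (g x)) absolutely_integrable_on {a..b}"
proof (rule absolutely_integrable_bounded_measurable_product[where h = h and f = f and g = g])
  show "bilinear h" using assms(1) by (simp add: bilinear_conv_bounded_bilinear)
  show "bounded (f ` {a..b})"
    using assms(2) by (intro compact_imp_bounded compact_continuous_image) auto
  show "f \<in> borel_measurable (lebesgue_on {a..b})"
    using assms(2) by (intro continuous_imp_measurable_on_sets_lebesgue) auto
qed (use assms in auto)

text \<open>The product rule for indefinite integrals of Lebesgue integrable functions, that is, for absolutely
  continuous functions, which need not be differentiable everywhere. On a short interval the defect of the
  rule is at most the oscillation of \<open>F\<close> and \<open>G\<close> times the integral of \<open>norm f + norm g\<close>; as the latter is
  additive, the local bounds add up to an arbitrarily small bound on the whole interval.\<close>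

lemma has_integral_product_rule:
  fixes h :: "'a::euclidean_space \<Rightarrow> 'b::euclidean_space \<Rightarrow> 'c::euclidean_space"
    and f F :: "real \<Rightarrow> 'a" and g G :: "real \<Rightarrow> 'b"
  assumes h: "bounded_bilinear h" and T: "0 \<le> T"
    and f: "f absolutely_integrable_on {0..T}" and g: "g absolutely_integrable_on {0..T}"
    and F: "\<And>t. t \<in> {0..T} \<Longrightarrow> F t = F 0 + integral {0..t} f"
    and G: "\<And>t. t \<in> {0..T} \<Longrightarrow> G t = G 0 + integral {0..t} g"
  shows "(\<lambda>s. h (F s) (g s) + h (f s) (G s)) absolutely_integrable_on {0..T}"
    and "((\<lambda>s. h (F s) (g s) + h (f s) (G s)) has_integral h (F T) (G T) - h (F 0) (G 0)) {0..T}"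
proof -
  interpret h: bounded_bilinear h by (rule h)
  have fi: "f integrable_on {0..T}" and gi: "g integrable_on {0..T}"
    using f g absolutely_integrable_on_def by blast+
  have cF: "continuous_on {0..T} F"
    using continuous_on_add[OF continuous_on_const[of _ "F 0"] indefinite_integral_continuous_1[OF fi]]
    by (rule continuous_on_eq) (rule F[symmetric])
  have cG: "continuous_on {0..T} G"
    using continuous_on_add[OF continuous_on_const[of _ "G 0"] indefinite_integral_continuous_1[OF gi]]
    by (rule continuous_on_eq) (rule G[symmetric])
  define k where "k s = h (F s) (g s) + h (f s) (G s)" for s
  have k: "k absolutely_integrable_on {0..T}"
    unfolding k_def
    using absolutely_integrable_continuous_product[OF h cF g]
      absolutely_integrable_continuous_product[OF bounded_bilinear.flip[OF h] cG f]
    by (rule set_integral_add(1))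
  then show "(\<lambda>s. h (F s) (g s) + h (f s) (G s)) absolutely_integrable_on {0..T}"
    by (simp add: k_def[abs_def])
  have ki: "k integrable_on {0..T}" using k absolutely_integrable_on_def by blast
  define m where "m s = norm (f s) + norm (g s)" for s
  have m: "m integrable_on {0..T}"
    unfolding m_def using f g
    by (auto simp: absolutely_integrable_on_def intro!: Henstock_Kurzweil_Integration.integrable_add)
  obtain K where K: "K > 0" "\<And>a b. norm (h a b) \<le> norm a * norm b * K"
    using h.pos_bounded by metis
  have sub: "integral {a..b} \<phi> = integral {0..b} \<phi> - integral {0..a} \<phi>"
    if "\<phi> integrable_on {0..T}" "0 \<le> a" "a \<le> b" "b \<le> T"
    for \<phi> :: "real \<Rightarrow> 'z::euclidean_space" and a b
  proof -
    have "\<phi> integrable_on {0..b}" by (rule integrable_subinterval_real[OF that(1)]) (use that in auto)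
    then have "integral {0..a} \<phi> + integral {a..b} \<phi> = integral {0..b} \<phi>"
      using that Henstock_Kurzweil_Integration.integral_combine by blast
    then show ?thesis by (simp add: algebra_simps)
  qed
  define H where "H t = h (F t) (G t) - integral {0..t} k" for t
  have bound: "norm (H T - H 0) \<le> e * K * integral {0..T} m" if e: "e > 0" for e
  proof -
    define Q where "Q a b \<longleftrightarrow> (0 \<le> a \<and> b \<le> T \<and> a \<le> b \<longrightarrow> norm (H b - H a) \<le> e * K * integral {a..b} m)" for a b
    have "Q 0 T" using T
    proof (induction rule: Bolzano)
      case (trans a b c)
      show ?case unfolding Q_def
      proof
        assume abc: "0 \<le> a \<and> c \<le> T \<and> a \<le> c"
        have "norm (H c - H a) \<le> norm (H b - H a) + norm (H c - H b)"
          using norm_triangle_ineq[of "H b - H a" "H c - H b"] by simp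
        also have "\<dots> \<le> e * K * integral {a..b} m + e * K * integral {b..c} m"
          using trans abc unfolding Q_def by (intro add_mono) auto
        also have "\<dots> = e * K * integral {a..c} m"
          using trans(3,4) abc by (simp add: sub[OF m, of a b] sub[OF m, of b c] sub[OF m, of a c] algebra_simps)
        finally show "norm (H c - H a) \<le> e * K * integral {a..c} m" .
      qed
    next
      case (local x)
      then have x: "x \<in> {0..T}" by simp
      obtain d1 where d1: "d1 > 0" "\<And>y. y \<in> {0..T} \<Longrightarrow> dist y x < d1 \<Longrightarrow> dist (F y) (F x) < e / 2"
        using cF x e unfolding continuous_on_iff by (meson half_gt_zero)
      obtain d2 where d2: "d2 > 0" "\<And>y. y \<in> {0..T} \<Longrightarrow> dist y x < d2 \<Longrightarrow> dist (G y) (G x) < e / 2"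
        using cG x e unfolding continuous_on_iff by (meson half_gt_zero)
      show ?case
      proof (intro exI[of _ "min d1 d2"] conjI allI impI)
        show "0 < min d1 d2" using d1 d2 by simp
        fix a b assume ab: "a \<le> x \<and> x \<le> b \<and> b - a < min d1 d2"
        show "Q a b" unfolding Q_def
        proof
          assume ab': "0 \<le> a \<and> b \<le> T \<and> a \<le> b"
          have near: "norm (F s - F s') \<le> e" "norm (G s - G s') \<le> e" if "s \<in> {a..b}" "s' \<in> {a..b}" for s s'
          proof -
            have s: "s \<in> {0..T}" "dist s x < d1" "dist s x < d2" "s' \<in> {0..T}" "dist s' x < d1" "dist s' x < d2"
              using that ab ab' by (auto simp: dist_real_def)
            have "dist (F s) (F s') < e"
              using d1(2)[OF s(1,2)] d1(2)[OF s(4,5)] by (metis dist_triangle_half_l)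
            then show "norm (F s - F s') \<le> e" by (simp add: dist_norm)
            have "dist (G s) (G s') < e"
              using d2(2)[OF s(1,3)] d2(2)[OF s(4,6)] by (metis dist_triangle_half_l)
            then show "norm (G s - G s') \<le> e" by (simp add: dist_norm)
          qed
          have ii: "\<phi> integrable_on {a..b}" if "\<phi> integrable_on {0..T}" for \<phi> :: "real \<Rightarrow> 'z::euclidean_space"
            by (rule integrable_subinterval_real[OF that]) (use ab' in auto)
          have Fab: "F b - F a = integral {a..b} f" and Gab: "G b - G a = integral {a..b} g"
            using F[of a] F[of b] G[of a] G[of b] ab' sub[OF fi, of a b] sub[OF gi, of a b]
            by (metis (no_types, opaque_lifting) add_diff_cancel_left atLeastAtMost_iff order_trans)+
          have i1: "((\<lambda>s. h (f s) (G b)) has_integral h (F b - F a) (G b)) {a..b}"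
            unfolding Fab
            using has_integral_linear[OF integrable_integral[OF ii[OF fi]] h.bounded_linear_left[of "G b"]]
            by (simp add: o_def)
          have i2: "((\<lambda>s. h (F a) (g s)) has_integral h (F a) (G b - G a)) {a..b}"
            unfolding Gab
            using has_integral_linear[OF integrable_integral[OF ii[OF gi]] h.bounded_linear_right[of "F a"]]
            by (simp add: o_def)
          have i3: "(k has_integral (integral {0..b} k - integral {0..a} k)) {a..b}"
            using integrable_integral[OF ii[OF ki]] sub[OF ki, of a b] ab' by simp
          have i: "((\<lambda>s. h (f s) (G b) + h (F a) (g s) - k s) has_integral (H b - H a)) {a..b}"
            using has_integral_diff[OF has_integral_add[OF i1 i2] i3]
            by (simp add: H_def h.diff_left h.diff_right algebra_simps)
          have "norm (integral {a..b} (\<lambda>s. h (f s) (G b) + h (F a) (g s) - k s)) \<le> integral {a..b} (\<lambda>s. e * K * m s)"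
          proof (rule integral_norm_bound_integral)
            show "(\<lambda>s. h (f s) (G b) + h (F a) (g s) - k s) integrable_on {a..b}" using i by blast
            show "(\<lambda>s. e * K * m s) integrable_on {a..b}" using ii[OF m] by (rule integrable_on_mult_right)
            fix s assume s: "s \<in> {a..b}"
            have "h (f s) (G b) + h (F a) (g s) - k s = h (f s) (G b - G s) + h (F a - F s) (g s)"
              by (simp add: k_def h.diff_left h.diff_right)
            also have "norm \<dots> \<le> norm (f s) * norm (G b - G s) * K + norm (F a - F s) * norm (g s) * K"
              by (rule norm_triangle_le[OF add_mono[OF K(2) K(2)]])
            also have "\<dots> \<le> norm (f s) * e * K + e * norm (g s) * K"
              using near[of b s] near[of a s] s ab' K(1)
              by (intro add_mono mult_right_mono mult_left_mono) auto
            finally show "norm (h (f s) (G b) + h (F a) (g s) - k s) \<le> e * K * m s"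
              by (simp add: m_def algebra_simps)
          qed
          then show "norm (H b - H a) \<le> e * K * integral {a..b} m"
            using i by (simp add: integral_unique)
        qed
      qed
    qed
    then show ?thesis using T by (simp add: Q_def)
  qed
  have "norm (H T - H 0) \<le> 0"
  proof (rule field_le_epsilon)
    fix e :: real assume e: "e > 0"
    define c where "c = K * integral {0..T} m + 1"
    have i0: "integral {0..T} m \<ge> 0" by (rule integral_nonneg[OF m]) (simp add: m_def)
    then have c: "c > 0" using K(1) by (simp add: c_def add_nonneg_pos)
    have "norm (H T - H 0) \<le> (e / c) * (K * integral {0..T} m)"
      using bound[of "e / c"] e c by (simp add: mult.assoc)
    also have "\<dots> \<le> (e / c) * c" using e c by (intro mult_left_mono) (auto simp: c_def)
    finally show "norm (H T - H 0) \<le> 0 + e" using c by simp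
  qed
  then have "H T = H 0" by simp
  then have "integral {0..T} k = h (F T) (G T) - h (F 0) (G 0)" by (simp add: H_def algebra_simps)
  then show "((\<lambda>s. h (F s) (g s) + h (f s) (G s)) has_integral h (F T) (G T) - h (F 0) (G 0)) {0..T}"
    using integrable_integral[OF ki] by (simp add: k_def[abs_def])
qed

section \<open>Linear differential equations with integrable forcing\<close>

text \<open>The function \<open>x\<close> solves \<open>x' = A x + f\<close>, \<open>x(0) = x0\<close> on \<open>{0..}\<close> in the integrated sense of Caratheodory, for a
  forcing term \<open>f\<close> that is merely locally integrable. Values at negative times are irrelevant.\<close>

definition caratheodory :: "real^'n^'n \<Rightarrow> (real \<Rightarrow> real^'n) \<Rightarrow> real^'n \<Rightarrow> (real \<Rightarrow> real^'n) \<Rightarrow> bool" where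
  "caratheodory A f x0 x \<longleftrightarrow>
     (\<forall>t\<ge>0. (\<lambda>s. A *v x s + f s) absolutely_integrable_on {0..t} \<and>
            x t = x0 + integral {0..t} (\<lambda>s. A *v x s + f s))"

lemma caratheodoryD:
  assumes "caratheodory A f x0 x"
  shows "t \<ge> 0 \<Longrightarrow> (\<lambda>s. A *v x s + f s) absolutely_integrable_on {0..t}"
    and "t \<ge> 0 \<Longrightarrow> x t = x0 + integral {0..t} (\<lambda>s. A *v x s + f s)"
    and "x 0 = x0"
    and "t \<ge> 0 \<Longrightarrow> x t = x 0 + integral {0..t} (\<lambda>s. A *v x s + f s)"
proof -
  show "x 0 = x0" using assms[unfolded caratheodory_def, rule_format, of 0] by simp
  then show "t \<ge> 0 \<Longrightarrow> (\<lambda>s. A *v x s + f s) absolutely_integrable_on {0..t}"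
    and "t \<ge> 0 \<Longrightarrow> x t = x0 + integral {0..t} (\<lambda>s. A *v x s + f s)"
    and "t \<ge> 0 \<Longrightarrow> x t = x 0 + integral {0..t} (\<lambda>s. A *v x s + f s)"
    using assms[unfolded caratheodory_def, rule_format, of t] by simp_all
qed

lemma caratheodory_continuous:
  assumes "caratheodory A f x0 x" shows "continuous_on {0..T} x"
proof (cases "T \<ge> 0")
  case True
  have "(\<lambda>s. A *v x s + f s) integrable_on {0..T}"
    using caratheodoryD(1)[OF assms True] absolutely_integrable_on_def by blast
  from continuous_on_add[OF continuous_on_const[of _ "x 0"] indefinite_integral_continuous_1[OF this]]
  show ?thesis
    by (rule continuous_on_eq) (rule caratheodoryD(4)[OF assms, symmetric], simp)
qed simp

lemma integral_of_vector_derivative: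
  fixes F :: "real \<Rightarrow> 'a::euclidean_space"
  assumes "\<And>t. (F has_vector_derivative f t) (at t)" and "continuous_on UNIV f"
  shows "f absolutely_integrable_on {0..T}" and "t \<in> {0..T} \<Longrightarrow> F t = F 0 + integral {0..t} f"
proof -
  show "f absolutely_integrable_on {0..T}"
    using assms(2) by (intro absolutely_integrable_continuous_real) (auto intro: continuous_on_subset)
  assume t: "t \<in> {0..T}"
  have "(f has_integral (F t - F 0)) {0..t}"
    using t by (intro fundamental_theorem_of_calculus has_vector_derivative_at_within[OF assms(1)]) auto
  then show "F t = F 0 + integral {0..t} f" by (simp add: integral_unique)
qed

lemma expm_integral:
  fixes M :: "real^'n^'n"
  shows "(\<lambda>t. M ** expm M t) absolutely_integrable_on {0..T}"
    and "t \<in> {0..T} \<Longrightarrow> expm M t = expm M 0 + integral {0..t} (\<lambda>t. M ** expm M t)"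
    and "(\<lambda>t. - (M ** expm M (- t))) absolutely_integrable_on {0..T}"
    and "t \<in> {0..T} \<Longrightarrow> expm M (- t) = expm M (- 0) + integral {0..t} (\<lambda>t. - (M ** expm M (- t)))"
proof -
  have c: "continuous_on UNIV (\<lambda>t. M ** expm M (f t))" if "continuous_on UNIV f" for f :: "real \<Rightarrow> real"
    by (intro bounded_bilinear.continuous_on[OF bounded_bilinear_matrix_matrix] continuous_intros that)
  note c1 = c[of "\<lambda>t. t", OF continuous_on_id]
  have c2: "continuous_on UNIV (\<lambda>t. - (M ** expm M (- t)))"
    by (intro continuous_on_minus c continuous_on_id)
  show "(\<lambda>t. M ** expm M t) absolutely_integrable_on {0..T}"
    and "t \<in> {0..T} \<Longrightarrow> expm M t = expm M 0 + integral {0..t} (\<lambda>t. M ** expm M t)"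
    using integral_of_vector_derivative[OF expm_has_vector_derivative c1] by blast+
  show "(\<lambda>t. - (M ** expm M (- t))) absolutely_integrable_on {0..T}"
    and "t \<in> {0..T} \<Longrightarrow> expm M (- t) = expm M (- 0) + integral {0..t} (\<lambda>t. - (M ** expm M (- t)))"
    using integral_of_vector_derivative[OF expm_minus_has_vector_derivative c2] by blast+
qed

text \<open>The solution is given by variation of constants, \<open>x(t) = e\<^bsup>tA\<^esup> (x0 + \<integral> e\<^bsup>-sA\<^esup> f(s) ds)\<close>.\<close>

lemma caratheodory_exists:
  fixes A :: "real^'n^'n"
  assumes f: "\<And>t. t \<ge> 0 \<Longrightarrow> f absolutely_integrable_on {0..t}"
  shows "\<exists>x. caratheodory A f x0 x"
proof -
  define g where "g s = expm A (- s) *v f s" for s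
  define G where "G t = x0 + integral {0..t} g" for t
  define x where "x t = expm A t *v G t" for t
  have g: "g absolutely_integrable_on {0..t}" if "t \<ge> 0" for t
    unfolding g_def
    by (intro absolutely_integrable_continuous_product[OF bounded_bilinear_matrix_vector]
        continuous_intros f that)
  have eq: "expm A s *v g s + (A ** expm A s) *v G s = A *v x s + f s" for s
    by (simp add: g_def x_def matrix_vector_mul_assoc expm_inverse)
  have "caratheodory A f x0 x"
    unfolding caratheodory_def
  proof (intro allI impI conjI)
    fix t :: real assume t: "t \<ge> 0"
    have G: "G s = G 0 + integral {0..s} g" for s by (simp add: G_def)
    note pr = has_integral_product_rule[OF bounded_bilinear_matrix_vector t
        expm_integral(1)[where M = A and T = t] g[OF t] expm_integral(2)[where M = A and T = t] G, unfolded eq]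
    show "(\<lambda>s. A *v x s + f s) absolutely_integrable_on {0..t}" by (rule pr(1))
    show "x t = x0 + integral {0..t} (\<lambda>s. A *v x s + f s)"
      using integral_unique[OF pr(2)] by (simp add: x_def G_def)
  qed
  then show ?thesis by blast
qed

lemma caratheodory_unique:
  fixes A :: "real^'n^'n"
  assumes x: "caratheodory A f x0 x" and y: "caratheodory A f x0 y" and t: "t \<ge> 0"
  shows "x t = y t"
proof -
  define h where "h s = x s - y s" for s
  define k where "k s = A *v h s" for s
  have k_eq: "k s = (A *v x s + f s) - (A *v y s + f s)" for s
    by (simp add: k_def h_def matrix_vector_mult_diff_distrib)
  have k: "k absolutely_integrable_on {0..t}"
    unfolding k_eq using caratheodoryD(1)[OF x t] caratheodoryD(1)[OF y t]
    by (rule set_integral_diff(1))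
  have h: "h s = h 0 + integral {0..s} k" if "s \<in> {0..t}" for s
  proof -
    have s: "s \<ge> 0" using that by simp
    have "integral {0..s} k = integral {0..s} (\<lambda>s. A *v x s + f s) - integral {0..s} (\<lambda>s. A *v y s + f s)"
      unfolding k_eq using caratheodoryD(1)[OF x s] caratheodoryD(1)[OF y s]
      by (intro Henstock_Kurzweil_Integration.integral_diff) (auto simp: absolutely_integrable_on_def)
    then show ?thesis
      using caratheodoryD(2)[OF x s] caratheodoryD(2)[OF y s] caratheodoryD(3)[OF x] caratheodoryD(3)[OF y]
      by (simp add: h_def)
  qed
  \<comment> \<open>The product \<open>e\<^bsup>-sA\<^esup> h(s)\<close> is constant for a solution
    \<open>h\<close> of the homogeneous equation.\<close>
  have z: "expm A (- s) *v k s + - (A ** expm A (- s)) *v h s = 0" for s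
    by (simp add: k_def matrix_vector_mul_assoc expm_commute
        bounded_bilinear.minus_left[OF bounded_bilinear_matrix_vector])
  have "((\<lambda>s. 0) has_integral expm A (- t) *v h t - expm A (- 0) *v h 0) {0..t}"
    using has_integral_product_rule(2)[OF bounded_bilinear_matrix_vector t
        expm_integral(3)[where M = A and T = t] k expm_integral(4)[where M = A and T = t] h] unfolding z .
  moreover have "h 0 = 0" using caratheodoryD(3)[OF x] caratheodoryD(3)[OF y] by (simp add: h_def)
  ultimately have "expm A (- t) *v h t = 0" by (simp add: has_integral_0_eq)
  then have "expm A t *v (expm A (- t) *v h t) = 0" by simp
  then show ?thesis by (simp add: matrix_vector_mul_assoc expm_inverse h_def)
qed

lemma state_trajectory_iff_caratheodory:
  "state_trajectory S 0 x0 u d x \<longleftrightarrow> caratheodory (matA S) (\<lambda>s. matB S *v u s + matE S *v d s) x0 x"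
  by (simp add: state_trajectory_def caratheodory_def Let_def add.assoc)

lemma state_at_eq:
  assumes "state_trajectory S 0 x0 u d x" and "t \<ge> 0"
  shows "state_at S 0 x0 u d t = x t"
  unfolding state_at_def
proof (rule the_equality)
  show "\<exists>x'. state_trajectory S 0 x0 u d x' \<and> x' t = x t" using assms by blast
  show "z = x t" if z: "\<exists>x'. state_trajectory S 0 x0 u d x' \<and> x' t = z" for z
  proof -
    obtain x' where x': "state_trajectory S 0 x0 u d x'" "x' t = z" using z by blast
    have "x' t = x t"
      by (rule caratheodory_unique[OF _ _ assms(2)])
         (use x'(1) assms(1) in \<open>simp_all only: state_trajectory_iff_caratheodory\<close>)
    then show ?thesis using x'(2) by simp
  qed
qed

text \<open>The next two lemmas integrate the derivative of \<open>x \<bullet> G\<close> and of \<open>x \<bullet> P x\<close> along a trajectory.\<close>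

lemma caratheodory_inner:
  assumes x: "caratheodory A f x0 x" and T: "T \<ge> 0"
    and g: "g absolutely_integrable_on {0..T}" and G: "\<And>t. t \<in> {0..T} \<Longrightarrow> G t = G 0 + integral {0..t} g"
  shows "((\<lambda>s. x s \<bullet> g s + (A *v x s + f s) \<bullet> G s) has_integral x T \<bullet> G T - x0 \<bullet> G 0) {0..T}"
  using has_integral_product_rule(2)[OF bounded_bilinear_inner T caratheodoryD(1)[OF x T] g
      caratheodoryD(4)[OF x] G] caratheodoryD(3)[OF x] by simp

lemma caratheodory_quadratic:
  fixes P :: "real^'n^'n"
  assumes x: "caratheodory A f x0 x" and T: "T \<ge> 0" and P: "transpose P = P"
  shows "((\<lambda>s. 2 * ((P *v x s) \<bullet> (A *v x s + f s))) has_integral x T \<bullet> (P *v x T) - x0 \<bullet> (P *v x0)) {0..T}"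
proof -
  let ?g = "\<lambda>s. A *v x s + f s"
  have g: "(\<lambda>s. P *v ?g s) absolutely_integrable_on {0..T}"
    using absolutely_integrable_linear[OF caratheodoryD(1)[OF x T] matrix_vector_mul_bounded_linear[of P]]
    by (simp add: o_def)
  have G: "P *v x t = P *v x 0 + integral {0..t} (\<lambda>s. P *v ?g s)" if "t \<in> {0..T}" for t
  proof -
    have "?g integrable_on {0..t}"
      using caratheodoryD(1)[OF x, of t] that absolutely_integrable_on_def by fastforce
    then have "integral {0..t} (\<lambda>s. P *v ?g s) = P *v integral {0..t} ?g"
      using integral_linear[OF _ matrix_vector_mul_bounded_linear[of P], of ?g] by (simp add: o_def)
    then show ?thesis using caratheodoryD(4)[OF x, of t] that
      by (simp add: matrix_vector_right_distrib)
  qed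
  have sym: "a \<bullet> (P *v b) = b \<bullet> (P *v a)" for a b
    by (metis P dot_lmul_matrix inner_commute transpose_matrix_vector)
  have "x s \<bullet> (P *v ?g s) + ?g s \<bullet> (P *v x s) = 2 * ((P *v x s) \<bullet> ?g s)" for s
    by (simp only: sym[of "x s"] inner_commute[of "P *v x s"])
  then show ?thesis
    using caratheodory_inner[OF x T g, of "\<lambda>t. P *v x t", OF G] caratheodoryD(3)[OF x] by simp
qed

section \<open>Square integrable signals\<close>

text \<open>Square integrability and the norm are restated with the Henstock-Kurzweil integral; the two integrals
  agree on the nonnegative function \<open>(norm (u t))\<^sup>2\<close>.\<close>

lemma L2_iff:
  "u \<in> L2 \<longleftrightarrow> u \<in> borel_measurable (lebesgue_on {0..}) \<and> (\<lambda>t. (norm (u t))\<^sup>2) integrable_on {0..}"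
proof -
  have "integrable (lebesgue_on {0..}) (\<lambda>t. (norm (u t))\<^sup>2) \<longleftrightarrow> (\<lambda>t. (norm (u t))\<^sup>2) integrable_on {0..}"
    (is "?l \<longleftrightarrow> ?r")
  proof
    show "?l \<Longrightarrow> ?r" by (rule integrable_on_lebesgue_on) auto
    assume ?r
    then have "(\<lambda>t. (norm (u t))\<^sup>2) absolutely_integrable_on {0..}"
      by (rule nonnegative_absolutely_integrable_1) simp
    then show ?l by (simp add: absolutely_integrable_measurable o_def)
  qed
  then show ?thesis by (simp add: L2_def)
qed

lemma L2_norm_squared: "u \<in> L2 \<Longrightarrow> (L2_norm u)\<^sup>2 = integral {0..} (\<lambda>t. (norm (u t))\<^sup>2)"
  unfolding L2_norm_def
  by (subst lebesgue_integral_eq_integral[symmetric]) (auto simp: L2_def)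

lemma L2_measurable: "u \<in> L2 \<Longrightarrow> u \<in> borel_measurable (lebesgue_on {0..})"
  and L2_square_integrable: "u \<in> L2 \<Longrightarrow> (\<lambda>t. (norm (u t))\<^sup>2) integrable_on {0..}"
  by (simp_all add: L2_iff)

lemma L2_dominated:
  assumes "u \<in> borel_measurable (lebesgue_on {0..})" and "g integrable_on {0..}"
    and "\<And>t. t \<ge> 0 \<Longrightarrow> (norm (u t))\<^sup>2 \<le> g t"
  shows "u \<in> L2"
proof -
  have "(\<lambda>t. (norm (u t))\<^sup>2) absolutely_integrable_on {0..}"
    by (rule measurable_bounded_by_integrable_imp_absolutely_integrable[OF _ _ assms(2)])
       (use assms(1,3) in auto)
  then show ?thesis using assms(1) by (auto simp: L2_iff absolutely_integrable_on_def)
qed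

lemma L2_bounded_linear:
  assumes f: "bounded_linear f" and u: "u \<in> L2"
  shows "(\<lambda>t. f (u t)) \<in> L2"
proof -
  obtain K where K: "\<And>x. norm (f x) \<le> norm x * K"
    using bounded_linear.bounded[OF f] by blast
  show ?thesis
  proof (rule L2_dominated)
    show "(\<lambda>t. f (u t)) \<in> borel_measurable (lebesgue_on {0..})"
      by (rule measurable_compose[OF L2_measurable[OF u] borel_measurable_continuous_onI])
         (rule linear_continuous_on[OF f])
    show "(\<lambda>t. K\<^sup>2 * (norm (u t))\<^sup>2) integrable_on {0..}"
      using L2_square_integrable[OF u] by (rule integrable_on_mult_right)
    show "(norm (f (u t)))\<^sup>2 \<le> K\<^sup>2 * (norm (u t))\<^sup>2" for t
      using power_mono[OF K[of "u t"], of 2] by (simp add: power_mult_distrib mult.commute)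
  qed
qed

lemma L2_matrix: "u \<in> L2 \<Longrightarrow> (\<lambda>t. M *v u t) \<in> L2"
  by (rule L2_bounded_linear[OF matrix_vector_mul_bounded_linear])

lemma norm_add_squared_le: "(norm (a + b))\<^sup>2 \<le> 2 * (norm a)\<^sup>2 + 2 * (norm (b::'a::real_inner))\<^sup>2"
proof -
  have "(norm (a + b))\<^sup>2 + (norm (a - b))\<^sup>2 = 2 * (norm a)\<^sup>2 + 2 * (norm b)\<^sup>2"
    by (simp add: power2_norm_eq_inner algebra_simps)
  then show ?thesis by (smt (verit) zero_le_power2)
qed

lemma L2_add:
  assumes "u \<in> L2" and "v \<in> L2" shows "(\<lambda>t. u t + v t) \<in> L2"
proof (rule L2_dominated)
  show "(\<lambda>t. u t + v t) \<in> borel_measurable (lebesgue_on {0..})"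
    using assms L2_measurable by (intro borel_measurable_add) auto
  show "(\<lambda>t. 2 * (norm (u t))\<^sup>2 + 2 * (norm (v t))\<^sup>2) integrable_on {0..}"
    using assms L2_square_integrable
    by (intro Henstock_Kurzweil_Integration.integrable_add integrable_on_mult_right) auto
qed (rule norm_add_squared_le)

lemma L2_diff:
  assumes "u \<in> L2" and "v \<in> L2" shows "(\<lambda>t. u t - v t) \<in> L2"
  using L2_add[OF assms(1) L2_bounded_linear[OF bounded_linear_minus[OF bounded_linear_ident] assms(2)]]
  by simp

lemma abs_inner_le: "\<bar>a \<bullet> b\<bar> \<le> (norm a)\<^sup>2 + (norm (b::'a::real_inner))\<^sup>2"
proof -
  have "\<bar>a \<bullet> b\<bar> \<le> norm a * norm b" by (rule Cauchy_Schwarz_ineq2)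
  moreover have "0 \<le> (norm a - norm b)\<^sup>2" "0 \<le> (norm a)\<^sup>2" "0 \<le> (norm b)\<^sup>2" by simp_all
  ultimately show ?thesis by (simp add: power2_diff)
qed

lemma L2_inner_integrable:
  fixes u v :: "real \<Rightarrow> real^'k"
  assumes u: "u \<in> L2" and v: "v \<in> L2" shows "(\<lambda>t. u t \<bullet> v t) integrable_on {0..}"
proof -
  have "(\<lambda>t. u t \<bullet> v t) absolutely_integrable_on {0..}"
  proof (rule measurable_bounded_by_integrable_imp_absolutely_integrable)
    show "(\<lambda>t. u t \<bullet> v t) \<in> borel_measurable (lebesgue_on {0..})"
      using u v L2_measurable by (intro borel_measurable_inner) auto
    show "(\<lambda>t. (norm (u t))\<^sup>2 + (norm (v t))\<^sup>2) integrable_on {0..}"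
      using u v L2_square_integrable
      by (intro Henstock_Kurzweil_Integration.integrable_add) auto
  qed (auto simp: abs_inner_le)
  then show ?thesis by (simp add: absolutely_integrable_on_def)
qed

lemma integrable_on_halfline_interval:
  fixes g :: "real \<Rightarrow> real"
  assumes "g integrable_on {0..}" shows "g integrable_on {0..T}"
  using integrable_on_subinterval[of g "{0..}" 0 T] assms by auto

lemma integral_interval_le_halfline:
  fixes g :: "real \<Rightarrow> real"
  assumes "g integrable_on {0..}" and "\<And>t. t \<ge> 0 \<Longrightarrow> g t \<ge> 0"
  shows "integral {0..T} g \<le> integral {0..} g"
  using assms integrable_on_halfline_interval[OF assms(1)]
  by (intro integral_subset_le) auto

lemma L2_locally_integrable:
  assumes u: "u \<in> L2" shows "u absolutely_integrable_on {0..T}"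
proof (rule measurable_bounded_by_integrable_imp_absolutely_integrable)
  show "u \<in> borel_measurable (lebesgue_on {0..T})"
    by (rule measurable_restrict_mono[OF L2_measurable[OF u]]) auto
  show "(\<lambda>t. 1 + (norm (u t))\<^sup>2) integrable_on {0..T}"
    using integrable_on_halfline_interval[OF L2_square_integrable[OF u]]
    by (intro Henstock_Kurzweil_Integration.integrable_add) auto
  show "norm (u t) \<le> 1 + (norm (u t))\<^sup>2" for t
    using zero_le_power2[of "norm (u t) - 1 / 2"] by (simp add: power2_eq_square algebra_simps)
qed auto

lemma integral_halfline_bounded:
  fixes g :: "real \<Rightarrow> real"
  assumes int: "\<And>T. T \<ge> 0 \<Longrightarrow> g integrable_on {0..T}" and pos: "\<And>t. t \<ge> 0 \<Longrightarrow> g t \<ge> 0"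
    and bound: "\<And>T. T \<ge> 0 \<Longrightarrow> integral {0..T} g \<le> B"
  shows "g integrable_on {0..}" and "integral {0..} g \<le> B"
proof -
  define f where "f k t = (if t \<in> {0..real k} then g t else 0)" for k t
  have f: "(f k has_integral integral {0..real k} g) {0..}" for k
    unfolding f_def using int[of "real k"] by (subst has_integral_restrict) auto
  have conv: "g integrable_on {0..} \<and> (\<lambda>k. integral {0..} (f k)) \<longlonglongrightarrow> integral {0..} g"
  proof (rule monotone_convergence_increasing)
    show "f k integrable_on {0..}" for k using f by blast
    show "f k t \<le> f (Suc k) t" if "t \<in> {0..}" for k t using pos that by (auto simp: f_def)
    show "(\<lambda>k. f k t) \<longlonglongrightarrow> g t" if "t \<in> {0..}" for t
    proof (rule tendsto_eventually)
      obtain n where "t \<le> real n" using real_arch_simple by blast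
      then show "\<forall>\<^sub>F k in sequentially. f k t = g t"
        using that by (intro eventually_sequentiallyI[of n]) (auto simp: f_def)
    qed
    show "bounded (range (\<lambda>k. integral {0..} (f k)))"
    proof (rule boundedI)
      fix y assume "y \<in> range (\<lambda>k. integral {0..} (f k))"
      then obtain k where y: "y = integral {0..real k} g" using integral_unique[OF f] by auto
      have "0 \<le> y" unfolding y using int[of "real k"] pos by (intro integral_nonneg) auto
      then show "norm y \<le> B" using bound[of "real k"] y by simp
    qed
  qed
  then show "g integrable_on {0..}" by blast
  show "integral {0..} g \<le> B"
    by (rule LIMSEQ_le_const2[OF conv[THEN conjunct2]]) (use integral_unique[OF f] bound in auto)
qed

lemma continuous_on_halfline:
  fixes u :: "real \<Rightarrow> 'a::topological_space"
  assumes c: "\<And>T. continuous_on {0..T} u" shows "continuous_on {0..} u"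
  unfolding continuous_on_eq_continuous_within
proof
  fix t :: real assume t: "t \<in> {0..}"
  have "at t within {0..} = at t within {0..t + 1}"
    by (rule at_within_nhd[of _ "{..<t + 1}"]) (use t in auto)
  moreover have "continuous (at t within {0..t + 1}) u"
    using c[of "t + 1"] t by (simp add: continuous_on_eq_continuous_within)
  ultimately show "continuous (at t within {0..}) u" by (simp add: continuous_within)
qed

lemma L2_continuous_bounded:
  assumes c: "\<And>T. continuous_on {0..T} u"
    and B: "\<And>T. T \<ge> 0 \<Longrightarrow> integral {0..T} (\<lambda>t. (norm (u t))\<^sup>2) \<le> B"
  shows "u \<in> L2"
proof -
  have "continuous_on {0..} u" by (rule continuous_on_halfline[OF c])
  then have "u \<in> borel_measurable (lebesgue_on {0..})"
    by (intro continuous_imp_measurable_on_sets_lebesgue) auto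
  moreover have "(\<lambda>t. (norm (u t))\<^sup>2) integrable_on {0..}"
    by (rule integral_halfline_bounded(1)[OF _ _ B]) (auto intro!: integrable_continuous_real continuous_intros c)
  ultimately show ?thesis by (simp add: L2_iff)
qed

lemma L2_truncated:
  assumes c: "continuous_on {0..T} g"
  shows "(\<lambda>t. if t \<in> {0..T} then g t else 0) \<in> L2"
  unfolding L2_iff
proof
  have "(\<lambda>t. if t \<in> {0..T} then g t else 0) \<in> borel_measurable lebesgue"
    by (rule borel_measurable_if_I) (use c in \<open>auto intro: continuous_imp_measurable_on_sets_lebesgue\<close>)
  then show "(\<lambda>t. if t \<in> {0..T} then g t else 0) \<in> borel_measurable (lebesgue_on {0..})"
    by (rule measurable_restrict_space1)
  have "(\<lambda>t. (norm (g t))\<^sup>2) integrable_on {0..T}"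
    by (intro integrable_continuous_real continuous_intros c)
  then have "(\<lambda>t. if t \<in> {0..T} then (norm (g t))\<^sup>2 else 0) integrable_on {0..}"
    unfolding integrable_on_def by (subst has_integral_restrict) auto
  then show "(\<lambda>t. (norm (if t \<in> {0..T} then g t else 0))\<^sup>2) integrable_on {0..}"
    by (rule integrable_eq) auto
qed

lemma integral_truncated:
  fixes \<phi> :: "'a \<Rightarrow> real"
  assumes "(\<lambda>t. h t) integrable_on {0..T}" and "\<And>t. t \<in> {0..T} \<Longrightarrow> k t = h t"
    and "\<And>t. t \<notin> {0..T} \<Longrightarrow> k t = (0::real)"
  shows "integral {0..} k = integral {0..T} h"
proof -
  have "((\<lambda>t. if t \<in> {0..T} then h t else 0) has_integral integral {0..T} h) {0..}"
    using assms(1) by (subst has_integral_restrict) auto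
  then have "(k has_integral integral {0..T} h) {0..}"
    by (rule has_integral_eq[rotated]) (use assms in auto)
  then show ?thesis by (rule integral_unique)
qed

section \<open>Sufficiency of the matrix inequality\<close>

text \<open>A negative definite form is uniformly negative, by compactness of the unit sphere.\<close>

lemma form_gap:
  fixes q :: "'v::euclidean_space \<Rightarrow> real"
  assumes cq: "continuous_on UNIV q" and hq: "\<And>c v. q (c *\<^sub>R v) = c\<^sup>2 * q v"
    and neg: "\<And>v. v \<noteq> 0 \<Longrightarrow> q v < 0"
  obtains \<kappa> where "\<kappa> > 0" and "\<And>v. q v \<le> - \<kappa> * (norm v)\<^sup>2"
proof -
  have "\<exists>x\<in>sphere 0 1. \<forall>y\<in>sphere 0 1. q y \<le> q x"
    by (rule continuous_attains_sup) (auto intro: continuous_on_subset[OF cq])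
  then obtain x where x: "norm x = 1" "\<And>y. norm y = 1 \<Longrightarrow> q y \<le> q x" by auto
  show thesis
  proof (rule that)
    show "- q x > 0" using neg[of x] x(1) by fastforce
    show "q v \<le> - (- q x) * (norm v)\<^sup>2" for v
    proof (cases "v = 0")
      case True
      then show ?thesis using hq[of 0 v] by simp
    next
      case False
      have "q v = (norm v)\<^sup>2 * q (inverse (norm v) *\<^sub>R v)"
        using False by (simp add: hq power_inverse)
      also have "\<dots> \<le> (norm v)\<^sup>2 * q x"
        using x(2)[of "inverse (norm v) *\<^sub>R v"] False by (intro mult_left_mono) auto
      finally show ?thesis by (simp add: mult.commute)
    qed
  qed
qed

lemma matrix_mult_continuous [continuous_intros]:
  "continuous_on S f \<Longrightarrow> continuous_on S (\<lambda>x. (M :: real^'n^'m) *v f x)"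
  by (rule bounded_linear.continuous_on[OF matrix_vector_mul_bounded_linear])

lemma matrix_norm_bound:
  obtains b where "b > 0" and "\<And>x. (norm ((M :: real^'n^'m) *v x))\<^sup>2 \<le> b * (norm x)\<^sup>2"
proof -
  obtain K where K: "K > 0" "\<And>x. norm (M *v x) \<le> norm x * K"
    using bounded_linear.pos_bounded[OF matrix_vector_mul_bounded_linear[of M]] by blast
  show thesis
  proof (rule that)
    show "(norm (M *v x))\<^sup>2 \<le> K\<^sup>2 * (norm x)\<^sup>2" for x
      using power_mono[OF K(2)[of x], of 2] by (simp add: power_mult_distrib mult.commute)
  qed (use K in simp)
qed

lemma pos_definite_inverse:
  assumes X: "pos_definite (X :: real^'n^'n)"
  obtains P where "pos_definite P" and "X ** P = mat 1" and "P ** X = mat 1"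
proof -
  have "inj ((*v) X)"
    using X by (subst linear_injective_0[OF matrix_vector_mul_linear]) (force simp: pos_definite_def)
  then have "\<exists>P. P ** X = mat 1"
    by (simp add: matrix_left_invertible_injective)
  then obtain P where P: "P ** X = mat 1" by blast
  then have P': "X ** P = mat 1" by (simp add: matrix_left_right_inverse)
  have "transpose P ** X = mat 1"
    using arg_cong[OF P', of transpose] X by (simp add: matrix_transpose_mul pos_definite_def)
  then have "transpose P = P"
    using P' by (metis matrix_mul_assoc matrix_mul_lid matrix_mul_rid)
  moreover have "0 < v \<bullet> (P *v v)" if "v \<noteq> 0" for v
  proof -
    have v: "X *v (P *v v) = v" by (simp add: matrix_vector_mul_assoc P')
    then have "P *v v \<noteq> 0" using that by auto
    then have "0 < (P *v v) \<bullet> (X *v (P *v v))" using X unfolding pos_definite_def by blast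
    then show ?thesis by (simp add: v inner_commute)
  qed
  ultimately show thesis using that[OF _ P' P] by (simp add: pos_definite_def)
qed

lemma inner_young:
  fixes a b :: "'a::real_inner"
  assumes "c > 0" shows "2 * (a \<bullet> b) \<le> c * (norm a)\<^sup>2 + (norm b)\<^sup>2 / c"
proof -
  have "0 \<le> (norm (c *\<^sub>R a - b))\<^sup>2 / c" using assms by simp
  also have "(norm (c *\<^sub>R a - b))\<^sup>2 = c * (c * (norm a)\<^sup>2) + (norm b)\<^sup>2 - c * (2 * (a \<bullet> b))"
    unfolding power2_norm_eq_inner by (simp add: inner_diff_left inner_diff_right inner_commute)
  also have "\<dots> / c = c * (norm a)\<^sup>2 + (norm b)\<^sup>2 / c - 2 * (a \<bullet> b)"
    using assms by (simp add: add_divide_distrib diff_divide_distrib)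
  finally show ?thesis by simp
qed

text \<open>The quadratic form of the linear matrix inequality with unknowns \<open>X\<close> and \<open>F\<close>, written in the block
  components \<open>\<xi>\<close>, \<open>w\<close>, \<open>v\<close> of its argument; \<open>X\<close> is meant to be symmetric.\<close>

definition lmi_form ::
  "real^'n^'n \<Rightarrow> real^'q^'n \<Rightarrow> real^'m^'n \<Rightarrow> real^'n^'p \<Rightarrow> real^'m^'m \<Rightarrow>
   real^'n^'n \<Rightarrow> real^'n^'q \<Rightarrow> (real^'n) \<times> (real^'m) \<times> (real^'p) \<Rightarrow> real" where
  "lmi_form A B E C Q X F = (\<lambda>(\<xi>, w, v). 2 * (\<xi> \<bullet> (A *v (X *v \<xi>) + B *v (F *v \<xi>))) + 2 * (\<xi> \<bullet> (E *v w))
     + 2 * (v \<bullet> (C *v (X *v \<xi>))) - w \<bullet> (Q *v w) - v \<bullet> v)"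

text \<open>From the inequality to the estimate: the state feedback \<open>u = F X\<^sup>-\<^sup>1 x\<close> and the storage function \<open>x \<bullet> X\<^sup>-\<^sup>1 x\<close>
  turn the inequality at \<open>(X\<^sup>-\<^sup>1 x, w, C x)\<close> into a dissipation inequality. The strictness
  of the inequality pays for the terms in \<open>\<kappa>\<close> and \<open>\<eta>\<close>, and also for the extra disturbance \<open>d\<close>, since its weight \<open>\<mu>\<close>
  may be chosen as large as needed.\<close>

lemma lmi_sufficient:
  fixes A :: "real^'n^'n" and B :: "real^'q^'n" and E :: "real^'m^'n" and C :: "real^'n^'p"
    and Q :: "real^'m^'m" and D :: "real^'r^'n"
  assumes X: "pos_definite X" and neg: "\<And>z. z \<noteq> 0 \<Longrightarrow> lmi_form A B E C Q X F z < 0"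
  obtains \<kappa> \<mu> \<eta> where "\<kappa> > 0" and "\<mu> > 0" and "\<eta> > 0"
    and "\<And>w d. w \<in> L2 \<Longrightarrow> d \<in> L2 \<Longrightarrow> \<exists>x u. u \<in> L2 \<and> caratheodory A (\<lambda>s. B *v u s + E *v w s + D *v d s) 0 x
        \<and> (\<lambda>t. C *v x t) \<in> L2
        \<and> (L2_norm (\<lambda>t. C *v x t))\<^sup>2 \<le> integral {0..} (\<lambda>t. w t \<bullet> (Q *v w t)) - \<kappa> * (L2_norm w)\<^sup>2
             + \<mu> * (L2_norm d)\<^sup>2 - \<eta> * (L2_norm u)\<^sup>2"
proof -
  obtain \<kappa> where \<kappa>: "\<kappa> > 0" "\<And>z. lmi_form A B E C Q X F z \<le> - \<kappa> * (norm z)\<^sup>2"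
  proof (rule form_gap)
    show "continuous_on UNIV (lmi_form A B E C Q X F)"
      unfolding lmi_form_def case_prod_beta by (intro continuous_intros)
    show "lmi_form A B E C Q X F (c *\<^sub>R z) = c\<^sup>2 * lmi_form A B E C Q X F z" for c z
      by (cases z) (simp add: lmi_form_def matrix_vector_mult_scaleR power2_eq_square algebra_simps)
  qed (use neg in auto)
  obtain P where P: "pos_definite P" "X ** P = mat 1" "P ** X = mat 1"
    using pos_definite_inverse[OF X] .
  obtain bD where bD: "bD > 0" "\<And>x. (norm (D *v x))\<^sup>2 \<le> bD * (norm x)\<^sup>2" using matrix_norm_bound by blast
  obtain bF where bF: "bF > 0" "\<And>x. (norm (F *v x))\<^sup>2 \<le> bF * (norm x)\<^sup>2" using matrix_norm_bound by blast
  define \<mu> where "\<mu> = 2 * bD / \<kappa>"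
  define \<eta> where "\<eta> = \<kappa> / (2 * bF)"
  have pos: "\<mu> > 0" "\<eta> > 0" using \<kappa> bD bF by (auto simp: \<mu>_def \<eta>_def)
  show thesis
  proof (rule that[OF \<kappa>(1) pos])
    fix w :: "real \<Rightarrow> real^'m" and d :: "real \<Rightarrow> real^'r"
    assume w: "w \<in> L2" and d: "d \<in> L2"
    define g where "g s = E *v w s + D *v d s" for s
    have g: "g \<in> L2" unfolding g_def using w d by (intro L2_add L2_matrix)
    obtain x where x: "caratheodory (A + B ** F ** P) g 0 x"
      using caratheodory_exists[of g "A + B ** F ** P" 0] L2_locally_integrable[OF g] by blast
    define p where "p t = P *v x t" for t
    define u where "u t = F *v p t" for t
    have xp: "x t = X *v p t" for t by (simp add: p_def matrix_vector_mul_assoc P)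
    have cx: "continuous_on {0..T} x" for T using caratheodory_continuous[OF x] .
    have rhs: "(A + B ** F ** P) *v x s + g s = A *v x s + (B *v u s + E *v w s + D *v d s)" for s
      by (simp add: matrix_vector_mult_add_rdistrib g_def u_def p_def matrix_vector_mul_assoc matrix_mul_assoc add.assoc)
    have x': "caratheodory A (\<lambda>s. B *v u s + E *v w s + D *v d s) 0 x"
      using x unfolding caratheodory_def rhs .
    \<comment> \<open>The supply rate; it is nonnegative because the inequality at \<open>(0, w, 0)\<close>
      bounds \<open>Q\<close> below by \<open>\<kappa>\<close>.\<close>
    define rate where "rate t = w t \<bullet> (Q *v w t) - \<kappa> * (norm (w t))\<^sup>2 + \<mu> * (norm (d t))\<^sup>2" for t
    define h where "h t = (norm (C *v x t))\<^sup>2 + \<kappa> / 2 * (norm (p t))\<^sup>2" for t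
    have wQw: "\<kappa> * (norm v)\<^sup>2 \<le> v \<bullet> (Q *v v)" for v
      using \<kappa>(2)[of "(0, v, 0)"] by (simp add: lmi_form_def norm_prod_def)
    have rate_nonneg: "rate t \<ge> 0" for t
      using wQw[of "w t"] pos(1) by (simp add: rate_def)
    have rate_int: "rate integrable_on {0..}"
      unfolding rate_def[abs_def]
      by (intro Henstock_Kurzweil_Integration.integrable_add Henstock_Kurzweil_Integration.integrable_diff
          integrable_on_mult_right L2_inner_integrable L2_square_integrable L2_matrix w d)
    \<comment> \<open>The cross term with \<open>d\<close> is absorbed by half of the gap \<open>\<kappa> (norm
      (p t))\<^sup>2\<close>; the other half, kept in \<open>h\<close>, bounds \<open>u\<close>.\<close>
    have dissipation: "2 * ((P *v x t) \<bullet> ((A + B ** F ** P) *v x t + g t)) \<le> rate t - h t" for t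
    proof -
      have "2 * (p t \<bullet> (A *v (X *v p t) + B *v (F *v p t))) + 2 * (p t \<bullet> (E *v w t))
          + 2 * (norm (C *v x t))\<^sup>2 - w t \<bullet> (Q *v w t) - (norm (C *v x t))\<^sup>2
          \<le> - \<kappa> * ((norm (p t))\<^sup>2 + ((norm (w t))\<^sup>2 + (norm (C *v x t))\<^sup>2))"
        using \<kappa>(2)[of "(p t, w t, C *v x t)"]
        by (simp add: lmi_form_def norm_prod_def xp[of t, symmetric] power2_norm_eq_inner)
      moreover have "0 \<le> \<kappa> * (norm (C *v x t))\<^sup>2" using \<kappa>(1) by simp
      moreover have "2 * (p t \<bullet> (D *v d t)) \<le> \<kappa> / 2 * (norm (p t))\<^sup>2 + (norm (D *v d t))\<^sup>2 / (\<kappa> / 2)"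
        by (rule inner_young) (use \<kappa>(1) in simp)
      moreover have "(norm (D *v d t))\<^sup>2 / (\<kappa> / 2) \<le> \<mu> * (norm (d t))\<^sup>2"
        using divide_right_mono[OF bD(2)[of "d t"], of "\<kappa> / 2"] \<kappa>(1) by (simp add: \<mu>_def field_simps)
      moreover have "2 * ((P *v x t) \<bullet> ((A + B ** F ** P) *v x t + g t))
          = 2 * (p t \<bullet> (A *v (X *v p t) + B *v (F *v p t))) + 2 * (p t \<bullet> (E *v w t)) + 2 * (p t \<bullet> (D *v d t))"
        unfolding rhs by (simp add: p_def[symmetric] u_def xp[of t, symmetric] inner_add_right algebra_simps)
      ultimately show ?thesis by (simp add: rate_def h_def algebra_simps)
    qed
    have cp: "continuous_on {0..T} p" for T
      unfolding p_def[abs_def] by (intro continuous_intros cx)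
    have h_int: "h integrable_on {0..T}" for T
      unfolding h_def[abs_def] by (intro integrable_continuous_real continuous_intros cx cp)
    have h_bound: "integral {0..T} h \<le> integral {0..} rate" if T: "T \<ge> 0" for T
    proof -
      have "transpose P = P" using P(1) by (simp add: pos_definite_def)
      note bal = caratheodory_quadratic[OF x T this]
      have "0 \<le> x T \<bullet> (P *v x T)"
        using P(1) unfolding pos_definite_def by (cases "x T = 0") (auto intro: less_imp_le)
      also have "\<dots> = integral {0..T} (\<lambda>t. 2 * ((P *v x t) \<bullet> ((A + B ** F ** P) *v x t + g t)))"
        using integral_unique[OF bal] by simp
      also have "\<dots> \<le> integral {0..T} (\<lambda>t. rate t - h t)"
        using bal h_int integrable_on_halfline_interval[OF rate_int] dissipation
        by (intro integral_le Henstock_Kurzweil_Integration.integrable_diff) auto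
      also have "\<dots> = integral {0..T} rate - integral {0..T} h"
        using h_int integrable_on_halfline_interval[OF rate_int]
        by (intro Henstock_Kurzweil_Integration.integral_diff) auto
      also have "integral {0..T} rate \<le> integral {0..} rate"
        by (rule integral_interval_le_halfline[OF rate_int rate_nonneg])
      finally show ?thesis by simp
    qed
    have h_nonneg: "h t \<ge> 0" for t using \<kappa>(1) by (simp add: h_def)
    note h_inf = integral_halfline_bounded[OF h_int h_nonneg h_bound]
    have in_L2: "(\<lambda>t. M *v x t) \<in> L2" if M: "\<And>t. (norm (M *v x t))\<^sup>2 \<le> c * h t" and c: "c \<ge> 0"
      for M :: "real^'n^'k" and c :: real
    proof (rule L2_continuous_bounded)
      show "continuous_on {0..T} (\<lambda>t. M *v x t)" for T by (intro continuous_intros cx)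
      fix T :: real assume T: "T \<ge> 0"
      have "integral {0..T} (\<lambda>t. (norm (M *v x t))\<^sup>2) \<le> integral {0..T} (\<lambda>t. c * h t)"
        by (rule integral_le)
           (auto intro!: M integrable_continuous_real continuous_intros cx integrable_on_mult_right h_int)
      also have "\<dots> \<le> c * integral {0..} rate"
        using h_bound[OF T] c by (simp add: mult_left_mono)
      finally show "integral {0..T} (\<lambda>t. (norm (M *v x t))\<^sup>2) \<le> c * integral {0..} rate" .
    qed
    have u_h: "\<eta> * (norm (u t))\<^sup>2 \<le> \<kappa> / 2 * (norm (p t))\<^sup>2" for t
      using mult_left_mono[OF bF(2)[of "p t"], of \<eta>] pos(2) bF(1) by (simp add: \<eta>_def u_def field_simps)
    have CL2: "(\<lambda>t. C *v x t) \<in> L2"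
      by (rule in_L2[of C 1]) (use \<kappa>(1) in \<open>auto simp: h_def\<close>)
    have u_eq: "u t = (F ** P) *v x t" for t by (simp add: u_def p_def matrix_vector_mul_assoc)
    have uL2: "u \<in> L2"
      unfolding u_eq[abs_def]
    proof (rule in_L2[of _ "1 / \<eta>"])
      show "(norm ((F ** P) *v x t))\<^sup>2 \<le> 1 / \<eta> * h t" for t
      proof -
        have "\<eta> * (norm (u t))\<^sup>2 \<le> h t" using u_h[of t] by (simp add: h_def add_increasing)
        then show ?thesis using pos(2) by (simp add: u_eq field_simps)
      qed
    qed (use pos in simp)
    have "(L2_norm (\<lambda>t. C *v x t))\<^sup>2 + \<eta> * (L2_norm u)\<^sup>2
        = integral {0..} (\<lambda>t. (norm (C *v x t))\<^sup>2 + \<eta> * (norm (u t))\<^sup>2)"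
      using L2_square_integrable[OF CL2] integrable_on_mult_right[OF L2_square_integrable[OF uL2], of \<eta>]
      by (simp add: L2_norm_squared CL2 uL2 Henstock_Kurzweil_Integration.integral_add)
    also have "\<dots> \<le> integral {0..} h"
      using L2_square_integrable[OF CL2] L2_square_integrable[OF uL2] h_inf(1) u_h
      by (intro integral_le Henstock_Kurzweil_Integration.integrable_add integrable_on_mult_right)
         (auto simp: h_def)
    also have "\<dots> \<le> integral {0..} rate" by (rule h_inf(2))
    also have "\<dots> = integral {0..} (\<lambda>t. w t \<bullet> (Q *v w t)) - \<kappa> * (L2_norm w)\<^sup>2 + \<mu> * (L2_norm d)\<^sup>2"
      unfolding rate_def[abs_def]
      using L2_inner_integrable[OF w L2_matrix[OF w, of Q]]
        integrable_on_mult_right[OF L2_square_integrable[OF w], of \<kappa>]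
        integrable_on_mult_right[OF L2_square_integrable[OF d], of \<mu>]
      by (simp add: L2_norm_squared w d Henstock_Kurzweil_Integration.integral_add
          Henstock_Kurzweil_Integration.integral_diff Henstock_Kurzweil_Integration.integrable_diff)
    finally show "\<exists>x u. u \<in> L2 \<and> caratheodory A (\<lambda>s. B *v u s + E *v w s + D *v d s) 0 x
        \<and> (\<lambda>t. C *v x t) \<in> L2
        \<and> (L2_norm (\<lambda>t. C *v x t))\<^sup>2 \<le> integral {0..} (\<lambda>t. w t \<bullet> (Q *v w t)) - \<kappa> * (L2_norm w)\<^sup>2
             + \<mu> * (L2_norm d)\<^sup>2 - \<eta> * (L2_norm u)\<^sup>2"
      using uL2 CL2 x' by (intro exI[of _ x] exI[of _ u]) auto
  qed
qed

section \<open>The estimate for the adjoint equation\<close>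

text \<open>The state of a stable system started at rest is bounded, uniformly in time, by the \<open>L2\<close> norm of its forcing term.\<close>

lemma hurwitz_state_bound:
  fixes A :: "real^'n^'n"
  assumes "hurwitz A"
  obtains c where "c \<ge> 0"
    and "\<And>f x T. f \<in> L2 \<Longrightarrow> caratheodory A f 0 x \<Longrightarrow> T \<ge> 0 \<Longrightarrow> (norm (x T))\<^sup>2 \<le> c * (L2_norm f)\<^sup>2"
proof -
  obtain P where P: "pos_definite P" and PA: "\<And>x. x \<noteq> 0 \<Longrightarrow> x \<bullet> (P *v (A *v x)) < 0"
    using hurwitz_lyapunov[OF assms] by blast
  have sym: "a \<bullet> (P *v b) = (P *v a) \<bullet> b" for a b
    using P by (metis pos_definite_def dot_lmul_matrix transpose_matrix_vector)
  obtain \<mu> where \<mu>: "\<mu> > 0" "\<And>x. x \<bullet> (P *v (A *v x)) \<le> - \<mu> * (norm x)\<^sup>2"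
    by (rule form_gap[of "\<lambda>x. x \<bullet> (P *v (A *v x))"])
       (use PA in \<open>auto intro!: continuous_intros simp: matrix_vector_mult_scaleR power2_eq_square\<close>)
  obtain \<nu> where \<nu>: "\<nu> > 0" "\<And>x. - (x \<bullet> (P *v x)) \<le> - \<nu> * (norm x)\<^sup>2"
    by (rule form_gap[of "\<lambda>x. - (x \<bullet> (P *v x))"])
       (use P in \<open>auto intro!: continuous_intros simp: matrix_vector_mult_scaleR power2_eq_square pos_definite_def\<close>)
  obtain b where b: "b > 0" "\<And>x. (norm (P *v x))\<^sup>2 \<le> b * (norm x)\<^sup>2" using matrix_norm_bound by blast
  show thesis
  proof (rule that)
    show "b / (2 * \<mu>) / \<nu> \<ge> 0" using b \<mu> \<nu> by simp
    fix f x and T :: real assume f: "f \<in> L2" and x: "caratheodory A f 0 x" and T: "T \<ge> 0"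
    have "transpose P = P" using P by (simp add: pos_definite_def)
    note bal = caratheodory_quadratic[OF x T this]
    have fi: "(\<lambda>t. b / (2 * \<mu>) * (norm (f t))\<^sup>2) integrable_on {0..}"
      by (intro integrable_on_mult_right L2_square_integrable f)
    have pt: "2 * ((P *v x t) \<bullet> (A *v x t + f t)) \<le> b / (2 * \<mu>) * (norm (f t))\<^sup>2" for t
    proof -
      have "2 * (x t \<bullet> (P *v f t)) \<le> 2 * \<mu> * (norm (x t))\<^sup>2 + (norm (P *v f t))\<^sup>2 / (2 * \<mu>)"
        by (rule inner_young) (use \<mu> in simp)
      moreover have "(norm (P *v f t))\<^sup>2 / (2 * \<mu>) \<le> b / (2 * \<mu>) * (norm (f t))\<^sup>2"
        using divide_right_mono[OF b(2)[of "f t"], of "2 * \<mu>"] \<mu>(1) by simp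
      moreover have "2 * ((P *v x t) \<bullet> (A *v x t + f t)) = 2 * (x t \<bullet> (P *v (A *v x t))) + 2 * (x t \<bullet> (P *v f t))"
        by (simp add: sym inner_add_right)
      ultimately show ?thesis using \<mu>(2)[of "x t"] by simp
    qed
    have "\<nu> * (norm (x T))\<^sup>2 \<le> x T \<bullet> (P *v x T)" using \<nu>(2)[of "x T"] by simp
    also have "\<dots> = integral {0..T} (\<lambda>t. 2 * ((P *v x t) \<bullet> (A *v x t + f t)))"
      using integral_unique[OF bal] by simp
    also have "\<dots> \<le> integral {0..T} (\<lambda>t. b / (2 * \<mu>) * (norm (f t))\<^sup>2)"
      using bal integrable_on_halfline_interval[OF fi] pt by (intro integral_le) auto
    also have "\<dots> \<le> integral {0..} (\<lambda>t. b / (2 * \<mu>) * (norm (f t))\<^sup>2)"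
      by (rule integral_interval_le_halfline[OF fi]) (use b \<mu> in simp)
    also have "\<dots> = b / (2 * \<mu>) * (L2_norm f)\<^sup>2" by (simp add: L2_norm_squared f)
    finally show "(norm (x T))\<^sup>2 \<le> b / (2 * \<mu>) / \<nu> * (L2_norm f)\<^sup>2"
      using \<nu>(1) by (subst times_divide_eq_left, subst pos_le_divide_eq) (simp_all add: mult.commute)
  qed
qed

lemma quadratic_form_integrable:
  fixes T :: real
  assumes "continuous_on {0..T} f" shows "(\<lambda>t. f t \<bullet> ((W::real^'n^'n) *v f t)) integrable_on {0..T}"
  by (intro integrable_continuous_real continuous_intros assms)

text \<open>The heart of the necessity proof. Let \<open>l\<close> solve the adjoint equation \<open>l' = - (A\<^sup>T + C\<^sup>T K) l\<close> with \<open>B\<^sup>T l = 0\<close> on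
  \<open>{0..T}\<close>, and feed the system with the input \<open>w = Q\<^sup>-\<^sup>1 E\<^sup>T l\<close>, switched off after \<open>T\<close>. Integrating \<open>(x \<bullet> l)'\<close> gives
  \<open>\<integral> w \<bullet> Q w = \<integral> C x \<bullet> K l + x(T) \<bullet> l(T)\<close>, in which the answering signal \<open>d\<close> no longer occurs, because
  \<open>d \<bullet> B\<^sup>T l = 0\<close>. So it does not matter that \<open>d\<close> may depend on the future of \<open>w\<close>. As \<open>\<integral> (norm (C x))\<^sup>2\<close> is below
  \<open>\<integral> w \<bullet> Q w\<close> by a fixed factor, the left side is at most a factor \<open>\<rho> < 1\<close> times \<open>\<integral> (norm (K l))\<^sup>2\<close>, up to a
  boundary term. The constants do not depend on \<open>T\<close> or on the solution \<open>l\<close>.\<close>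

lemma adjoint_estimate:
  fixes A :: "real^'n^'n" and B :: "real^'q^'n" and E :: "real^'m^'n" and C :: "real^'n^'p"
    and Q Qi :: "real^'m^'m" and K :: "real^'n^'p"
  assumes A: "hurwitz A" and pos: "\<delta> > 0" "\<epsilon> > 0" "\<eta> > 0"
    and Q: "\<And>w. \<delta> * (norm w)\<^sup>2 \<le> w \<bullet> (Q *v w)" and Qi: "Q ** Qi = mat 1"
    and similar: "\<And>w. w \<in> L2 \<Longrightarrow> \<exists>d x. d \<in> L2 \<and> caratheodory A (\<lambda>s. B *v d s + E *v w s) 0 x
        \<and> (\<lambda>t. C *v x t) \<in> L2
        \<and> (L2_norm (\<lambda>t. C *v x t))\<^sup>2 + \<eta> * (L2_norm d)\<^sup>2
            \<le> integral {0..} (\<lambda>t. w t \<bullet> (Q *v w t)) - \<epsilon> * (L2_norm w)\<^sup>2"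
  obtains \<rho> c where "0 \<le> \<rho>" and "\<rho> < 1" and "c \<ge> 0"
    and "\<And>(\<xi>::real^'n) T l. T \<ge> 0 \<Longrightarrow> (\<And>t. l t = expm (- (transpose A + transpose C ** K)) t *v \<xi>)
        \<Longrightarrow> (\<And>t. t \<in> {0..T} \<Longrightarrow> transpose B *v l t = 0)
        \<Longrightarrow> integral {0..T} (\<lambda>t. l t \<bullet> ((E ** Qi ** transpose E) *v l t))
           \<le> \<rho> * integral {0..T} (\<lambda>t. l t \<bullet> ((transpose K ** K) *v l t)) + c * (norm (l T))\<^sup>2"
proof -
  obtain c0 where c0: "c0 \<ge> 0"
    "\<And>f x T. f \<in> L2 \<Longrightarrow> caratheodory A f 0 x \<Longrightarrow> T \<ge> 0 \<Longrightarrow> (norm (x T))\<^sup>2 \<le> c0 * (L2_norm f)\<^sup>2"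
    using hurwitz_state_bound[OF A] by blast
  obtain bB where bB: "bB > 0" "\<And>x. (norm (B *v x))\<^sup>2 \<le> bB * (norm x)\<^sup>2" using matrix_norm_bound by blast
  obtain bE where bE: "bE > 0" "\<And>x. (norm (E *v x))\<^sup>2 \<le> bE * (norm x)\<^sup>2" using matrix_norm_bound by blast
  obtain bQ where bQ: "bQ > 0" "\<And>x. (norm (Q *v x))\<^sup>2 \<le> bQ * (norm x)\<^sup>2" using matrix_norm_bound by blast
  \<comment> \<open>Adding \<open>2 * \<epsilon>\<close> to the upper bound of \<open>Q\<close> keeps the
    contraction factor \<open>\<kappa>\<close> positive.\<close>
  define q where "q = 1 + bQ + 2 * \<epsilon>"
  have q: "q > 0" using bQ(1) pos(2) by (simp add: q_def)
  have Qq: "w \<bullet> (Q *v w) \<le> q * (norm w)\<^sup>2" for w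
  proof -
    have "w \<bullet> (Q *v w) \<le> (norm w)\<^sup>2 + (norm (Q *v w))\<^sup>2"
      using abs_inner_le[of w "Q *v w"] by linarith
    also have "\<dots> \<le> (norm w)\<^sup>2 + bQ * (norm w)\<^sup>2" using bQ(2)[of w] by simp
    also have "\<dots> \<le> q * (norm w)\<^sup>2" using pos(2) by (simp add: q_def algebra_simps)
    finally show ?thesis .
  qed
  define \<kappa> where "\<kappa> = 1 - \<epsilon> / q"
  have \<kappa>: "\<kappa> > 0" "\<kappa> < 1" using pos(2) q bQ(1) by (auto simp: \<kappa>_def q_def field_simps)
  define c2 where "c2 = c0 * (2 * bB / \<eta> + 2 * bE / \<delta>) + 1"
  have c2: "c2 > 0" using c0(1) bB(1) bE(1) pos by (simp add: c2_def add_nonneg_pos)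
  define \<tau> where "\<tau> = (1 - \<kappa>) / (2 * c2)"
  have \<tau>: "\<tau> > 0" using \<kappa> c2 by (simp add: \<tau>_def)
  show thesis
  proof (rule that)
    show "0 \<le> 2 * \<kappa> / (1 + \<kappa>)" "2 * \<kappa> / (1 + \<kappa>) < 1" "2 / (\<tau> * (1 + \<kappa>)) \<ge> 0"
      using \<kappa> \<tau> by (auto simp: field_simps)
    fix \<xi> :: "real^'n" and T :: real and l
    assume T: "T \<ge> 0" and l: "\<And>t. l t = expm (- (transpose A + transpose C ** K)) t *v \<xi>"
      and Bl: "\<And>t. t \<in> {0..T} \<Longrightarrow> transpose B *v l t = 0"
    define M where "M = transpose A + transpose C ** K"
    define a where "a = integral {0..T} (\<lambda>t. l t \<bullet> ((E ** Qi ** transpose E) *v l t))"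
    define b where "b = integral {0..T} (\<lambda>t. l t \<bullet> ((transpose K ** K) *v l t))"
    have cl: "continuous_on S l" for S
      unfolding l[abs_def]
      by (intro bounded_bilinear.continuous_on[OF bounded_bilinear_matrix_vector] continuous_intros)
    define w where "w t = (if t \<in> {0..T} then Qi *v (transpose E *v l t) else 0)" for t
    have w: "w \<in> L2" unfolding w_def[abs_def] by (rule L2_truncated) (intro continuous_intros cl)
    have Ql: "transpose E *v l t = Q *v (Qi *v (transpose E *v l t))" for t
      by (simp add: matrix_vector_mul_assoc Qi)
    have inner_tr: "(transpose N *v y) \<bullet> z = y \<bullet> (N *v z)" for N :: "real^'j^'i" and y z
      by (simp add: dot_lmul_matrix)
    have wQw: "w t \<bullet> (Q *v w t) = l t \<bullet> ((E ** Qi ** transpose E) *v l t)" if "t \<in> {0..T}" for t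
    proof -
      have "w t \<bullet> (Q *v w t) = (transpose E *v l t) \<bullet> (Qi *v (transpose E *v l t))"
        using that Ql[of t] by (simp only: w_def if_True inner_commute)
      then show ?thesis by (simp only: inner_tr matrix_vector_mul_assoc[symmetric])
    qed
    have a_eq: "integral {0..} (\<lambda>t. w t \<bullet> (Q *v w t)) = a"
      unfolding a_def
      by (rule integral_truncated[OF quadratic_form_integrable[OF cl] wQw]) (auto simp: w_def)
    have wQ_int: "(\<lambda>t. w t \<bullet> (Q *v w t)) integrable_on {0..}"
      by (intro L2_inner_integrable L2_matrix w)
    have w_low: "\<delta> * (L2_norm w)\<^sup>2 \<le> a" and w_up: "a \<le> q * (L2_norm w)\<^sup>2"
    proof -
      have "integral {0..} (\<lambda>t. \<delta> * (norm (w t))\<^sup>2) \<le> integral {0..} (\<lambda>t. w t \<bullet> (Q *v w t))"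
        using Q wQ_int by (intro integral_le integrable_on_mult_right L2_square_integrable w) auto
      then show "\<delta> * (L2_norm w)\<^sup>2 \<le> a" by (simp add: L2_norm_squared w a_eq)
      have "integral {0..} (\<lambda>t. w t \<bullet> (Q *v w t)) \<le> integral {0..} (\<lambda>t. q * (norm (w t))\<^sup>2)"
        using Qq wQ_int by (intro integral_le integrable_on_mult_right L2_square_integrable w) auto
      then show "a \<le> q * (L2_norm w)\<^sup>2" by (simp add: L2_norm_squared w a_eq)
    qed
    have a0: "a \<ge> 0" using w_low pos(1) by (smt (verit) mult_nonneg_nonneg zero_le_power2)
    obtain d x where d: "d \<in> L2" and x: "caratheodory A (\<lambda>s. B *v d s + E *v w s) 0 x"
      and y: "(\<lambda>t. C *v x t) \<in> L2"
      and ineq: "(L2_norm (\<lambda>t. C *v x t))\<^sup>2 + \<eta> * (L2_norm d)\<^sup>2 \<le> a - \<epsilon> * (L2_norm w)\<^sup>2"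
      using similar[OF w] unfolding a_eq by blast
    have "a / q \<le> (L2_norm w)\<^sup>2" using w_up q by (simp add: field_simps)
    then have "\<epsilon> * (a / q) \<le> \<epsilon> * (L2_norm w)\<^sup>2" using pos(2) by (intro mult_left_mono) auto
    then have y_le: "(L2_norm (\<lambda>t. C *v x t))\<^sup>2 + \<eta> * (L2_norm d)\<^sup>2 \<le> \<kappa> * a"
      using ineq by (simp add: \<kappa>_def algebra_simps)
    define f where "f s = B *v d s + E *v w s" for s
    have f: "f \<in> L2" unfolding f_def by (intro L2_add L2_matrix d w)
    have f_le: "(L2_norm f)\<^sup>2 \<le> 2 * bB * (L2_norm d)\<^sup>2 + 2 * bE * (L2_norm w)\<^sup>2"
    proof -
      have "integral {0..} (\<lambda>t. (norm (f t))\<^sup>2)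
          \<le> integral {0..} (\<lambda>t. 2 * bB * (norm (d t))\<^sup>2 + 2 * bE * (norm (w t))\<^sup>2)"
      proof (rule integral_le)
        show "(norm (f t))\<^sup>2 \<le> 2 * bB * (norm (d t))\<^sup>2 + 2 * bE * (norm (w t))\<^sup>2" for t
          using norm_add_squared_le[of "B *v d t" "E *v w t"] bB(2)[of "d t"] bE(2)[of "w t"]
          by (simp add: f_def)
      qed (intro L2_square_integrable f Henstock_Kurzweil_Integration.integrable_add integrable_on_mult_right d w)+
      then show ?thesis
        using integrable_on_mult_right[OF L2_square_integrable[OF d], of "2 * bB"]
          integrable_on_mult_right[OF L2_square_integrable[OF w], of "2 * bE"]
        by (simp add: L2_norm_squared f d w Henstock_Kurzweil_Integration.integral_add)
    qed
    have "\<eta> * (L2_norm d)\<^sup>2 \<le> a"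
      using y_le \<kappa> a0 mult_right_mono[of \<kappa> 1 a] zero_le_power2[of "L2_norm (\<lambda>t. C *v x t)"] by linarith
    then have "2 * bB * (L2_norm d)\<^sup>2 \<le> 2 * bB / \<eta> * a"
      using pos(3) bB(1) by (simp add: field_simps)
    moreover have "2 * bE * (L2_norm w)\<^sup>2 \<le> 2 * bE / \<delta> * a"
      using w_low pos(1) bE(1) by (simp add: field_simps)
    ultimately have "(L2_norm f)\<^sup>2 \<le> (2 * bB / \<eta> + 2 * bE / \<delta>) * a"
      using f_le by (simp add: algebra_simps)
    then have "c0 * (L2_norm f)\<^sup>2 \<le> c0 * ((2 * bB / \<eta> + 2 * bE / \<delta>) * a)"
      using c0(1) by (rule mult_left_mono)
    moreover have "(norm (x T))\<^sup>2 \<le> c0 * (L2_norm f)\<^sup>2"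
      using c0(2)[OF f _ T, of x] x unfolding f_def by blast
    ultimately have xT: "(norm (x T))\<^sup>2 \<le> c2 * a"
      using a0 by (simp add: c2_def algebra_simps)
    have dl: "(l has_vector_derivative - (M *v l t)) (at t)" for t
    proof -
      have "((\<lambda>t. expm (- M) t *v \<xi>) has_vector_derivative (- M ** expm (- M) t) *v \<xi>) (at t)"
        by (rule bounded_linear.has_vector_derivative[OF
              bounded_bilinear.bounded_linear_left[OF bounded_bilinear_matrix_vector] expm_has_vector_derivative])
      then show ?thesis unfolding l[abs_def] M_def[symmetric]
        by (simp add: matrix_vector_mul_assoc[symmetric] bounded_bilinear.minus_left[OF bounded_bilinear_matrix_vector])
    qed
    note il = integral_of_vector_derivative[OF dl, OF continuous_on_minus[OF matrix_mult_continuous[OF cl]]]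
    have x': "caratheodory A f 0 x" using x unfolding f_def .
    \<comment> \<open>Integrating the derivative of \<open>x \<bullet> l\<close>; the term with \<open>d\<close>
      vanishes.\<close>
    note pair = caratheodory_inner[OF x' T il(1)[of T] il(2)]
    have integrand: "x t \<bullet> (- (M *v l t)) + (A *v x t + f t) \<bullet> l t
        = w t \<bullet> (Q *v w t) - (C *v x t) \<bullet> (K *v l t)" if t: "t \<in> {0..T}" for t
    proof -
      have "x t \<bullet> (M *v l t) = (A *v x t) \<bullet> l t + (C *v x t) \<bullet> (K *v l t)"
        by (simp add: M_def matrix_vector_mult_add_rdistrib inner_add_right matrix_vector_mul_assoc[symmetric]
            inner_transpose_mult inner_commute del: transpose_matrix_vector)
      moreover have "(B *v d t) \<bullet> l t = 0"
        using Bl[OF t] inner_transpose_mult[of "d t" B "l t"] by (simp add: inner_commute)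
      moreover have "(E *v w t) \<bullet> l t = w t \<bullet> (Q *v w t)"
      proof -
        have "(E *v w t) \<bullet> l t = w t \<bullet> (transpose E *v l t)"
          using inner_transpose_mult[of "w t" E "l t"] by (simp add: inner_commute)
        also have "transpose E *v l t = Q *v w t" using Ql[of t] t by (simp only: w_def if_True)
        finally show ?thesis .
      qed
      ultimately show ?thesis by (simp add: f_def inner_add_left)
    qed
    have cx: "continuous_on {0..T} x" using caratheodory_continuous[OF x] .
    have y_int: "(\<lambda>t. (norm (C *v x t))\<^sup>2) integrable_on {0..T}"
      by (intro integrable_continuous_real continuous_intros cx)
    have y_T: "integral {0..T} (\<lambda>t. (norm (C *v x t))\<^sup>2) \<le> \<kappa> * a"
      using integral_interval_le_halfline[OF L2_square_integrable[OF y], of T] y_le pos(3)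
      by (simp add: L2_norm_squared y) (smt (verit) mult_nonneg_nonneg zero_le_power2)
    have Kl: "l t \<bullet> ((transpose K ** K) *v l t) = (norm (K *v l t))\<^sup>2" for t
      by (simp add: matrix_vector_mul_assoc[symmetric] inner_transpose_mult power2_norm_eq_inner del: transpose_matrix_vector)
    have b_int: "(\<lambda>t. (norm (K *v l t))\<^sup>2) integrable_on {0..T}"
      by (intro integrable_continuous_real continuous_intros cl)
    have cross: "integral {0..T} (\<lambda>t. (C *v x t) \<bullet> (K *v l t)) \<le> a / 2 + \<kappa> / 2 * b"
    proof -
      have "integral {0..T} (\<lambda>t. (C *v x t) \<bullet> (K *v l t))
          \<le> integral {0..T} (\<lambda>t. (1 / (2 * \<kappa>)) * (norm (C *v x t))\<^sup>2 + \<kappa> / 2 * (norm (K *v l t))\<^sup>2)"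
      proof (rule integral_le)
        show "(C *v x t) \<bullet> (K *v l t) \<le> (1 / (2 * \<kappa>)) * (norm (C *v x t))\<^sup>2 + \<kappa> / 2 * (norm (K *v l t))\<^sup>2" for t
          using inner_young[OF \<kappa>(1), of "K *v l t" "C *v x t"] by (simp add: inner_commute field_simps)
      qed (intro integrable_continuous_real continuous_intros cx cl)+
      also have "\<dots> = (1 / (2 * \<kappa>)) * integral {0..T} (\<lambda>t. (norm (C *v x t))\<^sup>2) + \<kappa> / 2 * b"
        using integrable_on_mult_right[OF y_int, of "1 / (2 * \<kappa>)"] integrable_on_mult_right[OF b_int, of "\<kappa> / 2"]
        by (simp add: b_def Kl Henstock_Kurzweil_Integration.integral_add del: times_divide_eq_left)
      also have "\<dots> \<le> (1 / (2 * \<kappa>)) * (\<kappa> * a) + \<kappa> / 2 * b"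
        using y_T \<kappa>(1) by (intro add_right_mono mult_left_mono) auto
      finally show ?thesis using \<kappa>(1) by simp
    qed
    have xl: "x T \<bullet> l T = a - integral {0..T} (\<lambda>t. (C *v x t) \<bullet> (K *v l t))"
    proof -
      have 1: "((\<lambda>t. w t \<bullet> (Q *v w t) - (C *v x t) \<bullet> (K *v l t)) has_integral (x T \<bullet> l T - 0 \<bullet> l 0)) {0..T}"
        by (rule has_integral_eq[OF integrand pair])
      have 2: "((\<lambda>t. w t \<bullet> (Q *v w t)) has_integral a) {0..T}"
        unfolding a_def by (rule has_integral_eq[OF wQw[symmetric] integrable_integral[OF quadratic_form_integrable[OF cl]]])
      have 3: "(\<lambda>t. (C *v x t) \<bullet> (K *v l t)) integrable_on {0..T}"
        by (intro integrable_continuous_real continuous_intros cx cl)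
      show ?thesis
        using has_integral_unique[OF 1 has_integral_diff[OF 2 integrable_integral[OF 3]]] by simp
    qed
    have "2 * (x T \<bullet> l T) \<le> \<tau> * (norm (x T))\<^sup>2 + (norm (l T))\<^sup>2 / \<tau>"
      by (rule inner_young[OF \<tau>])
    also have "\<dots> \<le> \<tau> * (c2 * a) + (norm (l T))\<^sup>2 / \<tau>"
      using xT \<tau> by (intro add_right_mono mult_left_mono) auto
    also have "\<tau> * (c2 * a) = (1 - \<kappa>) / 2 * a" using c2 by (simp add: \<tau>_def)
    finally have "a \<le> (1 - \<kappa>) / 2 * a + (norm (l T))\<^sup>2 / \<tau> + \<kappa> * b"
      using xl cross by (simp add: algebra_simps)
    then have "(1 + \<kappa>) * a \<le> 2 * \<kappa> * b + 2 * ((norm (l T))\<^sup>2 / \<tau>)"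
      by (simp add: field_simps)
    then have "a \<le> (2 * \<kappa> * b + 2 * ((norm (l T))\<^sup>2 / \<tau>)) / (1 + \<kappa>)"
      using \<kappa>(1) by (subst pos_le_divide_eq) (simp_all add: mult.commute)
    also have "\<dots> = 2 * \<kappa> / (1 + \<kappa>) * b + 2 / (\<tau> * (1 + \<kappa>)) * (norm (l T))\<^sup>2"
      by (simp add: add_divide_distrib)
    finally show "integral {0..T} (\<lambda>t. l t \<bullet> ((E ** Qi ** transpose E) *v l t))
           \<le> 2 * \<kappa> / (1 + \<kappa>) * integral {0..T} (\<lambda>t. l t \<bullet> ((transpose K ** K) *v l t))
             + 2 / (\<tau> * (1 + \<kappa>)) * (norm (l T))\<^sup>2"
      unfolding a_def b_def .
  qed
qed

section \<open>Necessity of the matrix inequality\<close>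

text \<open>The least squares matrix \<open>K\<close> of the data \<open>(\<xi>\<^sub>j, v\<^sub>j)\<close>, characterised by its normal equations. These are
  solvable also if the \<open>\<xi>\<^sub>j\<close> do not span the space.\<close>

lemma normal_equations:
  fixes \<xi> :: "nat \<Rightarrow> real^'n" and v :: "nat \<Rightarrow> real^'p"
  obtains K :: "real^'n^'p" where "(\<Sum>j<k. outer (v j) (\<xi> j)) = (\<Sum>j<k. outer (K *v \<xi> j) (\<xi> j))"
proof -
  define N where "N = (\<Sum>j<k. outer (\<xi> j) (\<xi> j))"
  have Nx: "N *v x = (\<Sum>j<k. (\<xi> j \<bullet> x) *\<^sub>R \<xi> j)" for x
    by (simp add: N_def sum_matrix_vector_mult outer_mult_vec)
  have ex: "\<exists>a. N *v a = (\<Sum>j<k. c j *\<^sub>R \<xi> j)" for c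
  proof -
    define r where "r = (\<Sum>j<k. c j *\<^sub>R \<xi> j)"
    have sub: "subspace (range ((*v) N))"
      by (rule linear_subspace_image[OF matrix_vector_mul_linear subspace_UNIV])
    obtain y z where y: "y \<in> span (range ((*v) N))" and z: "\<And>w. w \<in> span (range ((*v) N)) \<Longrightarrow> orthogonal z w"
      and r: "r = y + z"
      using orthogonal_subspace_decomp_exists[of "range ((*v) N)" r] by blast
    have "z \<bullet> (N *v z) = 0" using z[of "N *v z"] by (auto simp: orthogonal_def intro: span_base)
    then have "(\<Sum>j<k. (\<xi> j \<bullet> z)\<^sup>2) = 0"
      by (simp add: Nx inner_sum_right power2_eq_square inner_commute)
    then have "(\<xi> j \<bullet> z)\<^sup>2 = 0" if "j < k" for j
      using that by (subst (asm) sum_nonneg_eq_0_iff) auto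
    then have "r \<bullet> z = 0" by (simp add: r_def inner_sum_left)
    moreover have "y \<bullet> z = 0" using z[OF y] by (simp add: orthogonal_def inner_commute)
    ultimately have "z \<bullet> z = 0" by (simp add: r inner_add_left)
    then have "r = y" using r by simp
    moreover have "span (range ((*v) N)) = range ((*v) N)" by (rule span_eq_iff[THEN iffD2, OF sub])
    ultimately have "r \<in> range ((*v) N)" using y by metis
    then show ?thesis by (auto simp: r_def)
  qed
  have "\<exists>a. \<forall>i. N *v a i = (\<Sum>j<k. (v j $ i) *\<^sub>R \<xi> j)"
    by (rule choice, rule allI, rule ex)
  then obtain a where a: "\<And>i. N *v a i = (\<Sum>j<k. (v j $ i) *\<^sub>R \<xi> j)" by blast
  define K where "K = (\<chi> i. a i)"
  show thesis
  proof (rule that)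
    have Kx: "(K *v x) $ i = a i \<bullet> x" for x i
      by (simp add: K_def matrix_vector_mult_def inner_vec_def)
    have "(\<Sum>j<k. outer (v j) (\<xi> j)) $ i = (\<Sum>j<k. outer (K *v \<xi> j) (\<xi> j)) $ i" for i
    proof -
      have o: "outer b c $ i = (b $ i) *\<^sub>R c" for b :: "real^'p" and c :: "real^'n"
        by (simp add: outer_def vec_eq_iff)
      show ?thesis using a[of i] by (simp add: o Kx Nx inner_commute)
    qed
    then show "(\<Sum>j<k. outer (v j) (\<xi> j)) = (\<Sum>j<k. outer (K *v \<xi> j) (\<xi> j))"
      by (simp add: vec_eq_iff)
  qed
qed

lemma outer_add: "outer (a + b) c = outer a c + outer b c" "outer c (a + b) = outer c a + outer c b"
  by (simp_all add: vec_eq_iff outer_def algebra_simps)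

lemma outer_mult: "outer (F *v a) (H *v b) = F ** outer a b ** transpose H"
  by (simp add: vec_eq_iff outer_def matrix_matrix_mult_def matrix_vector_mult_def transpose_def
      sum_product sum_distrib_left sum_distrib_right mult_ac)

lemma sum_matrix_mult:
  "F ** (\<Sum>j\<in>J. M j) ** H = (\<Sum>j\<in>J. F ** M j ** (H :: real^'c^'b))" for F :: "real^'n^'m"
  by (simp add: bounded_bilinear.sum_left[OF bounded_bilinear_matrix_matrix]
      bounded_bilinear.sum_right[OF bounded_bilinear_matrix_matrix])

text \<open>Let \<open>Z = \<Sum> \<xi>\<^sub>j \<xi>\<^sub>j\<^sup>T\<close> satisfy \<open>M Z + Z M\<^sup>T = \<Sum> g\<^sub>j g\<^sub>j\<^sup>T\<close>. Then the decay of the Gramian of the solutions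
  \<open>e\<^bsup>-tM\<^esup> \<xi>\<^sub>j\<close> is exactly compensated by the accumulated contributions of the solutions \<open>e\<^bsup>-tM\<^esup> g\<^sub>j\<close>; in other words
  \<open>Z\<close> is the stationary covariance of the equation \<open>l' = - M l\<close> excited by the \<open>g\<^sub>j\<close>.\<close>

lemma gramian_balance:
  fixes M W :: "real^'n^'n" and \<xi> g :: "nat \<Rightarrow> real^'n"
  assumes gram: "(\<Sum>j<k. outer (M *v \<xi> j) (\<xi> j) + outer (\<xi> j) (M *v \<xi> j)) = (\<Sum>j<k. outer (g j) (g j))"
    and T: "T \<ge> 0"
  defines "l \<equiv> \<lambda>j t. expm (- M) t *v \<xi> j" and "h \<equiv> \<lambda>j t. expm (- M) t *v g j"
  shows "((\<lambda>t. \<Sum>j<k. h j t \<bullet> (W *v h j t)) has_integral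
      (\<Sum>j<k. \<xi> j \<bullet> (W *v \<xi> j)) - (\<Sum>j<k. l j T \<bullet> (W *v l j T))) {0..T}"
proof -
  define s where "s t = - (\<Sum>j<k. l j t \<bullet> (W *v l j t))" for t
  have dl: "(l j has_vector_derivative - (M *v l j t)) (at t within S)" for j t S
  proof -
    have "((\<lambda>t. expm (- M) t *v \<xi> j) has_vector_derivative (- M ** expm (- M) t) *v \<xi> j) (at t within S)"
      by (rule bounded_linear.has_vector_derivative[OF
            bounded_bilinear.bounded_linear_left[OF bounded_bilinear_matrix_vector] expm_has_vector_derivative])
    then show ?thesis unfolding l_def
      by (simp add: matrix_vector_mul_assoc[symmetric] bounded_bilinear.minus_left[OF bounded_bilinear_matrix_vector])
  qed
  have dW: "((\<lambda>t. W *v l j t) has_vector_derivative W *v (- (M *v l j t))) (at t within S)" for j t S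
    by (rule bounded_linear.has_vector_derivative[OF matrix_vector_mul_bounded_linear dl])
  have M_l: "M *v l j t = expm (- M) t *v (M *v \<xi> j)" for j t
  proof -
    have "expm (- M) t ** (- M) = (- M) ** expm (- M) t" by (rule expm_commute)
    then have "expm (- M) t ** M = M ** expm (- M) t"
      by (simp add: bounded_bilinear.minus_left[OF bounded_bilinear_matrix_matrix]
          bounded_bilinear.minus_right[OF bounded_bilinear_matrix_matrix])
    then show ?thesis by (simp add: l_def matrix_vector_mul_assoc)
  qed
  have gram_t: "(\<Sum>j<k. outer (M *v l j t) (l j t) + outer (l j t) (M *v l j t)) = (\<Sum>j<k. outer (h j t) (h j t))" for t
  proof -
    let ?\<Phi> = "expm (- M) t"
    have "(\<Sum>j<k. outer (M *v l j t) (l j t) + outer (l j t) (M *v l j t))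
        = (\<Sum>j<k. ?\<Phi> ** (outer (M *v \<xi> j) (\<xi> j) + outer (\<xi> j) (M *v \<xi> j)) ** transpose ?\<Phi>)"
      unfolding M_l unfolding l_def
      by (simp add: outer_mult bounded_bilinear.add_left[OF bounded_bilinear_matrix_matrix]
          bounded_bilinear.add_right[OF bounded_bilinear_matrix_matrix])
    also have "\<dots> = ?\<Phi> ** (\<Sum>j<k. outer (g j) (g j)) ** transpose ?\<Phi>"
      by (simp only: sum_matrix_mult[symmetric] gram)
    also have "\<dots> = (\<Sum>j<k. outer (h j t) (h j t))"
      by (simp add: sum_matrix_mult h_def outer_mult)
    finally show ?thesis .
  qed
  have ds: "(s has_vector_derivative (\<Sum>j<k. h j t \<bullet> (W *v h j t))) (at t within {0..T})" for t
  proof -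
    have "((\<lambda>t. \<Sum>j<k. l j t \<bullet> (W *v l j t)) has_vector_derivative
        (\<Sum>j<k. l j t \<bullet> (W *v - (M *v l j t)) + (- (M *v l j t)) \<bullet> (W *v l j t))) (at t within {0..T})"
      by (intro has_vector_derivative_sum bounded_bilinear.has_vector_derivative[OF bounded_bilinear_inner] dl dW)
    then have "(s has_vector_derivative
        - (\<Sum>j<k. l j t \<bullet> (W *v - (M *v l j t)) + (- (M *v l j t)) \<bullet> (W *v l j t))) (at t within {0..T})"
      unfolding s_def[abs_def] by (rule has_vector_derivative_minus)
    also have "- (\<Sum>j<k. l j t \<bullet> (W *v - (M *v l j t)) + (- (M *v l j t)) \<bullet> (W *v l j t))
        = W \<bullet> (\<Sum>j<k. outer (M *v l j t) (l j t) + outer (l j t) (M *v l j t))"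
      by (simp add: inner_sum_right inner_outer inner_add_right sum_negf[symmetric]
          bounded_bilinear.minus_right[OF bounded_bilinear_matrix_vector] add.commute)
    also have "\<dots> = (\<Sum>j<k. h j t \<bullet> (W *v h j t))"
      unfolding gram_t by (simp add: inner_sum_right inner_outer)
    finally show ?thesis .
  qed
  have "((\<lambda>t. \<Sum>j<k. h j t \<bullet> (W *v h j t)) has_integral s T - s 0) {0..T}"
    by (rule fundamental_theorem_of_calculus[OF T]) (rule ds)
  then show ?thesis by (simp add: s_def l_def)
qed

lemma pos_form_inverse:
  fixes Q :: "real^'m^'m"
  assumes sym: "transpose Q = Q" and \<delta>: "\<delta> > 0" and Q: "\<And>w. \<delta> * (norm w)\<^sup>2 \<le> w \<bullet> (Q *v w)"
  obtains Qi where "Q ** Qi = mat 1" and "transpose Qi = Qi"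
    and "\<And>y. y \<bullet> (Qi *v y) \<ge> 0" and "\<And>y. y \<bullet> (Qi *v y) = 0 \<Longrightarrow> y = 0"
    and "\<And>y w. 2 * (y \<bullet> w) - w \<bullet> (Q *v w) \<le> y \<bullet> (Qi *v y)"
proof -
  have pd: "0 < v \<bullet> (Q *v v)" if "v \<noteq> 0" for v
    using Q[of v] \<delta> that by (smt (verit) mult_pos_pos zero_less_norm_iff zero_less_power)
  then have "pos_definite Q" using sym by (simp add: pos_definite_def)
  then obtain Qi where Qi: "pos_definite Qi" "Q ** Qi = mat 1" using pos_definite_inverse by blast
  show thesis
  proof (rule that[OF Qi(2)])
    show "transpose Qi = Qi" using Qi(1) by (simp add: pos_definite_def)
    show "y \<bullet> (Qi *v y) \<ge> 0" for y
      using Qi(1) unfolding pos_definite_def by (cases "y = 0") (auto intro: less_imp_le)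
    show "y \<bullet> (Qi *v y) = 0 \<Longrightarrow> y = 0" for y
      using Qi(1) unfolding pos_definite_def by fastforce
    show "2 * (y \<bullet> w) - w \<bullet> (Q *v w) \<le> y \<bullet> (Qi *v y)" for y w
    proof -
      define u where "u = Qi *v y"
      have y: "y = Q *v u" by (simp add: u_def matrix_vector_mul_assoc Qi)
      have s: "u \<bullet> (Q *v w) = w \<bullet> (Q *v u)"
        using inner_transpose_mult[of u Q w] sym by simp
      have "0 \<le> (w - u) \<bullet> (Q *v (w - u))"
        using pd[of "w - u"] by (cases "w = u") (auto intro: less_imp_le)
      also have "\<dots> = w \<bullet> (Q *v w) - 2 * (w \<bullet> (Q *v u)) + u \<bullet> (Q *v u)"
        by (simp add: matrix_vector_mult_diff_distrib inner_diff_left inner_diff_right s)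
      finally have "2 * (w \<bullet> (Q *v u)) - w \<bullet> (Q *v w) \<le> u \<bullet> (Q *v u)" by simp
      moreover have "y \<bullet> w = w \<bullet> (Q *v u)" "y \<bullet> (Qi *v y) = u \<bullet> (Q *v u)"
        unfolding u_def[symmetric] using y by (simp_all add: inner_commute)
      ultimately show ?thesis by simp
    qed
  qed
qed

lemma transpose_mult_inner: "(transpose N *v y) \<bullet> z = y \<bullet> (N *v z)" for N :: "real^'j^'i"
  by (metis inner_commute inner_transpose_mult)

text \<open>From the estimate to the inequality. If the inequality had no solution, \<open>quadratic_alternative\<close> would give
  vectors \<open>\<xi>\<^sub>j, w\<^sub>j, v\<^sub>j, g\<^sub>j\<close>; the component \<open>g\<close> is the multiplier of the constraint that \<open>X\<close> be positive
  definite. The equations that they satisfy say that \<open>B\<^sup>T \<xi>\<^sub>j = 0\<close> and that the adjoint equation with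
  feedback \<open>v = K \<xi>\<close>, excited by the \<open>g\<^sub>j\<close>, has stationary covariance \<open>\<Sum> \<xi>\<^sub>j \<xi>\<^sub>j\<^sup>T\<close>. With \<open>\<alpha>\<close> and \<open>\<beta>\<close> the
  stationary means of \<open>l \<bullet> E Q\<^sup>-\<^sup>1 E\<^sup>T l\<close> and \<open>(norm (K l))\<^sup>2\<close>, the certificate says \<open>\<beta> \<le> \<alpha>\<close>, whereas adding up
  \<open>adjoint_estimate\<close> over all the solutions and a time interval of length \<open>T\<close> gives \<open>T \<alpha> \<le> \<rho> T \<beta> + const\<close>. Hence
  \<open>\<alpha> = 0\<close>, and what remains of the certificate contradicts \<open>hurwitz_no_growing_gramian\<close>.\<close>

lemma lmi_necessary:
  fixes A :: "real^'n^'n" and B :: "real^'q^'n" and E :: "real^'m^'n" and C :: "real^'n^'p"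
    and Q :: "real^'m^'m"
  assumes A: "hurwitz A" and pos: "\<delta> > 0" "\<epsilon> > 0" "\<eta> > 0"
    and Q_sym: "transpose Q = Q" and Q: "\<And>w. \<delta> * (norm w)\<^sup>2 \<le> w \<bullet> (Q *v w)"
    and similar: "\<And>w. w \<in> L2 \<Longrightarrow> \<exists>d x. d \<in> L2 \<and> caratheodory A (\<lambda>s. B *v d s + E *v w s) 0 x
        \<and> (\<lambda>t. C *v x t) \<in> L2
        \<and> (L2_norm (\<lambda>t. C *v x t))\<^sup>2 + \<eta> * (L2_norm d)\<^sup>2
            \<le> integral {0..} (\<lambda>t. w t \<bullet> (Q *v w t)) - \<epsilon> * (L2_norm w)\<^sup>2"
  shows "\<exists>X F. pos_definite X \<and> (\<forall>z. z \<noteq> 0 \<longrightarrow> lmi_form A B E C Q X F z < 0)"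
proof -
  define q where "q = (\<lambda>(\<xi>::real^'n, w::real^'m, v::real^'p, g::real^'n). 2 * (\<xi> \<bullet> (E *v w)) - w \<bullet> (Q *v w) - v \<bullet> v)"
  \<comment> \<open>The terms of the form that involve a symmetric \<open>X\<close> are \<open>2 b \<bullet> X
    \<xi> - g \<bullet> X g\<close>.\<close>
  define b where "b = (\<lambda>(\<xi>::real^'n, w::real^'m, v::real^'p, g::real^'n). transpose A *v \<xi> + transpose C *v v)"
  define l where "l z = (outer (b z) (fst z) + outer (fst z) (b z) - outer (snd (snd (snd z))) (snd (snd (snd z))),
      2 *\<^sub>R outer (transpose B *v fst z) (fst z))" for z
  have "\<exists>X. \<forall>z. z \<noteq> 0 \<longrightarrow> q z + X \<bullet> l z < 0"
  proof (rule ccontr)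
    assume "\<nexists>X. \<forall>z. z \<noteq> 0 \<longrightarrow> q z + X \<bullet> l z < 0"
    then have inf: "\<exists>z. z \<noteq> 0 \<and> q z + X \<bullet> l z \<ge> 0" for X by (meson not_less)
    have cq: "continuous_on UNIV q" unfolding q_def case_prod_beta by (intro continuous_intros)
    have cl: "continuous_on UNIV l" unfolding l_def b_def case_prod_beta by (intro continuous_intros)
    have hq: "q (c *\<^sub>R z) = c\<^sup>2 * q z" for c z
      by (cases z) (simp add: q_def matrix_vector_mult_scaleR power2_eq_square algebra_simps)
    have hl: "l (c *\<^sub>R z) = c\<^sup>2 *\<^sub>R l z" for c z
    proof -
      have "b (c *\<^sub>R z) = c *\<^sub>R b z"
        by (cases z) (simp add: b_def matrix_vector_mult_scaleR scaleR_add_right del: transpose_matrix_vector)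
      then show ?thesis
        by (simp add: l_def matrix_vector_mult_scaleR outer_scaleR power2_eq_square algebra_simps
            del: transpose_matrix_vector)
    qed
    obtain k :: nat and z where z: "(\<Sum>j<k. (norm (z j))\<^sup>2) = 1" "(\<Sum>j<k. l (z j)) = 0" "(\<Sum>j<k. q (z j)) \<ge> 0"
      using quadratic_alternative[OF cq cl hq hl inf] by auto
    define \<xi> where "\<xi> j = fst (z j)" for j
    define w where "w j = fst (snd (z j))" for j
    define v where "v j = fst (snd (snd (z j)))" for j
    define g where "g j = snd (snd (snd (z j)))" for j
    have zj: "z j = (\<xi> j, w j, v j, g j)" for j by (simp add: \<xi>_def w_def v_def g_def)
    have bz: "b (z j) = transpose A *v \<xi> j + transpose C *v v j" for j by (simp add: zj b_def)
    have S1: "(\<Sum>j<k. outer (b (z j)) (\<xi> j) + outer (\<xi> j) (b (z j))) = (\<Sum>j<k. outer (g j) (g j))"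
      using arg_cong[OF z(2), of fst] by (simp add: fst_sum l_def sum_subtractf \<xi>_def g_def)
    have S2: "(\<Sum>j<k. outer (transpose B *v \<xi> j) (\<xi> j)) = 0"
      using arg_cong[OF z(2), of snd]
      by (simp add: snd_sum l_def scaleR_sum_right[symmetric] \<xi>_def del: transpose_matrix_vector)
    have S3: "(\<Sum>j<k. 2 * (\<xi> j \<bullet> (E *v w j)) - w j \<bullet> (Q *v w j) - v j \<bullet> v j) \<ge> 0"
      using z(3) by (simp add: q_def zj)
    have "(\<Sum>j<k. (norm (transpose B *v \<xi> j))\<^sup>2) = transpose B \<bullet> (\<Sum>j<k. outer (transpose B *v \<xi> j) (\<xi> j))"
      by (simp add: inner_sum_right inner_outer power2_norm_eq_inner del: transpose_matrix_vector)
    then have S2': "(\<Sum>j<k. (norm (transpose B *v \<xi> j))\<^sup>2) = 0" unfolding S2 by simp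
    obtain K where K: "(\<Sum>j<k. outer (v j) (\<xi> j)) = (\<Sum>j<k. outer (K *v \<xi> j) (\<xi> j))"
      using normal_equations .
    define M where "M = transpose A + transpose C ** K"
    have gram: "(\<Sum>j<k. outer (M *v \<xi> j) (\<xi> j) + outer (\<xi> j) (M *v \<xi> j)) = (\<Sum>j<k. outer (g j) (g j))"
    proof -
      have CF: "outer (transpose C *v a) c = transpose C ** outer a c ** mat 1" for a c
        using outer_mult[of "transpose C" a "mat 1" c] by simp
      have 1: "(\<Sum>j<k. outer (transpose C *v (K *v \<xi> j)) (\<xi> j)) = (\<Sum>j<k. outer (transpose C *v v j) (\<xi> j))"
        unfolding CF sum_matrix_mult[symmetric] K ..
      have tr: "(\<Sum>j<k. outer (\<xi> j) (f j)) = transpose (\<Sum>j<k. outer (f j) (\<xi> j))" for f :: "nat \<Rightarrow> real^'n"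
        by (simp add: vec_eq_iff transpose_def outer_def mult.commute)
      have 2: "(\<Sum>j<k. outer (\<xi> j) (transpose C *v (K *v \<xi> j))) = (\<Sum>j<k. outer (\<xi> j) (transpose C *v v j))"
        unfolding tr 1 ..
      have M: "M *v x = transpose A *v x + transpose C *v (K *v x)" for x
        by (simp only: M_def matrix_vector_mult_add_rdistrib matrix_vector_mul_assoc)
      show ?thesis
        unfolding S1[symmetric] bz M outer_add sum.distrib 1 2 ..
    qed
    obtain Qi where Qi: "Q ** Qi = mat 1" "transpose Qi = Qi"
      "\<And>y. y \<bullet> (Qi *v y) \<ge> 0" "\<And>y. y \<bullet> (Qi *v y) = 0 \<Longrightarrow> y = 0"
      "\<And>y w. 2 * (y \<bullet> w) - w \<bullet> (Q *v w) \<le> y \<bullet> (Qi *v y)"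
      using pos_form_inverse[OF Q_sym pos(1) Q] by blast
    define Wa where "Wa = E ** Qi ** transpose E"
    define Wb where "Wb = transpose K ** K"
    define Wc where "Wc = B ** transpose B"
    have Wa: "x \<bullet> (Wa *v x) = (transpose E *v x) \<bullet> (Qi *v (transpose E *v x))" for x
      by (simp only: Wa_def matrix_vector_mul_assoc[symmetric] transpose_mult_inner)
    have Wb: "x \<bullet> (Wb *v x) = (norm (K *v x))\<^sup>2" for x
      by (simp only: Wb_def matrix_vector_mul_assoc[symmetric] inner_transpose_mult power2_norm_eq_inner)
    have Wc: "x \<bullet> (Wc *v x) = (norm (transpose B *v x))\<^sup>2" for x
      by (simp only: Wc_def matrix_vector_mul_assoc[symmetric] transpose_mult_inner power2_norm_eq_inner)
    define \<alpha> where "\<alpha> = (\<Sum>j<k. \<xi> j \<bullet> (Wa *v \<xi> j))"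
    define \<beta> where "\<beta> = (\<Sum>j<k. \<xi> j \<bullet> (Wb *v \<xi> j))"
    \<comment> \<open>Completing the square in \<open>w\<close>.\<close>
    have v_le_\<alpha>: "(\<Sum>j<k. (norm (v j))\<^sup>2) \<le> \<alpha>"
    proof -
      have "2 * (\<xi> j \<bullet> (E *v w j)) - w j \<bullet> (Q *v w j) - v j \<bullet> v j \<le> \<xi> j \<bullet> (Wa *v \<xi> j) - (norm (v j))\<^sup>2" for j
        using Qi(5)[of "transpose E *v \<xi> j" "w j"] unfolding Wa transpose_mult_inner power2_norm_eq_inner by simp
      then have "0 \<le> (\<Sum>j<k. \<xi> j \<bullet> (Wa *v \<xi> j) - (norm (v j))\<^sup>2)"
        using S3 by (meson order_trans sum_mono)
      then show ?thesis by (simp add: \<alpha>_def sum_subtractf)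
    qed
    \<comment> \<open>Least squares reduces the norm.\<close>
    have \<beta>_le: "\<beta> \<le> \<alpha>"
    proof -
      have "(\<Sum>j<k. (K *v \<xi> j) \<bullet> v j) = \<beta>"
      proof -
        have "(\<Sum>j<k. (K *v \<xi> j) \<bullet> v j) = K \<bullet> (\<Sum>j<k. outer (v j) (\<xi> j))"
          by (simp add: inner_sum_right inner_outer inner_commute)
        also have "\<dots> = \<beta>" unfolding K \<beta>_def Wb
          by (simp add: inner_sum_right inner_outer power2_norm_eq_inner)
        finally show ?thesis .
      qed
      moreover have "0 \<le> (\<Sum>j<k. (norm (v j - K *v \<xi> j))\<^sup>2)" by (simp add: sum_nonneg)
      moreover have "(\<Sum>j<k. (norm (v j - K *v \<xi> j))\<^sup>2)
          = (\<Sum>j<k. (norm (v j))\<^sup>2) + \<beta> - 2 * (\<Sum>j<k. (K *v \<xi> j) \<bullet> v j)"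
        unfolding \<beta>_def Wb power2_norm_eq_inner
        by (simp add: inner_diff_left inner_diff_right inner_commute sum.distrib sum_subtractf sum_distrib_left)
      ultimately show ?thesis using v_le_\<alpha> by simp
    qed
    define L where "L j t = expm (- M) t *v \<xi> j" for j t
    define H where "H j t = expm (- M) t *v g j" for j t
    note balance = gramian_balance[OF gram, folded L_def H_def]
    have cL: "continuous_on S (L j)" and cH: "continuous_on S (H j)" for S j
      unfolding L_def[abs_def] H_def[abs_def]
      by (intro bounded_bilinear.continuous_on[OF bounded_bilinear_matrix_vector] continuous_intros)+
    \<comment> \<open>\<open>B\<^sup>T\<close> annihilates all these solutions: by the balance for \<open>B
      B\<^sup>T\<close>, two nonnegative quantities add up to 0.\<close>
    have BL: "transpose B *v L j t = 0" and BH: "transpose B *v H j t = 0" if "j < k" "t \<ge> 0" for j t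
    proof -
      define s where "s t = (\<Sum>j<k. (norm (transpose B *v H j t))\<^sup>2)" for t
      have s: "(s has_integral 0 - (\<Sum>j<k. (norm (transpose B *v L j T))\<^sup>2)) {0..T}" if "T \<ge> 0" for T
        using balance[OF that, of Wc] unfolding Wc S2' s_def[abs_def] .
      have s0: "s t \<ge> 0" for t by (simp add: s_def sum_nonneg)
      have L0: "(\<Sum>j<k. (norm (transpose B *v L j T))\<^sup>2) = 0" and I0: "integral {0..T} s = 0" if "T \<ge> 0" for T
      proof -
        have "0 \<le> 0 - (\<Sum>j<k. (norm (transpose B *v L j T))\<^sup>2)"
          by (rule has_integral_nonneg[OF s[OF that]]) (rule s0)
        moreover have "0 \<le> (\<Sum>j<k. (norm (transpose B *v L j T))\<^sup>2)" by (simp add: sum_nonneg)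
        ultimately show 1: "(\<Sum>j<k. (norm (transpose B *v L j T))\<^sup>2) = 0" by simp
        show "integral {0..T} s = 0" using integral_unique[OF s[OF that]] 1 by simp
      qed
      show "transpose B *v L j t = 0"
        using L0[OF \<open>t \<ge> 0\<close>] \<open>j < k\<close> by (subst (asm) sum_nonneg_eq_0_iff) auto
      have "continuous_on {0..t + 1} s" unfolding s_def[abs_def] by (intro continuous_intros cH)
      then have "\<forall>\<tau>\<in>{0..t + 1}. s \<tau> = 0"
        using I0[of "t + 1"] integral_eq_0_iff[of 0 "t + 1" s] s0 \<open>t \<ge> 0\<close> by simp
      then have "s t = 0" using \<open>t \<ge> 0\<close> by simp
      then show "transpose B *v H j t = 0"
        using \<open>j < k\<close> unfolding s_def by (subst (asm) sum_nonneg_eq_0_iff) auto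
    qed
    obtain \<rho> c where \<rho>: "0 \<le> \<rho>" "\<rho> < 1" "c \<ge> 0"
      and est: "\<And>(x::real^'n) T f. T \<ge> 0 \<Longrightarrow> (\<And>t. f t = expm (- M) t *v x)
        \<Longrightarrow> (\<And>t. t \<in> {0..T} \<Longrightarrow> transpose B *v f t = 0)
        \<Longrightarrow> integral {0..T} (\<lambda>t. f t \<bullet> (Wa *v f t))
           \<le> \<rho> * integral {0..T} (\<lambda>t. f t \<bullet> (Wb *v f t)) + c * (norm (f T))\<^sup>2"
      using adjoint_estimate[OF A pos Q Qi(1) similar, of K] unfolding M_def Wa_def Wb_def by blast
    define sL where "sL W t = (\<Sum>j<k. L j t \<bullet> (W *v L j t))" for W t
    have fL: "(\<lambda>t. L j t \<bullet> (W *v L j t)) integrable_on {0..T}" for j W and T :: real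
      by (rule quadratic_form_integrable[OF cL])
    have fH: "(\<lambda>t. H j t \<bullet> (W *v H j t)) integrable_on {0..T}" for j W and T :: real
      by (rule quadratic_form_integrable[OF cH])
    have sL_int: "(sL W) integrable_on {0..T}" for W and T :: real
      unfolding sL_def[abs_def] by (intro integrable_sum fL) simp
    \<comment> \<open>The estimates for the solutions that start at time 0 in \<open>\<xi>\<^sub>j\<close>, and
      for those that start at time \<open>T - t\<close> in \<open>g\<^sub>j\<close> and so run for a time
      \<open>t\<close>. The squared norms of their final values add up to the trace of the stationary
      covariance, which does not grow with \<open>T\<close>.\<close>
    have est_L: "integral {0..T} (sL Wa) \<le> \<rho> * integral {0..T} (sL Wb) + c * sL (mat 1) T" if T: "T \<ge> 0" for T
    proof -
      have "(\<Sum>j<k. integral {0..T} (\<lambda>t. L j t \<bullet> (Wa *v L j t)))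
          \<le> (\<Sum>j<k. \<rho> * integral {0..T} (\<lambda>t. L j t \<bullet> (Wb *v L j t)) + c * (norm (L j T))\<^sup>2)"
        using BL by (intro sum_mono est[OF T]) (auto simp: L_def)
      then show ?thesis
        unfolding sL_def[abs_def]
        by (simp add: integral_sum fL sum.distrib sum_distrib_left power2_norm_eq_inner)
    qed
    have est_H: "\<alpha> - sL Wa t \<le> \<rho> * (\<beta> - sL Wb t) + c * (\<Sum>j<k. H j t \<bullet> (mat 1 *v H j t))" if t: "t \<ge> 0" for t
    proof -
      have i: "(\<Sum>j<k. integral {0..t} (\<lambda>t. H j t \<bullet> (W *v H j t))) = (\<Sum>j<k. \<xi> j \<bullet> (W *v \<xi> j)) - sL W t" for W
        using integral_unique[OF balance[OF t, of W]] by (simp add: integral_sum fH sL_def)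
      have "(\<Sum>j<k. integral {0..t} (\<lambda>t. H j t \<bullet> (Wa *v H j t)))
          \<le> (\<Sum>j<k. \<rho> * integral {0..t} (\<lambda>t. H j t \<bullet> (Wb *v H j t)) + c * (norm (H j t))\<^sup>2)"
        using BH by (intro sum_mono est[OF t]) (auto simp: H_def)
      then show ?thesis
        by (simp add: i sum.distrib sum_distrib_left[symmetric] \<alpha>_def \<beta>_def power2_norm_eq_inner)
    qed
    have growth: "T * \<alpha> \<le> \<rho> * (T * \<alpha>) + c * (\<Sum>j<k. \<xi> j \<bullet> (mat 1 *v \<xi> j))" if T: "T \<ge> 0" for T
    proof -
      note b1 = balance[OF T, of "mat 1"]
      have 1: "((\<lambda>t. \<alpha> - sL Wa t) has_integral T * \<alpha> - integral {0..T} (sL Wa)) {0..T}"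
        using has_integral_diff[OF has_integral_const_real[of \<alpha> 0 T] integrable_integral[OF sL_int]] T by simp
      have 2: "((\<lambda>t. \<beta> - sL Wb t) has_integral T * \<beta> - integral {0..T} (sL Wb)) {0..T}"
        using has_integral_diff[OF has_integral_const_real[of \<beta> 0 T] integrable_integral[OF sL_int]] T by simp
      have "T * \<alpha> - integral {0..T} (sL Wa) \<le> \<rho> * (T * \<beta> - integral {0..T} (sL Wb))
          + c * ((\<Sum>j<k. \<xi> j \<bullet> (mat 1 *v \<xi> j)) - sL (mat 1) T)"
        unfolding sL_def[of "mat 1"]
        by (rule has_integral_le[OF 1 has_integral_add[OF has_integral_mult_right[OF 2] has_integral_mult_right[OF b1]]])
           (use est_H in auto)
      then have "T * \<alpha> \<le> \<rho> * (T * \<beta>) + c * (\<Sum>j<k. \<xi> j \<bullet> (mat 1 *v \<xi> j))"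
        using est_L[OF T] by (simp add: algebra_simps)
      also have "\<rho> * (T * \<beta>) \<le> \<rho> * (T * \<alpha>)"
        using \<rho>(1) T \<beta>_le by (intro mult_left_mono) auto
      finally show ?thesis by simp
    qed
    have \<alpha>0: "\<alpha> = 0"
    proof (rule ccontr)
      assume "\<alpha> \<noteq> 0"
      moreover have "\<alpha> \<ge> 0" unfolding \<alpha>_def Wa using Qi(3) by (intro sum_nonneg) auto
      ultimately have \<alpha>: "\<alpha> > 0" by simp
      define r where "r = c * (\<Sum>j<k. \<xi> j \<bullet> (mat 1 *v \<xi> j))"
      have r: "r \<ge> 0" using \<rho>(3) by (simp add: r_def sum_nonneg)
      define T where "T = (r + 1) / ((1 - \<rho>) * \<alpha>)"
      have "T \<ge> 0" using r \<rho> \<alpha> by (simp add: T_def)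
      then have "(1 - \<rho>) * \<alpha> * T \<le> r" using growth[of T] by (simp add: r_def algebra_simps)
      moreover have "(1 - \<rho>) * \<alpha> * T = r + 1" using \<rho> \<alpha> by (simp add: T_def)
      ultimately show False by simp
    qed
    have v0: "v j = 0" if "j < k" for j
    proof -
      have "(\<Sum>j<k. (norm (v j))\<^sup>2) = 0" using v_le_\<alpha> \<alpha>0 by (simp add: order_antisym sum_nonneg)
      then show ?thesis using that by (subst (asm) sum_nonneg_eq_0_iff) auto
    qed
    have E0: "transpose E *v \<xi> j = 0" if "j < k" for j
    proof -
      have "(\<Sum>j<k. (transpose E *v \<xi> j) \<bullet> (Qi *v (transpose E *v \<xi> j))) = 0"
        using \<alpha>0 unfolding \<alpha>_def Wa .
      then have "(transpose E *v \<xi> j) \<bullet> (Qi *v (transpose E *v \<xi> j)) = 0"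
        using that Qi(3) by (subst (asm) sum_nonneg_eq_0_iff) auto
      then show ?thesis by (rule Qi(4))
    qed
    have w0: "w j = 0" if "j < k" for j
    proof -
      have "\<xi> j \<bullet> (E *v w j) = 0" if "j < k" for j
        using E0[OF that] by (simp only: transpose_mult_inner[symmetric] inner_zero_left)
      then have "(\<Sum>j<k. w j \<bullet> (Q *v w j)) \<le> 0"
        using S3 v0 by (simp add: sum_negf)
      moreover have "(\<Sum>j<k. \<delta> * (norm (w j))\<^sup>2) \<le> (\<Sum>j<k. w j \<bullet> (Q *v w j))" using Q by (intro sum_mono)
      moreover have nn: "0 \<le> \<delta> * (norm (w j))\<^sup>2" for j using pos(1) by simp
      ultimately have "(\<Sum>j<k. \<delta> * (norm (w j))\<^sup>2) = 0" by (meson order_antisym order_trans sum_nonneg)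
      then have "\<delta> * (norm (w j))\<^sup>2 = 0"
        using that nn by (subst (asm) sum_nonneg_eq_0_iff) auto
      then show ?thesis using pos(1) by simp
    qed
    have "(\<Sum>j<k. outer (\<xi> j) (transpose A *v \<xi> j) + outer (transpose A *v \<xi> j) (\<xi> j)) = (\<Sum>j<k. outer (g j) (g j))"
      unfolding S1[symmetric] using v0 by (intro sum.cong) (auto simp: bz add.commute simp del: transpose_matrix_vector)
    from hurwitz_no_growing_gramian[OF hurwitz_transpose[OF A] this]
    have \<xi>0: "\<xi> j = 0" if "j < k" for j using that .
    then have "(\<Sum>j<k. outer (g j) (g j)) = 0" unfolding S1[symmetric] by simp
    then have "(\<Sum>j<k. mat 1 \<bullet> outer (g j) (g j)) = 0" by (simp flip: inner_sum_right)
    then have "(\<Sum>j<k. (norm (g j))\<^sup>2) = 0" by (simp add: inner_outer power2_norm_eq_inner)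
    then have "(norm (g j))\<^sup>2 = 0" if "j < k" for j
      using that by (subst (asm) sum_nonneg_eq_0_iff) auto
    then have "z j = 0" if "j < k" for j
      using that \<xi>0 v0 w0 by (simp add: zj zero_prod_def)
    then show False using z(1) by simp
  qed
  then obtain Y where Y: "\<And>z. z \<noteq> 0 \<Longrightarrow> q z + Y \<bullet> l z < 0" by blast
  obtain X0 F where XF: "Y = (X0, F)" by (cases Y)
  \<comment> \<open>Only the symmetric part of the parameter enters the form.\<close>
  define X where "X = (1 / 2) *\<^sub>R (X0 + transpose X0)"
  have X0: "a \<bullet> (X0 *v b) + b \<bullet> (X0 *v a) = 2 * (a \<bullet> (X *v b))" for a b
    by (simp add: X_def matrix_vector_mult_add_rdistrib inner_add_right inner_transpose_mult
        scaleR_matrix_vector_assoc[symmetric] del: transpose_matrix_vector)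
  have "pos_definite X"
    unfolding pos_definite_def
  proof safe
    show "transpose X = X" by (simp add: X_def transpose_def vec_eq_iff)
    show "0 < g \<bullet> (X *v g)" if "g \<noteq> 0" for g
      using Y[of "(0, 0, 0, g)"] X0[of g g] that
      by (simp add: q_def l_def b_def XF inner_outer inner_diff_right zero_prod_def inner_add_right)
  qed
  moreover have "lmi_form A B E C Q X F z < 0" if "z \<noteq> 0" for z
  proof -
    obtain \<xi> w v where z: "z = (\<xi>, w, v)" by (cases z)
    have "q (\<xi>, w, v, 0) + Y \<bullet> l (\<xi>, w, v, 0) < 0" using that z by (intro Y) (auto simp: zero_prod_def)
    moreover have "Y \<bullet> l (\<xi>, w, v, 0) = 2 * ((transpose A *v \<xi> + transpose C *v v) \<bullet> (X *v \<xi>))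
        + 2 * ((transpose B *v \<xi>) \<bullet> (F *v \<xi>))"
      using X0[of "transpose A *v \<xi> + transpose C *v v" \<xi>]
      by (simp add: l_def XF b_def inner_outer inner_add_right inner_diff_right del: transpose_matrix_vector)
    ultimately show ?thesis
      unfolding z lmi_form_def q_def
      by (simp add: inner_add_left inner_add_right transpose_mult_inner del: transpose_matrix_vector)
  qed
  ultimately show ?thesis by blast
qed

section \<open>The joint system of two systems\<close>

text \<open>The two blocks of a vector over a sum type.\<close>

definition vfst :: "'a^('m::finite + 'n::finite) \<Rightarrow> 'a^'m" where "vfst z = (\<chi> i. z $ Inl i)"
definition vsnd :: "'a^('m::finite + 'n::finite) \<Rightarrow> 'a^'n" where "vsnd z = (\<chi> i. z $ Inr i)"

lemma vec_append_nth [simp]: "vec_append x y $ Inl a = x $ a" "vec_append x y $ Inr b = y $ b"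
  by (simp_all add: vec_append_def)

lemma vec_append_eqI: "(\<And>a. u $ Inl a = v $ Inl a) \<Longrightarrow> (\<And>b. u $ Inr b = v $ Inr b) \<Longrightarrow> u = v"
  unfolding vec_eq_iff by (metis sum.exhaust)

lemma vfst_append [simp]: "vfst (vec_append x y) = x" and vsnd_append [simp]: "vsnd (vec_append x y) = y"
  by (simp_all add: vfst_def vsnd_def vec_eq_iff)

lemma vec_append_split: "vec_append (vfst z) (vsnd z) = z"
  by (rule vec_append_eqI) (simp_all add: vfst_def vsnd_def)

lemma vec_append_add: "vec_append (a + b) (c + d) = vec_append a c + vec_append b (d :: real^'n)"
  by (rule vec_append_eqI) simp_all

lemma vec_append_0 [simp]: "vec_append 0 0 = (0 :: real^('m::finite + 'n::finite))"
  by (rule vec_append_eqI) simp_all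

lemma sum_UNIV_plus: "(\<Sum>i\<in>UNIV. f i) = (\<Sum>a\<in>UNIV. f (Inl a)) + (\<Sum>b\<in>UNIV. f (Inr b))"
  for f :: "'a::finite + 'b::finite \<Rightarrow> 'c::comm_monoid_add"
  unfolding UNIV_Plus_UNIV[symmetric] by (subst sum.Plus) simp_all

lemma inner_vec_append [simp]: "vec_append a b \<bullet> vec_append c d = a \<bullet> c + b \<bullet> (d :: real^'n)"
  by (simp add: inner_vec_def sum_UNIV_plus)

lemma vcat_mult [simp]: "vcat M N *v x = vec_append (M *v x) (N *v (x :: real^'n))"
  by (rule vec_append_eqI) (simp_all add: matrix_vector_mult_def)

lemma hcat_mult [simp]: "hcat M N *v vec_append a b = M *v a + N *v (b :: real^'n)"
  by (simp add: vec_eq_iff hcat_def matrix_vector_mult_def sum_UNIV_plus)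

lemma block2_mult [simp]:
  "block2 M11 M12 M21 M22 *v vec_append a b = vec_append (M11 *v a + M12 *v b) (M21 *v a + M22 *v (b :: real^'n))"
  by (simp add: block2_def)

lemma block3_mult:
  "block3 M11 M12 M13 M21 M22 M23 M31 M32 M33 *v vec_append a (vec_append b c)
   = vec_append (M11 *v a + (M12 *v b + M13 *v c))
       (vec_append (M21 *v a + (M22 *v b + M23 *v c)) (M31 *v a + (M32 *v b + M33 *v (c :: real^'n))))"
  by (simp add: block3_def)

lemma vec_append_linear:
  "bounded_linear (\<lambda>a :: real^'m. vec_append a (0 :: real^'n))"
  "bounded_linear (\<lambda>b :: real^'n. vec_append (0 :: real^'m) b)"
  "bounded_linear (vfst :: real^('m::finite + 'n::finite) \<Rightarrow> real^'m)"
  "bounded_linear (vsnd :: real^('m::finite + 'n::finite) \<Rightarrow> real^'n)"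
  unfolding linear_conv_bounded_linear[symmetric]
  by (auto intro!: linearI vec_append_eqI simp: vfst_def vsnd_def vec_eq_iff)

lemma symmetric_iff: "transpose M = M \<longleftrightarrow> (\<forall>a b. a \<bullet> (M *v b) = b \<bullet> (M *v a))" for M :: "real^'n^'n"
proof
  show "transpose M = M \<Longrightarrow> \<forall>a b. a \<bullet> (M *v b) = b \<bullet> (M *v a)"
    by (metis inner_transpose_mult)
  assume *: "\<forall>a b. a \<bullet> (M *v b) = b \<bullet> (M *v a)"
  have "axis i 1 \<bullet> (M *v axis j 1) = M $ i $ j" for i j
    by (simp add: inner_axis' matrix_vector_mult_basis column_def)
  then show "transpose M = M" using * by (metis (no_types, lifting) transpose_def vec_eq_iff vec_lambda_beta)
qed

lemma hurwitz_A_joint: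
  fixes S1 :: "('n1::finite, 'm::finite, 'q1::finite, 'p::finite) lti"
    and S2 :: "('n2::finite, 'm, 'q2::finite, 'p) lti"
  assumes "hurwitz (matA S1)" and "hurwitz (matA S2)"
  shows "hurwitz (A_joint S1 S2)"
  unfolding hurwitz_def
proof safe
  fix z and v :: "complex^('n1 + 'n2)"
  assume v: "v \<noteq> 0" "map_matrix complex_of_real (A_joint S1 S2) *v v = z *s v"
  have "map_matrix complex_of_real (matA S1) *v vfst v = vfst (map_matrix complex_of_real (A_joint S1 S2) *v v)"
    by (simp add: vec_eq_iff vfst_def matrix_vector_mult_def map_matrix_def sum_UNIV_plus A_joint_def
        block2_def hcat_def)
  then have 1: "map_matrix complex_of_real (matA S1) *v vfst v = z *s vfst v"
    unfolding v(2) by (simp add: vfst_def vec_eq_iff)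
  have "map_matrix complex_of_real (matA S2) *v vsnd v = vsnd (map_matrix complex_of_real (A_joint S1 S2) *v v)"
    by (simp add: vec_eq_iff vsnd_def matrix_vector_mult_def map_matrix_def sum_UNIV_plus A_joint_def
        block2_def hcat_def)
  then have 2: "map_matrix complex_of_real (matA S2) *v vsnd v = z *s vsnd v"
    unfolding v(2) by (simp add: vsnd_def vec_eq_iff)
  have "vfst v \<noteq> 0 \<or> vsnd v \<noteq> 0"
  proof (rule ccontr)
    assume "\<not> (vfst v \<noteq> 0 \<or> vsnd v \<noteq> 0)"
    then have "v = 0" by (intro vec_append_eqI) (simp_all add: vfst_def vsnd_def vec_eq_iff)
    then show False using v(1) by simp
  qed
  then show "Re z < 0" using 1 2 assms by (auto simp: hurwitz_def)
qed

text \<open>The systems run side by side are the joint system.\<close>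

lemma caratheodory_append:
  fixes S1 :: "('n1::finite, 'm::finite, 'q1::finite, 'p::finite) lti"
    and S2 :: "('n2::finite, 'm, 'q2::finite, 'p) lti"
  shows "caratheodory (A_joint S1 S2) (\<lambda>s. vec_append (f1 s) (f2 s)) 0 (\<lambda>t. vec_append (x1 t) (x2 t))
   \<longleftrightarrow> caratheodory (matA S1) f1 0 x1 \<and> caratheodory (matA S2) f2 0 x2" (is "?l \<longleftrightarrow> ?r")
proof -
  let ?g1 = "\<lambda>s. matA S1 *v x1 s + f1 s" and ?g2 = "\<lambda>s. matA S2 *v x2 s + f2 s"
  let ?g = "\<lambda>s. A_joint S1 S2 *v vec_append (x1 s) (x2 s) + vec_append (f1 s) (f2 s)"
  have g: "?g s = vec_append (?g1 s) (?g2 s)" for s by (simp add: A_joint_def vec_append_add)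
  have g': "?g s = vec_append (?g1 s) 0 + vec_append 0 (?g2 s)" for s
    unfolding g by (simp flip: vec_append_add)
  have int: "?g absolutely_integrable_on {0..t} \<longleftrightarrow>
      ?g1 absolutely_integrable_on {0..t} \<and> ?g2 absolutely_integrable_on {0..t}" for t
  proof safe
    assume "?g absolutely_integrable_on {0..t}"
    from absolutely_integrable_linear[OF this vec_append_linear(3)] absolutely_integrable_linear[OF this vec_append_linear(4)]
    show "?g1 absolutely_integrable_on {0..t}" "?g2 absolutely_integrable_on {0..t}"
      unfolding g by (simp_all add: o_def)
  next
    assume 1: "?g1 absolutely_integrable_on {0..t}" and 2: "?g2 absolutely_integrable_on {0..t}"
    have "(\<lambda>s. vec_append (?g1 s) 0 + vec_append 0 (?g2 s)) absolutely_integrable_on {0..t}"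
      using absolutely_integrable_linear[OF 1 vec_append_linear(1)] absolutely_integrable_linear[OF 2 vec_append_linear(2)]
      by (intro set_integral_add(1)) (simp_all add: o_def)
    then show "?g absolutely_integrable_on {0..t}" unfolding g' .
  qed
  have "integral {0..t} ?g = vec_append (integral {0..t} ?g1) (integral {0..t} ?g2)"
    if "?g absolutely_integrable_on {0..t}" for t
  proof -
    have i: "?g integrable_on {0..t}" using that by (simp add: absolutely_integrable_on_def)
    have "vfst (integral {0..t} ?g) = integral {0..t} ?g1"
      using integral_linear[OF i vec_append_linear(3)] unfolding g by (simp add: o_def)
    moreover have "vsnd (integral {0..t} ?g) = integral {0..t} ?g2"
      using integral_linear[OF i vec_append_linear(4)] unfolding g by (simp add: o_def)
    ultimately show ?thesis using vec_append_split[of "integral {0..t} ?g"] by (simp only:)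
  qed
  moreover have "vec_append a b = vec_append c d \<longleftrightarrow> a = c \<and> b = d" for a c :: "real^'n1" and b d :: "real^'n2"
    by (metis vfst_append vsnd_append)
  ultimately show ?thesis
    unfolding caratheodory_def using int by auto
qed

lemma L2_cong:
  assumes "\<And>t. t \<ge> 0 \<Longrightarrow> u t = v t"
  shows "u \<in> L2 \<longleftrightarrow> v \<in> L2" and "L2_norm u = L2_norm v"
proof -
  have "u \<in> borel_measurable (lebesgue_on {0..}) \<longleftrightarrow> v \<in> borel_measurable (lebesgue_on {0..})"
    by (rule measurable_cong) (use assms in simp)
  moreover have "(\<lambda>t. (norm (u t))\<^sup>2) integrable_on {0..} \<longleftrightarrow> (\<lambda>t. (norm (v t))\<^sup>2) integrable_on {0..}"
    by (rule integrable_cong) (use assms in simp)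
  ultimately show "u \<in> L2 \<longleftrightarrow> v \<in> L2" by (simp add: L2_iff)
  have "integral\<^sup>L (lebesgue_on {0..}) (\<lambda>t. (norm (u t))\<^sup>2) = integral\<^sup>L (lebesgue_on {0..}) (\<lambda>t. (norm (v t))\<^sup>2)"
    by (rule Bochner_Integration.integral_cong) (use assms in auto)
  then show "L2_norm u = L2_norm v" by (simp add: L2_norm_def)
qed

lemma L2_append: "u \<in> L2 \<Longrightarrow> v \<in> L2 \<Longrightarrow> (\<lambda>t. vec_append (u t) (v t)) \<in> L2"
  using L2_add[OF L2_bounded_linear[OF vec_append_linear(1)] L2_bounded_linear[OF vec_append_linear(2)]]
  by (simp flip: vec_append_add)

lemma mat_mult_vec: "mat c *v x = c *\<^sub>R (x :: real^'n)"
  by (simp add: vec_eq_iff matrix_vector_mult_def mat_def if_distrib if_distribR cong: if_cong)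

text \<open>The matrix \<open>Q_bar\<close> is that of the supply rate \<open>\<gamma> |a - b|\<^sup>2 + \<delta> (|a|\<^sup>2 + |b|\<^sup>2)\<close> in the definition of similarity.\<close>

lemma Q_bar_form:
  "vec_append a b \<bullet> (Q_bar \<gamma> \<delta> *v vec_append a b) = \<gamma> * (norm (a - b))\<^sup>2 + \<delta> * (norm (vec_append a b))\<^sup>2"
  by (simp add: Q_bar_def mat_mult_vec power2_norm_eq_inner inner_diff_left inner_diff_right inner_add_right
      inner_commute algebra_simps)

lemma Q_bar_symmetric: "transpose (Q_bar \<gamma> \<delta>) = (Q_bar \<gamma> \<delta> :: real^('m::finite + 'm)^('m + 'm))"
proof -
  have "vec_append a b \<bullet> (Q_bar \<gamma> \<delta> *v vec_append c d) = vec_append c d \<bullet> (Q_bar \<gamma> \<delta> *v vec_append a b)"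
    for a b c d :: "real^'m"
    by (simp add: Q_bar_def mat_mult_vec inner_add_right inner_diff_right inner_commute algebra_simps)
  from this[of "vfst x" "vsnd x" "vfst y" "vsnd y" for x y] show ?thesis
    unfolding symmetric_iff by (simp add: vec_append_split)
qed

lemma Q_bar_integral:
  assumes u: "u1 \<in> L2" "u2 \<in> L2"
  defines "w \<equiv> \<lambda>t. vec_append (u1 t) (u2 t)"
  shows "integral {0..} (\<lambda>t. w t \<bullet> (Q_bar \<gamma> \<delta> *v w t)) = \<gamma> * (L2_norm (\<lambda>t. u1 t - u2 t))\<^sup>2 + \<delta> * (L2_norm w)\<^sup>2"
proof -
  have d: "(\<lambda>t. u1 t - u2 t) \<in> L2" by (rule L2_diff[OF u])
  have w: "w \<in> L2" unfolding w_def by (rule L2_append[OF u])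
  show ?thesis
    using integrable_on_mult_right[OF L2_square_integrable[OF d], of \<gamma>]
      integrable_on_mult_right[OF L2_square_integrable[OF w], of \<delta>]
    unfolding L2_norm_squared[OF d] L2_norm_squared[OF w]
    by (simp add: w_def Q_bar_form Henstock_Kurzweil_Integration.integral_add)
qed

lemma neg_definite_iff_lmi_form:
  fixes A X :: "real^'n^'n" and B :: "real^'q^'n" and E :: "real^'m^'n" and C :: "real^'n^'p"
  assumes X: "transpose X = X" and Q: "transpose Q = Q"
  shows "neg_definite (block3
       (X ** transpose A + A ** X + transpose F ** transpose B + B ** F) E (X ** transpose C)
       (transpose E) (- Q) 0
       (C ** X) 0 (- mat 1))
    \<longleftrightarrow> (\<forall>z. z \<noteq> 0 \<longrightarrow> lmi_form A B E C Q X F z < 0)" (is "neg_definite ?M \<longleftrightarrow> _")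
proof -
  have sX: "a \<bullet> (X *v b) = b \<bullet> (X *v a)" for a b using X symmetric_iff by blast
  have sQ: "a \<bullet> (Q *v b) = b \<bullet> (Q *v a)" for a b using Q symmetric_iff by blast
  have M: "vec_append \<xi> (vec_append w v) \<bullet> (?M *v vec_append \<xi>' (vec_append w' v'))
      = (A *v (X *v \<xi>)) \<bullet> \<xi>' + \<xi> \<bullet> (A *v (X *v \<xi>')) + (F *v \<xi>) \<bullet> (transpose B *v \<xi>') + (transpose B *v \<xi>) \<bullet> (F *v \<xi>')
        + \<xi> \<bullet> (E *v w') + \<xi>' \<bullet> (E *v w) + (C *v (X *v \<xi>)) \<bullet> v' + v \<bullet> (C *v (X *v \<xi>')) - w \<bullet> (Q *v w') - v \<bullet> v'"
    for \<xi> \<xi>' :: "real^'n" and w w' :: "real^'m" and v v' :: "real^'p"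
  proof -
    have "\<xi> \<bullet> (X *v (transpose A *v \<xi>')) = (A *v (X *v \<xi>)) \<bullet> \<xi>'"
      unfolding sX[of \<xi>] transpose_mult_inner by (rule inner_commute)
    moreover have "\<xi> \<bullet> (X *v (transpose C *v v')) = (C *v (X *v \<xi>)) \<bullet> v'"
      unfolding sX[of \<xi>] transpose_mult_inner by (rule inner_commute)
    moreover have "\<xi> \<bullet> (transpose F *v (transpose B *v \<xi>')) = (F *v \<xi>) \<bullet> (transpose B *v \<xi>')"
      by (metis inner_transpose_mult inner_commute)
    moreover have "\<xi> \<bullet> (B *v (F *v \<xi>')) = (transpose B *v \<xi>) \<bullet> (F *v \<xi>')"
      by (rule transpose_mult_inner[symmetric])
    moreover have "w \<bullet> (transpose E *v \<xi>') = \<xi>' \<bullet> (E *v w)" by (rule inner_transpose_mult)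
    ultimately show ?thesis
      by (simp add: block3_mult matrix_vector_mult_add_rdistrib matrix_vector_mul_assoc[symmetric]
          inner_add_right inner_diff_right bounded_bilinear.minus_left[OF bounded_bilinear_matrix_vector] del: transpose_matrix_vector)
  qed
  have split: "\<exists>\<xi> w v. u = vec_append \<xi> (vec_append w v)" for u :: "real^('n + 'm + 'p)"
    by (rule exI[of _ "vfst u"], rule exI[of _ "vfst (vsnd u)"], rule exI[of _ "vsnd (vsnd u)"])
      (simp only: vec_append_split)
  have "transpose ?M = ?M"
    unfolding symmetric_iff
  proof (intro allI)
    fix a b :: "real^('n + 'm + 'p)"
    obtain \<xi> w v where a: "a = vec_append \<xi> (vec_append w v)" using split by blast
    obtain \<xi>' w' v' where b: "b = vec_append \<xi>' (vec_append w' v')" using split by blast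
    show "a \<bullet> (?M *v b) = b \<bullet> (?M *v a)"
      unfolding a b M sQ[of w w'] by (simp add: inner_commute)
  qed
  moreover have form: "vec_append \<xi> (vec_append w v) \<bullet> (?M *v vec_append \<xi> (vec_append w v)) = lmi_form A B E C Q X F (\<xi>, w, v)"
    for \<xi> w v
    unfolding M lmi_form_def by (simp add: transpose_mult_inner inner_add_right inner_commute del: transpose_matrix_vector)
      (metis inner_commute transpose_mult_inner)
  moreover have "vec_append \<xi> (vec_append w v) = 0 \<longleftrightarrow> (\<xi>, w, v) = 0" for \<xi> :: "real^'n" and w :: "real^'m" and v :: "real^'p"
    unfolding zero_prod_def by (metis prod.inject vec_append_0 vfst_append vsnd_append)
  ultimately show ?thesis
    unfolding neg_definite_def by (metis split prod_cases3)
qed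

theorem theorem3:
  fixes S1 :: "('n1::finite, 'm::finite, 'q1::finite, 'p::finite) lti"
    and S2 :: "('n2::finite, 'm, 'q2::finite, 'p) lti"
    and \<gamma> \<delta> :: real
  assumes "zero_asymptotically_stable S1"
    and "zero_asymptotically_stable S2"
    and "\<gamma> > 0"
    and "\<delta> > 0"
  shows "similar_to \<gamma> \<delta> S2 S1 \<longleftrightarrow>
    (\<exists>(X :: real^('n1 + 'n2)^('n1 + 'n2)) (P :: real^('n1 + 'n2)^'q2).
       pos_definite X \<and>
       neg_definite (block3
         (X ** transpose (A_joint S1 S2) + A_joint S1 S2 ** X
            + transpose P ** transpose (B_joint S1 S2) + B_joint S1 S2 ** P)
         (E_bar S1 S2)
         (X ** transpose (C_bar S1 S2))

         (transpose (E_bar S1 S2))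
         (- Q_bar \<gamma> \<delta>)
         0

         (C_bar S1 S2 ** X)
         0
         (- mat 1)))"
proof -
  let ?A = "A_joint S1 S2" and ?B = "B_joint S1 S2" and ?E = "E_bar S1 S2" and ?C = "C_bar S1 S2"
  let ?Q = "Q_bar \<gamma> \<delta> :: real^('m + 'm)^('m + 'm)" and ?D = "vcat (matE S1) 0 :: real^'q1^('n1 + 'n2)"
  define f1 where "f1 u1 d1 s = matB S1 *v u1 s + matE S1 *v d1 s" for u1 :: "real \<Rightarrow> real^'m" and d1 :: "real \<Rightarrow> real^'q1" and s :: real
  define f2 where "f2 u2 d2 s = matB S2 *v u2 s + matE S2 *v d2 s" for u2 :: "real \<Rightarrow> real^'m" and d2 :: "real \<Rightarrow> real^'q2" and s :: real
  have forcing: "?B *v d2 s + ?E *v vec_append (u1 s) (u2 s) + ?D *v d1 s = vec_append (f1 u1 d1 s) (f2 u2 d2 s)"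
    for u1 u2 d1 d2 and s :: real
    by (simp add: B_joint_def E_bar_def f1_def f2_def add.commute flip: vec_append_add)
  have output_diff: "output_at S1 0 0 u1 d1 t - output_at S2 0 0 u2 d2 t = ?C *v vec_append (x1 t) (x2 t)"
    if "caratheodory (matA S1) (f1 u1 d1) 0 x1" "caratheodory (matA S2) (f2 u2 d2) 0 x2" "t \<ge> 0"
    for u1 u2 d1 d2 x1 x2 t
    using state_at_eq[of S1 0 u1 d1 x1 t] state_at_eq[of S2 0 u2 d2 x2 t] that
    by (simp add: state_trajectory_iff_caratheodory f1_def[abs_def] f2_def[abs_def] output_at_def C_bar_def
        bounded_bilinear.minus_left[OF bounded_bilinear_matrix_vector])
  have Q_low: "\<delta> * (norm w)\<^sup>2 \<le> w \<bullet> (?Q *v w)" for w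
    using Q_bar_form[of "vfst w" "vsnd w" \<gamma> \<delta>] \<open>\<gamma> > 0\<close> by (simp add: vec_append_split)
  show ?thesis
  proof
    assume "similar_to \<gamma> \<delta> S2 S1"
    then obtain \<epsilon> \<eta> \<mu> where pos: "\<epsilon> > 0" "\<eta> > 0" and sim: "\<And>u1 u2 d1. u1 \<in> L2 \<Longrightarrow> u2 \<in> L2 \<Longrightarrow> d1 \<in> L2 \<Longrightarrow>
        \<exists>d2\<in>L2. (\<lambda>t. output_at S1 0 0 u1 d1 t - output_at S2 0 0 u2 d2 t) \<in> L2 \<and>
          (L2_norm (\<lambda>t. output_at S1 0 0 u1 d1 t - output_at S2 0 0 u2 d2 t))\<^sup>2
            \<le> \<gamma> * (L2_norm (\<lambda>t. u1 t - u2 t))\<^sup>2 + (\<delta> - \<epsilon>) * (L2_norm (\<lambda>t. vec_append (u1 t) (u2 t)))\<^sup>2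
              + (\<mu> - \<epsilon>) * (L2_norm d1)\<^sup>2 - \<eta> * (L2_norm d2)\<^sup>2"
      unfolding similar_to_def Let_def by blast
    have "\<exists>X F. pos_definite X \<and> (\<forall>z. z \<noteq> 0 \<longrightarrow> lmi_form ?A ?B ?E ?C ?Q X F z < 0)"
    proof (rule lmi_necessary[OF hurwitz_A_joint \<open>\<delta> > 0\<close> pos Q_bar_symmetric Q_low])
      show "hurwitz (matA S1)" "hurwitz (matA S2)"
        using assms by (simp_all add: zero_asymptotically_stable_def)
      fix w :: "real \<Rightarrow> real^('m + 'm)" assume w: "w \<in> L2"
      define u1 where "u1 t = vfst (w t)" for t
      define u2 where "u2 t = vsnd (w t)" for t
      \<comment> \<open>Necessity already follows from the signals without a disturbance of the first
        system.\<close>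
      define d1 :: "real \<Rightarrow> real^'q1" where "d1 t = 0" for t
      have w_eq: "w t = vec_append (u1 t) (u2 t)" for t by (simp add: u1_def u2_def vec_append_split)
      have u: "u1 \<in> L2" "u2 \<in> L2"
        unfolding u1_def[abs_def] u2_def[abs_def] by (rule L2_bounded_linear[OF vec_append_linear(3) w])
          (rule L2_bounded_linear[OF vec_append_linear(4) w])
      have d1: "d1 \<in> L2" "L2_norm d1 = 0" by (simp_all add: d1_def[abs_def] L2_iff L2_norm_def integrable_0)
      obtain d2 where d2: "d2 \<in> L2"
        and e: "(\<lambda>t. output_at S1 0 0 u1 d1 t - output_at S2 0 0 u2 d2 t) \<in> L2"
        and le: "(L2_norm (\<lambda>t. output_at S1 0 0 u1 d1 t - output_at S2 0 0 u2 d2 t))\<^sup>2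
            \<le> \<gamma> * (L2_norm (\<lambda>t. u1 t - u2 t))\<^sup>2 + (\<delta> - \<epsilon>) * (L2_norm (\<lambda>t. vec_append (u1 t) (u2 t)))\<^sup>2
              + (\<mu> - \<epsilon>) * (L2_norm d1)\<^sup>2 - \<eta> * (L2_norm d2)\<^sup>2"
        using sim[OF u d1(1)] by blast
      have "f1 u1 d1 \<in> L2" "f2 u2 d2 \<in> L2"
        unfolding f1_def[abs_def] f2_def[abs_def] by (intro L2_add L2_matrix u d1(1) d2)+
      then obtain x1 x2 where x: "caratheodory (matA S1) (f1 u1 d1) 0 x1" "caratheodory (matA S2) (f2 u2 d2) 0 x2"
        using caratheodory_exists L2_locally_integrable by metis
      define x where "x t = vec_append (x1 t) (x2 t)" for t
      have "vec_append (f1 u1 d1 s) (f2 u2 d2 s) = ?B *v d2 s + ?E *v w s" for s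
        using forcing[where ?d1.0 = d1, of d2 s u1 u2] by (simp add: d1_def w_eq)
      then have cx: "caratheodory ?A (\<lambda>s. ?B *v d2 s + ?E *v w s) 0 x"
        using caratheodory_append[of S1 S2 "f1 u1 d1" "f2 u2 d2" x1 x2] x by (simp add: x_def[abs_def])
      have Cx: "output_at S1 0 0 u1 d1 t - output_at S2 0 0 u2 d2 t = ?C *v x t" if "t \<ge> 0" for t
        unfolding x_def using x that by (rule output_diff)
      show "\<exists>d x. d \<in> L2 \<and> caratheodory ?A (\<lambda>s. ?B *v d s + ?E *v w s) 0 x \<and> (\<lambda>t. ?C *v x t) \<in> L2 \<and>
          (L2_norm (\<lambda>t. ?C *v x t))\<^sup>2 + \<eta> * (L2_norm d)\<^sup>2
            \<le> integral {0..} (\<lambda>t. w t \<bullet> (?Q *v w t)) - \<epsilon> * (L2_norm w)\<^sup>2"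
        using d2 cx e le d1(2) L2_cong[OF Cx] Q_bar_integral[OF u, of \<gamma> \<delta>]
        by (intro exI[of _ d2] exI[of _ x]) (simp add: w_eq[symmetric] algebra_simps)
    qed
    then show "\<exists>X P. pos_definite X \<and> neg_definite (block3
         (X ** transpose ?A + ?A ** X + transpose P ** transpose ?B + ?B ** P) ?E (X ** transpose ?C)
         (transpose ?E) (- ?Q) 0 (?C ** X) 0 (- mat 1))"
      using neg_definite_iff_lmi_form[OF _ Q_bar_symmetric] unfolding pos_definite_def by metis
  next
    assume "\<exists>X P. pos_definite X \<and> neg_definite (block3
         (X ** transpose ?A + ?A ** X + transpose P ** transpose ?B + ?B ** P) ?E (X ** transpose ?C)
         (transpose ?E) (- ?Q) 0 (?C ** X) 0 (- mat 1))"
    then obtain X F where X: "pos_definite X" and "\<And>z. z \<noteq> 0 \<Longrightarrow> lmi_form ?A ?B ?E ?C ?Q X F z < 0"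
      using neg_definite_iff_lmi_form[OF _ Q_bar_symmetric] unfolding pos_definite_def by metis
    then obtain \<kappa> \<mu> \<eta> where pos: "\<kappa> > 0" "\<mu> > 0" "\<eta> > 0"
      and diss: "\<And>w d. w \<in> L2 \<Longrightarrow> d \<in> L2 \<Longrightarrow> \<exists>x u. u \<in> L2
        \<and> caratheodory ?A (\<lambda>s. ?B *v u s + ?E *v w s + ?D *v d s) 0 x \<and> (\<lambda>t. ?C *v x t) \<in> L2
        \<and> (L2_norm (\<lambda>t. ?C *v x t))\<^sup>2 \<le> integral {0..} (\<lambda>t. w t \<bullet> (?Q *v w t)) - \<kappa> * (L2_norm w)\<^sup>2
             + \<mu> * (L2_norm d)\<^sup>2 - \<eta> * (L2_norm u)\<^sup>2"
      using lmi_sufficient[OF X, of ?A ?B ?E ?C ?Q F ?D] by blast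
    show "similar_to \<gamma> \<delta> S2 S1"
      unfolding similar_to_def Let_def
    \<comment> \<open>The weight \<open>\<mu> + \<kappa>\<close> makes room for the \<open>\<epsilon> =
      \<kappa>\<close> that is subtracted from it.\<close>
    proof (rule exI[of _ \<kappa>], rule conjI[OF pos(1)], rule exI[of _ \<eta>], rule conjI[OF pos(3)],
        rule exI[of _ "\<mu> + \<kappa>"], rule conjI[OF add_pos_pos[OF pos(2,1)]], intro ballI)
      fix u1 u2 :: "real \<Rightarrow> real^'m" and d1 :: "real \<Rightarrow> real^'q1"
      assume u: "u1 \<in> L2" "u2 \<in> L2" and d1: "d1 \<in> L2"
      define w where "w t = vec_append (u1 t) (u2 t)" for t
      have w: "w \<in> L2" unfolding w_def[abs_def] by (rule L2_append[OF u])
      obtain x d2 where d2: "d2 \<in> L2" and x: "caratheodory ?A (\<lambda>s. ?B *v d2 s + ?E *v w s + ?D *v d1 s) 0 x"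
        and Cx: "(\<lambda>t. ?C *v x t) \<in> L2"
        and le: "(L2_norm (\<lambda>t. ?C *v x t))\<^sup>2 \<le> integral {0..} (\<lambda>t. w t \<bullet> (?Q *v w t)) - \<kappa> * (L2_norm w)\<^sup>2
             + \<mu> * (L2_norm d1)\<^sup>2 - \<eta> * (L2_norm d2)\<^sup>2"
        using diss[OF w d1] by blast
      have "caratheodory ?A (\<lambda>s. vec_append (f1 u1 d1 s) (f2 u2 d2 s)) 0 (\<lambda>t. vec_append (vfst (x t)) (vsnd (x t)))"
        using x unfolding w_def forcing vec_append_split .
      then have x12: "caratheodory (matA S1) (f1 u1 d1) 0 (\<lambda>t. vfst (x t))"
          "caratheodory (matA S2) (f2 u2 d2) 0 (\<lambda>t. vsnd (x t))"
        unfolding caratheodory_append by auto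
      have out: "output_at S1 0 0 u1 d1 t - output_at S2 0 0 u2 d2 t = ?C *v x t" if "t \<ge> 0" for t
        using output_diff[OF x12 that] by (simp add: vec_append_split)
      show "\<exists>d2\<in>L2. (\<lambda>t. output_at S1 0 0 u1 d1 t - output_at S2 0 0 u2 d2 t) \<in> L2 \<and>
          (L2_norm (\<lambda>t. output_at S1 0 0 u1 d1 t - output_at S2 0 0 u2 d2 t))\<^sup>2
            \<le> \<gamma> * (L2_norm (\<lambda>t. u1 t - u2 t))\<^sup>2 + (\<delta> - \<kappa>) * (L2_norm (\<lambda>t. vec_append (u1 t) (u2 t)))\<^sup>2
              + (\<mu> + \<kappa> - \<kappa>) * (L2_norm d1)\<^sup>2 - \<eta> * (L2_norm d2)\<^sup>2"
        using d2 Cx le L2_cong[OF out] Q_bar_integral[OF u, of \<gamma> \<delta>]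
        by (intro bexI[of _ d2]) (simp_all add: w_def[abs_def] algebra_simps)
    qed
  qed
qed

end
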